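(* Let $g$ be a Riemannian metric on $Q$, $L(v)=\frac12g(v,v)$, $\mathcal{D}$ a distribution on $Q$, let $\exp^{nh}_q$ ($q\in Q$) be the nonholonomic exponential map of the purely kinetic nonholonomic system $(L,\mathcal{D})$, and let $\hat g$ be a Riemannian metric on $Q$ which is a $\mathcal{D}$-preserving modification of $g$. If, for all $q\in Q$, $\mathcal{G}^0=(\exp^{nh}_q)^*\hat g$ satisfies the Gauss-type condition $$\mathcal{G}^0_{v_q}(v_q,u_q)=\mathcal{G}^0_{0_q}(v_q,u_q),\qquad\forall v_q,u_q\in\mathcal{D}_q,$$ or, equivalently, $$\hat g_{\exp^{nh}_q(v_q)}\left(T_{v_q}(\exp^{nh}_q)(v_q),T_{v_q}(\exp^{nh}_q)(u_q)\right)=\hat g_q(v_q,u_q),$$ then the condition $$(A)\quad \hat g_{bk}R^k_{ac}v^av^b=0\ \text{ for all } c \text{ and all } v^a$$ is satisfied for $\hat g$.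
   Context: All objects are smooth and repeated indices are summed. $Q$ is an $n$-dimensional manifold, $\tau:TQ\to Q$ its tangent bundle, $\mathcal{D}$ has rank $m$, and $\mathcal{D}^g$ is the $g$-orthogonal complement of $\mathcal{D}$. A globally defined frame $\{X_\alpha\}=\{X_a,X_i\}$ on $Q$ is fixed, with $\{X_a\}$ ($a,b,c\in\{1,\dots,m\}$) spanning $\mathcal{D}$ and $\{X_i\}$ ($i,k\in\{1,\dots,n-m\}$) spanning $\mathcal{D}^g$; $[X_\alpha,X_\beta]=R^\gamma_{\alpha\beta}X_\gamma$; $\hat g_{\alpha\beta}=\hat g(X_\alpha,X_\beta)$. Quasi-velocities $v^\alpha=(v^a,v^i)$ are the functions on $TQ$ with $v_q=v^\alpha X_\alpha(q)$; $\mathcal{C}=\{v^i=0\}$ is $\mathcal{D}$ viewed as a submanifold of $TQ$. $X^C$, $X^V$ are the complete and vertical lifts to $TQ$ of a vector field $X$ on $Q$. $\hat g$ is a $\mathcal{D}$-preserving modification of $g$ if $\hat g|_{\mathcal{D}\times\mathcal{D}}=g|_{\mathcal{D}\times\mathcal{D}}$. The nonholonomic vector field $\Gamma_{(L,\mathcal{D})}$ is the unique vector field on $\mathcal{C}$ of the form $v^aX_a^C+f^aX_a^V$ satisfying $\Gamma_{(L,\mathcal{D})}(X^V(L))-X^C(L)=0$ on $\mathcal{C}$ for all $X\in\mathrm{Sec}(\mathcal{D})$; explicitly $f^d=-\Gamma^d_{ab}v^av^b$ with $\nabla^g_{X_\alpha}X_\beta=\Gamma^\gamma_{\alpha\beta}X_\gamma$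 for the Levi-Civita connection of $g$. With $\phi^{nh}_t$ its flow on $\mathcal{D}$, the nonholonomic exponential map at $q$ is $\exp^{nh}_q(v_q)=\tau(\phi^{nh}_1(v_q))$, defined for $v_q$ in an open starshaped neighbourhood of $0_q$ in $\mathcal{D}_q$; it satisfies $\exp^{nh}_q(tv_q)=c_{v_q}(t)$, where $c_{v_q}$ is the nonholonomic trajectory (base integral curve of $\Gamma_{(L,\mathcal{D})}$) with $\dot c_{v_q}(0)=v_q$, and $T_{0_q}(\exp^{nh}_q)$ is the inclusion $\mathcal{D}_q\subset T_qQ$. The Gauss-type condition at $v_q$ is understood for $v_q$ in the domain of $\exp^{nh}_q$. Throughout, $T_{v_q}(\mathcal{D}_q)$ is identified with $\mathcal{D}_q$. *)

theory Defs
  imports "HOL-Analysis.Analysis"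
begin

section \<open>Smooth manifolds given by an atlas\<close>

primrec times_continuously_differentiable_on ::
  "nat \<Rightarrow> 'a::euclidean_space set \<Rightarrow> ('a \<Rightarrow> 'b::real_normed_vector) \<Rightarrow> bool" where
  "times_continuously_differentiable_on 0 = (\<lambda>S f. continuous_on S f)"
| "times_continuously_differentiable_on (Suc k) =
     (\<lambda>S f. (\<forall>x\<in>S. f differentiable (at x)) \<and>
        (\<forall>h. times_continuously_differentiable_on k S (\<lambda>x. frechet_derivative f (at x) h)))"

text \<open>Only used for open sets \<open>S\<close>.\<close>

definition smooth_on :: "'a::euclidean_space set \<Rightarrow> ('a \<Rightarrow> 'b::real_normed_vector) \<Rightarrow> bool" where
  "smooth_on S f \<longleftrightarrow> (\<forall>k. times_continuously_differentiable_on k S f)"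

text \<open>The underlying set of the manifold is the union of the chart domains, and its topology is
  the one induced by the charts. The type \<open>'q\<close> itself carries no topology; in this way the same
  notions apply to \<open>Q\<close> and to \<open>TQ\<close>.\<close>

type_synonym ('q, 'e) atlas = "('q set \<times> ('q \<Rightarrow> 'e)) set"

definition carrier :: "('q, 'e) atlas \<Rightarrow> 'q set" where
  "carrier A = (\<Union>(U, \<phi>)\<in>A. U)"

definition manifold_topology :: "('q, 'e::euclidean_space) atlas \<Rightarrow> 'q topology" where
  "manifold_topology A =
     topology (\<lambda>O'. O' \<subseteq> carrier A \<and> (\<forall>(U, \<phi>)\<in>A. open (\<phi> ` (U \<inter> O'))))"

definition smooth_atlas :: "('q, 'e::euclidean_space) atlas \<Rightarrow> bool" where
  "smooth_atlas A \<longleftrightarrow>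
     (\<forall>(U, \<phi>)\<in>A. inj_on \<phi> U \<and> open (\<phi> ` U)) \<and>
     (\<forall>(U, \<phi>)\<in>A. \<forall>(V, \<psi>)\<in>A.
        open (\<phi> ` (U \<inter> V)) \<and> smooth_on (\<phi> ` (U \<inter> V)) (\<psi> \<circ> inv_into U \<phi>))"

definition smooth_manifold :: "('q, 'e::euclidean_space) atlas \<Rightarrow> bool" where
  "smooth_manifold A \<longleftrightarrow> smooth_atlas A \<and>
     Hausdorff_space (manifold_topology A) \<and> second_countable (manifold_topology A)"

lemma openin_manifold_topology:
  assumes "smooth_atlas A"
  shows "openin (manifold_topology A) W \<longleftrightarrow>
    W \<subseteq> carrier A \<and> (\<forall>(U, \<phi>)\<in>A. open (\<phi> ` (U \<inter> W)))"
proof -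
  have "istopology (\<lambda>W. W \<subseteq> carrier A \<and> (\<forall>(U, \<phi>)\<in>A. open (\<phi> ` (U \<inter> W))))"
    unfolding istopology_def
  proof (intro conjI allI impI)
    fix S T :: "'a set"
    assume S: "S \<subseteq> carrier A \<and> (\<forall>(U, \<phi>)\<in>A. open (\<phi> ` (U \<inter> S)))"
      and T: "T \<subseteq> carrier A \<and> (\<forall>(U, \<phi>)\<in>A. open (\<phi> ` (U \<inter> T)))"
    show "S \<inter> T \<subseteq> carrier A" using S by blast
    show "\<forall>(U, \<phi>)\<in>A. open (\<phi> ` (U \<inter> (S \<inter> T)))"
    proof clarify
      fix U \<phi> assume U: "(U, \<phi>) \<in> A"
      then have "inj_on \<phi> U" using assms by (auto simp: smooth_atlas_def)
      then have "\<phi> ` (U \<inter> (S \<inter> T)) = \<phi> ` (U \<inter> S) \<inter> \<phi> ` (U \<inter> T)"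
        by (auto simp: inj_on_def)
      then show "open (\<phi> ` (U \<inter> (S \<inter> T)))" using S T U by auto
    qed
  next
    fix K :: "'a set set"
    assume K: "\<forall>S\<in>K. S \<subseteq> carrier A \<and> (\<forall>(U, \<phi>)\<in>A. open (\<phi> ` (U \<inter> S)))"
    show "\<Union>K \<subseteq> carrier A" using K by blast
    show "\<forall>(U, \<phi>)\<in>A. open (\<phi> ` (U \<inter> \<Union>K))"
    proof clarify
      fix U \<phi> assume U: "(U, \<phi>) \<in> A"
      have "\<phi> ` (U \<inter> \<Union>K) = (\<Union>S\<in>K. \<phi> ` (U \<inter> S))" by auto
      moreover have "open (\<Union>S\<in>K. \<phi> ` (U \<inter> S))"
        using K U by (intro open_UN) fastforce
      ultimately show "open (\<phi> ` (U \<inter> \<Union>K))" by simp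
    qed
  qed
  then show ?thesis by (simp add: manifold_topology_def topology_inverse')
qed

definition smooth_fun :: "('q, 'e::euclidean_space) atlas \<Rightarrow> 'q set \<Rightarrow> ('q \<Rightarrow> real) \<Rightarrow> bool" where
  "smooth_fun A N f \<longleftrightarrow> (\<forall>(U, \<phi>)\<in>A. smooth_on (\<phi> ` (U \<inter> N)) (f \<circ> inv_into U \<phi>))"

definition smooth_near :: "('q, 'e::euclidean_space) atlas \<Rightarrow> 'q \<Rightarrow> ('q \<Rightarrow> real) \<Rightarrow> bool" where
  "smooth_near A p f \<longleftrightarrow> (\<exists>N. openin (manifold_topology A) N \<and> p \<in> N \<and> smooth_fun A N f)"


section \<open>Tangent vectors, vector fields, metrics\<close>

text \<open>A tangent vector at \<open>p\<close> is identified with the operator taking the directional derivative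
  at \<open>p\<close> of functions that are smooth near \<open>p\<close>. To make the operator unique it is set to zero on
  all other functions, so the zero vector is the constantly zero operator and linear combinations
  are formed pointwise.\<close>

type_synonym 'q tangent = "('q \<Rightarrow> real) \<Rightarrow> real"

definition chart_vector ::
  "('q, 'e::euclidean_space) atlas \<Rightarrow> 'q set \<times> ('q \<Rightarrow> 'e) \<Rightarrow> 'q \<Rightarrow> 'e \<Rightarrow> 'q tangent" where
  "chart_vector A = (\<lambda>(U, \<phi>) p h f.
     if smooth_near A p f then frechet_derivative (f \<circ> inv_into U \<phi>) (at (\<phi> p)) h else 0)"

definition tangent_space :: "('q, 'e::euclidean_space) atlas \<Rightarrow> 'q \<Rightarrow> 'q tangent set" where
  "tangent_space A p = {chart_vector A c p h | c h. c \<in> A \<and> p \<in> fst c}"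

definition zero_vector :: "'q tangent" where
  "zero_vector = (\<lambda>f. 0)"

definition add_scaled :: "'q tangent \<Rightarrow> real \<Rightarrow> 'q tangent \<Rightarrow> 'q tangent" where
  "add_scaled v s u = (\<lambda>f. v f + s * u f)"

definition lincomb ::
  "nat set \<Rightarrow> (nat \<Rightarrow> real) \<Rightarrow> (nat \<Rightarrow> 'q \<Rightarrow> 'q tangent) \<Rightarrow> 'q \<Rightarrow> 'q tangent" where
  "lincomb S x X q = (\<lambda>f. \<Sum>\<alpha>\<in>S. x \<alpha> * X \<alpha> q f)"

definition vector_field ::
  "('q, 'e::euclidean_space) atlas \<Rightarrow> 'q set \<Rightarrow> ('q \<Rightarrow> 'q tangent) \<Rightarrow> bool" where
  "vector_field A N X \<longleftrightarrow> (\<forall>q\<in>N. X q \<in> tangent_space A q) \<and>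
     (\<forall>N' f. openin (manifold_topology A) N' \<and> N' \<subseteq> N \<and> smooth_fun A N' f \<longrightarrow>
        smooth_fun A N' (\<lambda>q. X q f))"

definition lie_bracket ::
  "('q, 'e::euclidean_space) atlas \<Rightarrow> ('q \<Rightarrow> 'q tangent) \<Rightarrow> ('q \<Rightarrow> 'q tangent) \<Rightarrow> 'q \<Rightarrow> 'q tangent"
  where
  "lie_bracket A X Y q f =
     (if smooth_near A q f then X q (\<lambda>x. Y x f) - Y q (\<lambda>x. X x f) else 0)"

definition riemannian_metric ::
  "('q, 'e::euclidean_space) atlas \<Rightarrow> ('q \<Rightarrow> 'q tangent \<Rightarrow> 'q tangent \<Rightarrow> real) \<Rightarrow> bool" where
  "riemannian_metric A g \<longleftrightarrow>
     (\<forall>q\<in>carrier A. \<forall>u\<in>tangent_space A q. \<forall>v\<in>tangent_space A q.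
        g q u v = g q v u \<and> (u \<noteq> zero_vector \<longrightarrow> g q u u > 0) \<and>
        (\<forall>w\<in>tangent_space A q. \<forall>s. g q (add_scaled u s v) w = g q u w + s * g q v w)) \<and>
     (\<forall>N X Y. openin (manifold_topology A) N \<and> vector_field A N X \<and> vector_field A N Y \<longrightarrow>
        smooth_fun A N (\<lambda>q. g q (X q) (Y q)))"

text \<open>A curve is tested on smooth functions; differentiability in this sense implies continuity.
  (A function which is smooth near \<open>c t\<close> may be arbitrary elsewhere.)\<close>

definition differentiable_curve ::
  "('q, 'e::euclidean_space) atlas \<Rightarrow> (real \<Rightarrow> 'q) \<Rightarrow> real \<Rightarrow> bool" where
  "differentiable_curve A c t \<longleftrightarrow>
     (\<forall>f. smooth_near A (c t) f \<longrightarrow> (\<lambda>s. f (c s)) differentiable (at t))"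

definition velocity :: "('q, 'e::euclidean_space) atlas \<Rightarrow> (real \<Rightarrow> 'q) \<Rightarrow> real \<Rightarrow> 'q tangent" where
  "velocity A c t = (\<lambda>f. if smooth_near A (c t) f then deriv (\<lambda>s. f (c s)) t else 0)"


section \<open>The tangent bundle\<close>

definition tangent_atlas ::
  "('q, 'e::euclidean_space) atlas \<Rightarrow> ('q \<times> 'q tangent, 'e \<times> 'e) atlas" where
  "tangent_atlas A =
     (\<lambda>(U, \<phi>). ({(q, v). q \<in> U \<and> v \<in> tangent_space A q},
                  \<lambda>(q, v). (\<phi> q, \<Sum>b\<in>Basis. v (\<lambda>x. \<phi> x \<bullet> b) *\<^sub>R b))) ` A"

definition vertical_lift ::
  "('q, 'e::euclidean_space) atlas \<Rightarrow> ('q \<Rightarrow> 'q tangent) \<Rightarrow>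
     'q \<times> 'q tangent \<Rightarrow> ('q \<times> 'q tangent) tangent" where
  "vertical_lift A X = (\<lambda>(q, v). velocity (tangent_atlas A) (\<lambda>s. (q, add_scaled v s (X q))) 0)"

text \<open>The complete lift is characterized by \<open>X\<^sup>C (f \<circ> \<tau>) = X f \<circ> \<tau>\<close> and \<open>X\<^sup>C f\<^sup>C = (X f)\<^sup>C\<close>, where
  \<open>f\<^sup>C\<close> is the function \<open>v \<mapsto> v f\<close> on the tangent bundle.\<close>

definition complete_lift ::
  "('q, 'e::euclidean_space) atlas \<Rightarrow> ('q \<Rightarrow> 'q tangent) \<Rightarrow>
     'q \<times> 'q tangent \<Rightarrow> ('q \<times> 'q tangent) tangent" where
  "complete_lift A X = (\<lambda>(q, v). THE z. z \<in> tangent_space (tangent_atlas A) (q, v) \<and>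
     (\<forall>f. smooth_near A q f \<longrightarrow>
        z (\<lambda>p. f (fst p)) = X q f \<and> z (\<lambda>p. snd p f) = v (\<lambda>x. X x f)))"

definition kinetic_lagrangian ::
  "('q \<Rightarrow> 'q tangent \<Rightarrow> 'q tangent \<Rightarrow> real) \<Rightarrow> 'q \<times> 'q tangent \<Rightarrow> real" where
  "kinetic_lagrangian g = (\<lambda>(q, v). 1/2 * g q v v)"


section \<open>Distributions and adapted frames\<close>

text \<open>Frames are indexed by \<open>\<alpha> < n\<close>, where \<open>n\<close> is the dimension.\<close>

definition global_frame ::
  "('q, 'e::euclidean_space) atlas \<Rightarrow> (nat \<Rightarrow> 'q \<Rightarrow> 'q tangent) \<Rightarrow> bool" where
  "global_frame A X \<longleftrightarrow> (\<forall>\<alpha><DIM('e). vector_field A (carrier A) (X \<alpha>)) \<and>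
     (\<forall>q\<in>carrier A. \<forall>v\<in>tangent_space A q.
        \<exists>!w. (\<forall>\<alpha>\<ge>DIM('e). w \<alpha> = 0) \<and> v = lincomb {..<DIM('e)} w X q)"

definition orthogonal_distribution ::
  "('q, 'e::euclidean_space) atlas \<Rightarrow> ('q \<Rightarrow> 'q tangent \<Rightarrow> 'q tangent \<Rightarrow> real) \<Rightarrow>
     ('q \<Rightarrow> 'q tangent set) \<Rightarrow> 'q \<Rightarrow> 'q tangent set" where
  "orthogonal_distribution A g D q = {u \<in> tangent_space A q. \<forall>v\<in>D q. g q u v = 0}"

text \<open>The fields \<open>X a\<close> with \<open>a < m\<close> span \<open>D\<close> (so that \<open>D\<close> is a smooth distribution of rank \<open>m\<close>),
  and the fields \<open>X i\<close> with \<open>m \<le> i < n\<close> span its orthogonal complement.\<close>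

definition adapted_frame ::
  "('q, 'e::euclidean_space) atlas \<Rightarrow> ('q \<Rightarrow> 'q tangent \<Rightarrow> 'q tangent \<Rightarrow> real) \<Rightarrow> nat \<Rightarrow>
     ('q \<Rightarrow> 'q tangent set) \<Rightarrow> (nat \<Rightarrow> 'q \<Rightarrow> 'q tangent) \<Rightarrow> bool" where
  "adapted_frame A g m D X \<longleftrightarrow> m \<le> DIM('e) \<and> global_frame A X \<and>
     (\<forall>q\<in>carrier A. D q = {lincomb {..<m} x X q | x. True} \<and>
        orthogonal_distribution A g D q = {lincomb {m..<DIM('e)} x X q | x. True})"

definition structure_functions ::
  "('q, 'e::euclidean_space) atlas \<Rightarrow> (nat \<Rightarrow> 'q \<Rightarrow> 'q tangent) \<Rightarrow>
     (nat \<Rightarrow> nat \<Rightarrow> nat \<Rightarrow> 'q \<Rightarrow> real) \<Rightarrow> bool" where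
  "structure_functions A X R \<longleftrightarrow> (\<forall>\<alpha><DIM('e). \<forall>\<beta><DIM('e). \<forall>q\<in>carrier A.
     lie_bracket A (X \<alpha>) (X \<beta>) q = lincomb {..<DIM('e)} (\<lambda>\<gamma>. R \<gamma> \<alpha> \<beta> q) X q)"

definition quasi_velocity ::
  "nat \<Rightarrow> (nat \<Rightarrow> 'q \<Rightarrow> 'q tangent) \<Rightarrow> 'q \<times> 'q tangent \<Rightarrow> nat \<Rightarrow> real" where
  "quasi_velocity n X = (\<lambda>(q, v). THE w. (\<forall>\<alpha>\<ge>n. w \<alpha> = 0) \<and> v = lincomb {..<n} w X q)"

definition sections ::
  "('q, 'e::euclidean_space) atlas \<Rightarrow> ('q \<Rightarrow> 'q tangent set) \<Rightarrow> ('q \<Rightarrow> 'q tangent) set" where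
  "sections A D = {Y. vector_field A (carrier A) Y \<and> (\<forall>q\<in>carrier A. Y q \<in> D q)}"

definition preserving_modification ::
  "('q, 'e::euclidean_space) atlas \<Rightarrow> ('q \<Rightarrow> 'q tangent set) \<Rightarrow>
     ('q \<Rightarrow> 'q tangent \<Rightarrow> 'q tangent \<Rightarrow> real) \<Rightarrow> ('q \<Rightarrow> 'q tangent \<Rightarrow> 'q tangent \<Rightarrow> real) \<Rightarrow> bool" where
  "preserving_modification A D g h \<longleftrightarrow>
     (\<forall>q\<in>carrier A. \<forall>u\<in>D q. \<forall>v\<in>D q. h q u v = g q u v)"


section \<open>The nonholonomic vector field and exponential map\<close>

text \<open>The distribution as a subset of the tangent bundle.\<close>

definition total_space ::
  "('q, 'e::euclidean_space) atlas \<Rightarrow> ('q \<Rightarrow> 'q tangent set) \<Rightarrow> ('q \<times> 'q tangent) set" where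
  "total_space A D = {(q, v). q \<in> carrier A \<and> v \<in> D q}"

text \<open>The condition below determines \<open>\<Gamma>\<close> pointwise on the total space of \<open>D\<close>, since the matrix
  \<open>g(X\<^sub>a, X\<^sub>b)\<close> is invertible. Smoothness of the coefficients \<open>f\<close> is therefore a consequence
  and is not demanded. Values of \<open>\<Gamma>\<close> outside the total space are irrelevant.\<close>

definition nonholonomic_vector_field ::
  "('q, 'e::euclidean_space) atlas \<Rightarrow> ('q \<times> 'q tangent \<Rightarrow> real) \<Rightarrow> nat \<Rightarrow>
     ('q \<Rightarrow> 'q tangent set) \<Rightarrow> (nat \<Rightarrow> 'q \<Rightarrow> 'q tangent) \<Rightarrow>
     ('q \<times> 'q tangent \<Rightarrow> ('q \<times> 'q tangent) tangent) \<Rightarrow> bool" where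
  "nonholonomic_vector_field A L m D X \<Gamma> \<longleftrightarrow>
     (\<exists>f :: nat \<Rightarrow> 'q \<times> 'q tangent \<Rightarrow> real. \<forall>p\<in>total_space A D.
        \<Gamma> p = (\<lambda>F. \<Sum>a<m. quasi_velocity DIM('e) X p a * complete_lift A (X a) p F
                        + f a p * vertical_lift A (X a) p F)) \<and>
     (\<forall>p\<in>total_space A D. \<forall>Y\<in>sections A D.
        \<Gamma> p (\<lambda>p'. vertical_lift A Y p' L) - complete_lift A Y p L = 0)"

definition integral_curve ::
  "('p, 'e::euclidean_space) atlas \<Rightarrow> 'p set \<Rightarrow> ('p \<Rightarrow> 'p tangent) \<Rightarrow>
     (real \<Rightarrow> 'p) \<Rightarrow> real set \<Rightarrow> bool" where
  "integral_curve B C Z \<gamma> I \<longleftrightarrow>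
     (\<forall>t\<in>I. \<gamma> t \<in> C \<and> differentiable_curve B \<gamma> t \<and> velocity B \<gamma> t = Z (\<gamma> t))"

text \<open>\<open>flow_relation B C Z t p p'\<close> states that the flow at time \<open>t\<close> of the vector field \<open>Z\<close> on \<open>C\<close>
  is defined at \<open>p\<close> and has value \<open>p'\<close> there.\<close>

definition flow_relation ::
  "('p, 'e::euclidean_space) atlas \<Rightarrow> 'p set \<Rightarrow> ('p \<Rightarrow> 'p tangent) \<Rightarrow> real \<Rightarrow> 'p \<Rightarrow> 'p \<Rightarrow> bool"
  where
  "flow_relation B C Z t p p' \<longleftrightarrow>
     (\<exists>\<gamma> I. open I \<and> is_interval I \<and> 0 \<in> I \<and> t \<in> I \<and> integral_curve B C Z \<gamma> I \<and>
        \<gamma> 0 = p \<and> \<gamma> t = p')"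

definition flow ::
  "('p, 'e::euclidean_space) atlas \<Rightarrow> 'p set \<Rightarrow> ('p \<Rightarrow> 'p tangent) \<Rightarrow> real \<Rightarrow> 'p \<Rightarrow> 'p" where
  "flow B C Z t p = (THE p'. flow_relation B C Z t p p')"

definition nh_exp ::
  "('q, 'e::euclidean_space) atlas \<Rightarrow> ('q \<Rightarrow> 'q tangent set) \<Rightarrow>
     ('q \<times> 'q tangent \<Rightarrow> ('q \<times> 'q tangent) tangent) \<Rightarrow> 'q \<Rightarrow> 'q tangent \<Rightarrow> 'q" where
  "nh_exp A D \<Gamma> q v = fst (flow (tangent_atlas A) (total_space A D) \<Gamma> 1 (q, v))"

text \<open>\<open>W q\<close> is an open starshaped neighbourhood of zero in \<open>D q\<close> on which the exponential map at
  \<open>q\<close> is defined. Openness in \<open>D q\<close> is expressed by means of the norm of the metric; all norms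
  on the finite-dimensional space \<open>D q\<close> give the same topology.\<close>

definition exp_domain ::
  "('q, 'e::euclidean_space) atlas \<Rightarrow> ('q \<Rightarrow> 'q tangent \<Rightarrow> 'q tangent \<Rightarrow> real) \<Rightarrow>
     ('q \<Rightarrow> 'q tangent set) \<Rightarrow> ('q \<times> 'q tangent \<Rightarrow> ('q \<times> 'q tangent) tangent) \<Rightarrow>
     ('q \<Rightarrow> 'q tangent set) \<Rightarrow> bool" where
  "exp_domain A g D \<Gamma> W \<longleftrightarrow> (\<forall>q\<in>carrier A.
     W q \<subseteq> D q \<and> zero_vector \<in> W q \<and>
     (\<forall>v\<in>W q. \<exists>p'. flow_relation (tangent_atlas A) (total_space A D) \<Gamma> 1 (q, v) p') \<and>
     (\<forall>v\<in>W q. \<forall>s\<in>{0..1}. add_scaled zero_vector s v \<in> W q) \<and>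
     (\<forall>v\<in>W q. \<exists>\<epsilon>>0. \<forall>u\<in>D q. sqrt (g q (add_scaled u (-1) v) (add_scaled u (-1) v)) < \<epsilon> \<longrightarrow> u \<in> W q))"

text \<open>The tangent map at \<open>v\<close> of the exponential map at \<open>q\<close>, applied to \<open>u\<close> in
  \<open>T\<^sub>v (D q) = D q\<close>, where \<open>u\<close> is represented by the line \<open>s \<mapsto> v + s u\<close>.\<close>

definition tangent_nh_exp ::
  "('q, 'e::euclidean_space) atlas \<Rightarrow> ('q \<Rightarrow> 'q tangent set) \<Rightarrow>
     ('q \<times> 'q tangent \<Rightarrow> ('q \<times> 'q tangent) tangent) \<Rightarrow> 'q \<Rightarrow> 'q tangent \<Rightarrow> 'q tangent \<Rightarrow> 'q tangent"
  where
  "tangent_nh_exp A D \<Gamma> q v u = velocity A (\<lambda>s. nh_exp A D \<Gamma> q (add_scaled v s u)) 0"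

definition nh_exp_pullback ::
  "('q, 'e::euclidean_space) atlas \<Rightarrow> ('q \<Rightarrow> 'q tangent set) \<Rightarrow>
     ('q \<times> 'q tangent \<Rightarrow> ('q \<times> 'q tangent) tangent) \<Rightarrow>
     ('q \<Rightarrow> 'q tangent \<Rightarrow> 'q tangent \<Rightarrow> real) \<Rightarrow> 'q \<Rightarrow> 'q tangent \<Rightarrow> 'q tangent \<Rightarrow> 'q tangent \<Rightarrow> real"
  where
  "nh_exp_pullback A D \<Gamma> h q v u w =
     h (nh_exp A D \<Gamma> q v) (tangent_nh_exp A D \<Gamma> q v u) (tangent_nh_exp A D \<Gamma> q v w)"

end

theory Submission
  imports Defs
begin

text \<open>
  Why the theorem holds. Fix \<open>q\<close> and \<open>v, u\<close> in the distribution \<open>D\<close> at \<open>q\<close>. Let \<open>c\<^sub>s\<close> be the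
  nonholonomic trajectory with initial velocity \<open>v + s u\<close> and let \<open>J\<close> be the variation field at
  \<open>s = 0\<close>. Since \<open>exp (t w)\<close> runs through the trajectory with initial velocity \<open>w\<close>, the Gauss-type
  condition says that \<open>h(c', J) = t h(v, u)\<close> along \<open>c = c\<^sub>0\<close>, and that \<open>h(c', c')\<close> is constant along
  every \<open>c\<^sub>s\<close>, where \<open>h\<close> is the modified metric. Differentiate the first equation in \<open>t\<close> and the
  second one in \<open>s\<close>, and subtract half of the latter: the covariant acceleration of \<open>c\<close> for \<open>h\<close> is
  orthogonal to \<open>J\<close>. As \<open>J / t\<close> tends to \<open>u\<close> at \<open>t = 0\<close>, the acceleration at \<open>q\<close> is \<open>h\<close>-orthogonal to
  \<open>u\<close>, hence to \<open>D\<close> (\<open>gauss_imp_euler_lagrange\<close>).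

  On the other hand the covariant acceleration of a nonholonomic trajectory for \<open>g\<close> itself is
  \<open>g\<close>-orthogonal to \<open>D\<close>. Let \<open>V = v\<^sup>a X\<^sub>a\<close> with constant \<open>v\<^sup>a\<close>. In Koszul's formula for the product of
  the acceleration with \<open>X\<^sub>c\<close>, the metrics enter through the functions \<open>h(V, V)\<close> and \<open>h(V, X\<^sub>c)\<close>,
  which are the same for \<open>g\<close> and \<open>h\<close>, and through \<open>h(V, [V, X\<^sub>c])\<close>. So the two orthogonality
  relations together say \<open>h(v, [V, X\<^sub>c]) = g(v, [V, X\<^sub>c])\<close> (\<open>bracket_product_eq\<close>). The components of the
  bracket in \<open>D\<close> contribute equally to both sides, and the remaining ones are \<open>g\<close>-orthogonal to \<open>v\<close>;
  what is left is the condition \<open>h(v, X\<^sub>k) R\<^sup>k\<^sub>a\<^sub>c v\<^sup>a = 0\<close>.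

  The computations take place in one chart, where covariant derivatives are replaced by the
  Euler-Lagrange expressions of the kinetic energies. Two facts of analysis carry them.
  First, nonholonomic trajectories are solutions of an unconstrained smooth equation
  \<open>\<xi>' = F(x, \<xi>)\<close>, quadratic in \<open>\<xi> = x'\<close> (\<open>constrained_spray\<close>). Secondly, its solutions are
  unique and depend differentiably on the initial velocity (\<open>ode_solution_unique\<close>,
  \<open>ode_solution_variation\<close>). Existence of solutions is part of the hypothesis that the exponential
  map is defined near the zero vector. A small initial velocity keeps a trajectory inside the chart up to time one
  (\<open>integral_curve_confined\<close>), so the exponential map near zero can be read off from solutions of
  the equation in the chart (\<open>exp_motions_exist\<close>).
\<close>

section \<open>Calculus of smooth maps\<close>

abbreviation "C_k \<equiv> times_continuously_differentiable_on"
abbreviation "\<D> f x \<equiv> frechet_derivative f (at x)"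

lemma C_k_cong:
  assumes "open S" "\<And>x. x \<in> S \<Longrightarrow> f x = g x" "C_k k S f"
  shows "C_k k S g"
  using assms(2,3)
proof (induction k arbitrary: f g)
  case 0
  then show ?case by (auto simp: continuous_on_eq)
next
  case (Suc k)
  have d: "(g has_derivative \<D> f x) (at x)" if "x \<in> S" for x
  proof -
    have "(f has_derivative \<D> f x) (at x)"
      using Suc.prems that by (simp add: frechet_derivative_works[symmetric])
    then show ?thesis
      by (rule has_derivative_transform_within_open[OF _ assms(1) that]) (use Suc.prems in auto)
  qed
  then have e: "\<D> f x = \<D> g x" if "x \<in> S" for x
    using frechet_derivative_at that by blast
  have "C_k k S (\<lambda>x. \<D> g x h)" for h
    by (rule Suc.IH[of "\<lambda>x. \<D> f x h"]) (use Suc.prems e in auto)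
  then show ?case using d by (auto simp: differentiable_def)
qed

lemma C_k_SucI:
  assumes "open S" "\<And>x. x \<in> S \<Longrightarrow> (f has_derivative f' x) (at x)" "\<And>h. C_k k S (\<lambda>x. f' x h)"
  shows "C_k (Suc k) S f"
proof -
  have "f' x = \<D> f x" if "x \<in> S" for x
    using assms(2)[OF that] frechet_derivative_at by blast
  then have "C_k k S (\<lambda>x. \<D> f x h)" for h
    by (intro C_k_cong[OF assms(1) _ assms(3)]) auto
  then show ?thesis using assms(2) by (auto simp: differentiable_def)
qed

lemma C_k_SucD:
  assumes "C_k (Suc k) S f"
  shows "\<And>x. x \<in> S \<Longrightarrow> (f has_derivative \<D> f x) (at x)"
    "\<And>h. C_k k S (\<lambda>x. \<D> f x h)"
  using assms by (auto simp: frechet_derivative_works[symmetric])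

lemma C_k_continuous: "C_k k S f \<Longrightarrow> continuous_on S f"
  by (cases k) (simp_all add: continuous_at_imp_continuous_on differentiable_imp_continuous_within)

lemma C_k_Suc_imp: "C_k (Suc k) S f \<Longrightarrow> C_k k S f"
proof (induction k arbitrary: f)
  case 0
  then show ?case using C_k_continuous by (metis times_continuously_differentiable_on.simps(1))
next
  case (Suc k)
  then show ?case by (meson times_continuously_differentiable_on.simps(2))
qed

lemma C_k_subset: "C_k k S f \<Longrightarrow> T \<subseteq> S \<Longrightarrow> C_k k T f"
  by (induction k arbitrary: f) (auto intro: continuous_on_subset)

lemma C_k_const: "open S \<Longrightarrow> C_k k S (\<lambda>x. c)"
proof (induction k arbitrary: c)
  case (Suc k)
  show ?case by (rule C_k_SucI[where f' = "\<lambda>x h. 0"]) (use Suc in auto)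
qed simp

lemma C_k_bounded_linear:
  assumes "open S" "bounded_linear f" shows "C_k k S f"
proof (cases k)
  case 0
  then show ?thesis using assms by (simp add: linear_continuous_on)
next
  case (Suc j)
  show ?thesis unfolding Suc
    by (rule C_k_SucI[where f' = "\<lambda>x. f"])
      (use assms C_k_const bounded_linear_imp_has_derivative in auto)
qed

lemma C_k_add:
  assumes "open S" "C_k k S f" "C_k k S g" shows "C_k k S (\<lambda>x. f x + g x)"
  using assms(2,3)
proof (induction k arbitrary: f g)
  case 0
  then show ?case by (simp add: continuous_on_add)
next
  case (Suc k)
  note f = C_k_SucD[OF Suc.prems(1)] and g = C_k_SucD[OF Suc.prems(2)]
  show ?case
    by (rule C_k_SucI[OF assms(1) has_derivative_add[OF f(1) g(1)] Suc.IH[OF f(2) g(2)]])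
qed

lemma (in bounded_bilinear) C_k_prod:
  assumes "open S" "C_k k S f" "C_k k S g" shows "C_k k S (\<lambda>x. prod (f x) (g x))"
  using assms(2,3)
proof (induction k arbitrary: f g)
  case 0
  then show ?case by (simp add: continuous_on)
next
  case (Suc k)
  note f = C_k_SucD[OF Suc.prems(1)] and g = C_k_SucD[OF Suc.prems(2)]
  show ?case
    by (rule C_k_SucI[OF assms(1) FDERIV[OF f(1) g(1)]
          C_k_add[OF assms(1) Suc.IH[OF C_k_Suc_imp[OF Suc.prems(1)] g(2)] Suc.IH[OF f(2) C_k_Suc_imp[OF Suc.prems(2)]]]])
qed

lemma C_k_sum:
  assumes "open S" "\<And>i. i \<in> I \<Longrightarrow> C_k k S (f i)" shows "C_k k S (\<lambda>x. \<Sum>i\<in>I. f i x)"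
  using assms(2) by (induction I rule: infinite_finite_induct)
    (simp_all add: C_k_const C_k_add assms(1))

lemma C_k_inverse:
  fixes f :: "'a::euclidean_space \<Rightarrow> real"
  assumes "open S" "C_k k S f" "\<And>x. x \<in> S \<Longrightarrow> f x \<noteq> 0" shows "C_k k S (\<lambda>x. inverse (f x))"
  using assms(2)
proof (induction k)
  case 0
  then show ?case using assms(3) by (simp add: continuous_on_inverse)
next
  case (Suc k)
  note f = C_k_SucD[OF Suc.prems] and M = bounded_bilinear.C_k_prod[OF bounded_bilinear_mult assms(1)]
  show ?case
  proof (rule C_k_SucI[OF assms(1)])
    show "((\<lambda>x. inverse (f x)) has_derivative
        (\<lambda>h. (-1) * (inverse (f x) * \<D> f x h * inverse (f x)))) (at x)" if "x \<in> S" for x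
      using Deriv.has_derivative_inverse[OF assms(3)[OF that] f(1)[OF that]] by simp
    show "C_k k S (\<lambda>x. (-1) * (inverse (f x) * \<D> f x h * inverse (f x)))" for h
      by (intro M C_k_const[OF assms(1)] f(2) Suc.IH C_k_Suc_imp[OF Suc.prems])
  qed
qed

text \<open>The derivative of a composition is
  \<open>D(f \<circ> g) x h = (\<Sum>b. (Dg x h \<bullet> b) (Df (g x) b))\<close>, whose summands are products of a partial
  derivative of \<open>g\<close> and of a composition with \<open>g\<close> again; this drives the induction on the
  order of differentiability.\<close>

lemma C_k_compose:
  fixes g :: "'a::euclidean_space \<Rightarrow> 'b::euclidean_space" and f :: "'b \<Rightarrow> 'c::real_normed_vector"
  assumes "open S" "open T" "C_k k T f" "C_k k S g" "g ` S \<subseteq> T"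
  shows "C_k k S (\<lambda>x. f (g x))"
  using assms(3,4)
proof (induction k arbitrary: f)
  case 0
  then show ?case using assms(5) by (simp add: continuous_on_compose2)
next
  case (Suc k)
  note f = C_k_SucD[OF Suc.prems(1)] and g = C_k_SucD[OF Suc.prems(2)]
  have gT: "g x \<in> T" if "x \<in> S" for x using assms(5) that by auto
  show ?case
  proof (rule C_k_SucI[OF assms(1)])
    fix x assume x: "x \<in> S"
    have "bounded_linear (\<D> f (g x))"
      using f(1)[OF gT[OF x]] by (rule has_derivative_bounded_linear)
    then interpret bounded_linear "\<D> f (g x)" .
    have e: "\<D> f (g x) u = (\<Sum>b\<in>Basis. (u \<bullet> b) *\<^sub>R \<D> f (g x) b)" for u
      using sum[of "\<lambda>b. (u \<bullet> b) *\<^sub>R b" Basis] by (simp only: euclidean_representation scaleR)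
    show "((\<lambda>x. f (g x)) has_derivative
        (\<lambda>h. \<Sum>b\<in>Basis. (\<D> g x h \<bullet> b) *\<^sub>R \<D> f (g x) b)) (at x)"
      unfolding e[symmetric] by (rule has_derivative_compose[OF g(1)[OF x] f(1)[OF gT[OF x]]])
  next
    fix h
    show "C_k k S (\<lambda>x. \<Sum>b\<in>Basis. (\<D> g x h \<bullet> b) *\<^sub>R \<D> f (g x) b)"
      by (intro C_k_sum bounded_bilinear.C_k_prod[OF bounded_bilinear_scaleR]
          bounded_bilinear.C_k_prod[OF bounded_bilinear_inner] C_k_const g(2) assms(1)
          Suc.IH[OF f(2) C_k_Suc_imp[OF Suc.prems(2)]])
  qed
qed

lemma smooth_on_cong:
  assumes "open S" "\<And>x. x \<in> S \<Longrightarrow> f x = g x" "smooth_on S f" shows "smooth_on S g"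
  using assms unfolding smooth_on_def by (blast intro: C_k_cong)

lemma smooth_on_subset: "smooth_on S f \<Longrightarrow> T \<subseteq> S \<Longrightarrow> smooth_on T f"
  unfolding smooth_on_def using C_k_subset by blast

lemma smooth_on_const: "open S \<Longrightarrow> smooth_on S (\<lambda>x. c)"
  by (simp add: smooth_on_def C_k_const)

lemma smooth_on_bounded_linear: "open S \<Longrightarrow> bounded_linear f \<Longrightarrow> smooth_on S f"
  by (simp add: smooth_on_def C_k_bounded_linear)

lemma smooth_on_ident: "open S \<Longrightarrow> smooth_on S (\<lambda>x. x)"
  by (simp add: smooth_on_bounded_linear)

lemma smooth_on_add:
  "open S \<Longrightarrow> smooth_on S f \<Longrightarrow> smooth_on S g \<Longrightarrow> smooth_on S (\<lambda>x. f x + g x)"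
  by (simp add: smooth_on_def C_k_add)

lemma smooth_on_bilinear:
  "bounded_bilinear p \<Longrightarrow> open S \<Longrightarrow> smooth_on S f \<Longrightarrow> smooth_on S g \<Longrightarrow> smooth_on S (\<lambda>x. p (f x) (g x))"
  by (simp add: smooth_on_def bounded_bilinear.C_k_prod)

lemmas smooth_on_mult = smooth_on_bilinear[OF bounded_bilinear_mult]
lemmas smooth_on_scaleR = smooth_on_bilinear[OF bounded_bilinear_scaleR]
lemmas smooth_on_inner = smooth_on_bilinear[OF bounded_bilinear_inner]

lemma smooth_on_minus:
  fixes f :: "'a::euclidean_space \<Rightarrow> 'b::real_normed_vector"
  assumes "open S" "smooth_on S f" "smooth_on S g" shows "smooth_on S (\<lambda>x. f x - g x)"
  using smooth_on_add[OF assms(1,2) smooth_on_scaleR[OF assms(1) smooth_on_const[OF assms(1), of "-1"] assms(3)]]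
  by simp

lemma smooth_on_sum:
  "open S \<Longrightarrow> (\<And>i. i \<in> I \<Longrightarrow> smooth_on S (f i)) \<Longrightarrow> smooth_on S (\<lambda>x. \<Sum>i\<in>I. f i x)"
  by (simp add: smooth_on_def C_k_sum)

lemma smooth_on_divide:
  fixes f g :: "'a::euclidean_space \<Rightarrow> real"
  assumes "open S" "smooth_on S f" "smooth_on S g" "\<And>x. x \<in> S \<Longrightarrow> g x \<noteq> 0"
  shows "smooth_on S (\<lambda>x. f x / g x)"
  using smooth_on_mult[OF assms(1,2), of "\<lambda>x. inverse (g x)"] C_k_inverse[OF assms(1) _ assms(4)] assms(3)
  by (simp add: smooth_on_def divide_inverse)

lemma smooth_on_compose:
  fixes g :: "'a::euclidean_space \<Rightarrow> 'b::euclidean_space" and f :: "'b \<Rightarrow> 'c::real_normed_vector"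
  assumes "open S" "open T" "smooth_on T f" "smooth_on S g" "g ` S \<subseteq> T"
  shows "smooth_on S (\<lambda>x. f (g x))"
  using assms by (simp add: smooth_on_def C_k_compose)

lemma smooth_on_Pair:
  fixes f :: "'a::euclidean_space \<Rightarrow> 'b::euclidean_space" and g :: "'a \<Rightarrow> 'c::euclidean_space"
  assumes "open S" "smooth_on S f" "smooth_on S g"
  shows "smooth_on S (\<lambda>x. (f x, g x))"
proof -
  have "bounded_linear (\<lambda>u::'b. (u, 0::'c))" "bounded_linear (\<lambda>u::'c. (0::'b, u))"
    by (auto intro!: bounded_linear_Pair bounded_linear_ident bounded_linear_zero)
  from this[THEN smooth_on_bounded_linear[OF open_UNIV]]
  have "smooth_on S (\<lambda>x. (f x, 0::'c) + (0::'b, g x))"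
    using assms by (intro smooth_on_add[OF assms(1)] smooth_on_compose[OF assms(1) open_UNIV _ assms(2)]
      smooth_on_compose[OF assms(1) open_UNIV _ assms(3)]) auto
  then show ?thesis by simp
qed

lemma smooth_on_fst:
  "open S \<Longrightarrow> smooth_on S f \<Longrightarrow> smooth_on S (\<lambda>x. fst (f x :: 'b::euclidean_space \<times> 'c::euclidean_space))"
  by (rule smooth_on_compose[where T = UNIV and f = fst])
    (auto intro: smooth_on_bounded_linear bounded_linear_fst)

lemma smooth_on_snd:
  "open S \<Longrightarrow> smooth_on S f \<Longrightarrow> smooth_on S (\<lambda>x. snd (f x :: 'b::euclidean_space \<times> 'c::euclidean_space))"
  by (rule smooth_on_compose[where T = UNIV and f = snd])
    (auto intro: smooth_on_bounded_linear bounded_linear_snd)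

lemma smooth_on_continuous: "smooth_on S f \<Longrightarrow> continuous_on S f"
  unfolding smooth_on_def using C_k_continuous by blast

lemma smooth_on_has_derivative:
  "smooth_on S f \<Longrightarrow> x \<in> S \<Longrightarrow> (f has_derivative \<D> f x) (at x)"
  unfolding smooth_on_def using C_k_SucD(1) by blast

lemma smooth_on_directional:
  "smooth_on S f \<Longrightarrow> smooth_on S (\<lambda>x. \<D> f x h)"
  unfolding smooth_on_def using C_k_SucD(2) by blast

lemma frechet_derivative_Basis:
  fixes f :: "'a::euclidean_space \<Rightarrow> 'b::real_normed_vector"
  assumes "smooth_on S f" "x \<in> S"
  shows "\<D> f x h = (\<Sum>b\<in>Basis. (h \<bullet> b) *\<^sub>R \<D> f x b)"
proof -
  interpret bounded_linear "\<D> f x"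
    using smooth_on_has_derivative[OF assms] by (rule has_derivative_bounded_linear)
  show ?thesis using sum[of "\<lambda>b. (h \<bullet> b) *\<^sub>R b" Basis] by (simp only: euclidean_representation scaleR)
qed

text \<open>A derivative in a variable direction is again smooth, jointly in the base point and the
  direction, because it is a combination of partial derivatives with the components of the
  direction as coefficients.\<close>

lemma smooth_on_derivative_along:
  fixes f :: "'a::euclidean_space \<Rightarrow> 'b::real_normed_vector" and u h :: "'c::euclidean_space \<Rightarrow> 'a"
  assumes "open S" "open T" "smooth_on T f" "smooth_on S u" "u ` S \<subseteq> T" "smooth_on S h"
  shows "smooth_on S (\<lambda>x. \<D> f (u x) (h x))"
proof (rule smooth_on_cong[OF assms(1)])
  show "smooth_on S (\<lambda>x. \<Sum>b\<in>Basis. (h x \<bullet> b) *\<^sub>R \<D> f (u x) b)"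
    using assms by (intro smooth_on_sum smooth_on_scaleR smooth_on_inner smooth_on_const
      smooth_on_compose[OF _ assms(2) smooth_on_directional[OF assms(3)]])
  show "(\<Sum>b\<in>Basis. (h x \<bullet> b) *\<^sub>R \<D> f (u x) b) = \<D> f (u x) (h x)"
    if "x \<in> S" for x
    using frechet_derivative_Basis[OF assms(3), of "u x" "h x"] assms(5) that by auto
qed

section \<open>Dependence of solutions of differential equations on initial values\<close>

text \<open>Differentiate \<open>e\<^bsup>-(2K+1)t\<^esup> |z|\<^sup>2 - \<epsilon>\<^sup>2 t\<close>. In \<open>2 z \<bullet> z' \<le> 2 K |z|\<^sup>2 + 2 \<epsilon> |z|\<close> the last term is at
  most \<open>|z|\<^sup>2 + \<epsilon>\<^sup>2\<close>, which accounts for the exponent \<open>2K + 1\<close> and for the square of the error.\<close>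

lemma gronwall:
  fixes z :: "real \<Rightarrow> 'a::real_inner"
  assumes der: "\<And>t. t \<in> {0..T} \<Longrightarrow> (z has_vector_derivative z' t) (at t within {0..T})"
    and bound: "\<And>t. t \<in> {0..T} \<Longrightarrow> norm (z' t) \<le> K * norm (z t) + \<epsilon>"
    and "0 \<le> K" "t \<in> {0..T}"
  shows "(norm (z t))\<^sup>2 \<le> exp ((2 * K + 1) * t) * ((norm (z 0))\<^sup>2 + \<epsilon>\<^sup>2 * t)"
proof (cases "t = 0")
  case False
  define E where "E s = exp (- (2 * K + 1) * s)" for s :: real
  define h where "h s = E s * (z s \<bullet> z s) - \<epsilon>\<^sup>2 * s" for s
  define h' where "h' s = E s * (2 * (z s \<bullet> z' s) - (2 * K + 1) * (z s \<bullet> z s)) - \<epsilon>\<^sup>2" for s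
  have t: "0 < t" "{0..t} \<subseteq> {0..T}" using assms(4) False by auto
  have "(h has_derivative (\<lambda>x. x * h' s)) (at s within {0..t})" if "0 \<le> s" "s \<le> t" for s
  proof -
    have zs: "(z has_derivative (\<lambda>x. x *\<^sub>R z' s)) (at s within {0..t})"
      using der[of s] that t has_vector_derivative_within_subset[of z "z' s" s "{0..T}" "{0..t}"]
      by (auto simp: has_vector_derivative_def)
    show ?thesis unfolding h_def E_def
      by (auto intro!: derivative_eq_intros zs
          simp: h'_def E_def algebra_simps inner_commute fun_eq_iff)
  qed
  from mvt_simple[OF t(1) this] obtain s where s: "s \<in> {0<..<t}" "h t - h 0 = (t - 0) * h' s"
    by blast
  have "h' s \<le> 0"
  proof -
    have "z s \<bullet> z' s \<le> norm (z s) * (K * norm (z s) + \<epsilon>)"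
      using norm_cauchy_schwarz[of "z s" "z' s"] mult_left_mono[OF bound[of s] norm_ge_zero[of "z s"]] s(1) t(2)
      by force
    moreover have "2 * (norm (z s) * \<epsilon>) \<le> (norm (z s))\<^sup>2 + \<epsilon>\<^sup>2"
      using sum_squares_bound[of "norm (z s)" \<epsilon>] by simp
    ultimately have "2 * (z s \<bullet> z' s) - (2 * K + 1) * (z s \<bullet> z s) \<le> \<epsilon>\<^sup>2"
      by (simp add: algebra_simps power2_norm_eq_inner[symmetric] power2_eq_square)
    then have "E s * (2 * (z s \<bullet> z' s) - (2 * K + 1) * (z s \<bullet> z s)) \<le> E s * \<epsilon>\<^sup>2"
      by (simp add: E_def)
    also have "\<dots> \<le> 1 * \<epsilon>\<^sup>2"
      using s(1) assms(3) by (intro mult_right_mono) (auto simp: E_def mult_nonpos_nonneg)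
    finally show ?thesis by (simp add: h'_def)
  qed
  then have "h t \<le> h 0" using s t(1) mult_nonneg_nonpos[of t "h' s"] by simp
  then have "E t * (norm (z t))\<^sup>2 \<le> (norm (z 0))\<^sup>2 + \<epsilon>\<^sup>2 * t"
    by (simp add: h_def E_def power2_norm_eq_inner)
  then have "exp ((2 * K + 1) * t) * (E t * (norm (z t))\<^sup>2)
      \<le> exp ((2 * K + 1) * t) * ((norm (z 0))\<^sup>2 + \<epsilon>\<^sup>2 * t)"
    by simp
  moreover have "exp ((2 * K + 1) * t) * E t = 1"
    by (simp add: E_def exp_add[symmetric] algebra_simps)
  ultimately show ?thesis
    by (simp add: mult.assoc[symmetric])
qed simp

text \<open>On a compact set the derivative is uniformly continuous, so the error of linearization is
  controlled by the mean value theorem on segments. The partial derivatives dominate the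
  operator norm, and \<open>\<Phi>\<close> below is the sum of their differences.\<close>

lemma smooth_on_compact_linearization:
  fixes G :: "'a::euclidean_space \<Rightarrow> 'b::real_normed_vector"
  assumes "open \<Omega>" "smooth_on \<Omega> G" "compact S" "convex S" "S \<subseteq> \<Omega>" "0 < e"
  shows "\<exists>d>0. \<forall>a\<in>S. \<forall>b\<in>S. dist a b < d \<longrightarrow>
    norm (G b - G a - \<D> G a (b - a)) \<le> e * norm (b - a)"
proof -
  let ?D = "\<lambda>x. \<D> G x"
  define \<Phi> where "\<Phi> p = (\<Sum>b\<in>Basis. norm (?D (fst p) b - ?D (snd p) b))" for p
  have D: "(G has_derivative ?D x) (at x)" if "x \<in> S" for x
    using assms that by (blast intro: smooth_on_has_derivative)
  have cont: "continuous_on S (\<lambda>x. ?D x b)" for b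
    using assms(2,5) smooth_on_continuous smooth_on_directional continuous_on_subset by blast
  have "continuous_on (S \<times> S) \<Phi>"
    unfolding \<Phi>_def
    by (intro continuous_on_sum continuous_on_norm continuous_on_diff
      continuous_on_compose2[OF cont] continuous_intros) auto
  then have "uniformly_continuous_on (S \<times> S) \<Phi>"
    using assms(3) compact_Times compact_uniformly_continuous by blast
  then obtain d where d: "d > 0"
    "\<And>p p'. p \<in> S \<times> S \<Longrightarrow> p' \<in> S \<times> S \<Longrightarrow> dist p' p < d \<Longrightarrow> dist (\<Phi> p') (\<Phi> p) < e"
    using assms(6) unfolding uniformly_continuous_on_def by metis
  have close: "onorm (?D x - ?D a) \<le> e" if "x \<in> S" "a \<in> S" "dist x a < d" for x a
  proof (rule onorm_le)
    fix h
    interpret bounded_linear "?D x - ?D a"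
      unfolding fun_diff_def using D[OF that(1)] D[OF that(2)]
      by (intro bounded_linear_sub) (auto dest: has_derivative_bounded_linear)
    have "norm ((?D x - ?D a) h) = norm (\<Sum>b\<in>Basis. (h \<bullet> b) *\<^sub>R (?D x - ?D a) b)"
      using sum[of "\<lambda>b. (h \<bullet> b) *\<^sub>R b" Basis] by (simp only: euclidean_representation scaleR)
    also have "\<dots> \<le> (\<Sum>b\<in>Basis. norm h * norm ((?D x - ?D a) b))"
      by (rule order_trans[OF norm_sum sum_mono]) (auto intro!: mult_right_mono Basis_le_norm)
    also have "\<dots> = \<Phi> (x, a) * norm h" by (simp add: \<Phi>_def sum_distrib_left sum_distrib_right mult.commute)
    also have "\<dots> \<le> e * norm h"
      using d(2)[of "(a, a)" "(x, a)"] that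
      by (intro mult_right_mono) (auto simp: \<Phi>_def dist_Pair_Pair dist_real_def)
    finally show "norm ((?D x - ?D a) h) \<le> e * norm h" .
  qed
  show ?thesis
  proof (intro exI[of _ d] conjI d(1) ballI impI)
    fix a b assume ab: "a \<in> S" "b \<in> S" "dist a b < d"
    let ?S = "closed_segment a b"
    have seg: "?S \<subseteq> S" using ab assms(4) by (simp add: closed_segment_subset)
    have "norm (G b - G a - ?D a (b - a)) \<le> norm (b - a) * e"
    proof (rule differentiable_bound_linearization[where S = ?S])
      show "a + t *\<^sub>R (b - a) \<in> ?S" if "t \<in> {0..1}" for t
        using that by (auto simp: closed_segment_def algebra_simps intro!: exI[of _ t])
      show "(G has_derivative ?D x) (at x within ?S)" if "x \<in> ?S" for x
        using D seg that has_derivative_at_withinI by blast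
      show "onorm (?D x - ?D a) \<le> e" if "x \<in> ?S" for x
      proof (rule close)
        show "dist x a < d"
          using segment_bound(1)[OF that] ab(3) by (simp add: dist_norm norm_minus_commute)
      qed (use seg that ab in auto)
    qed simp
    then show "norm (G b - G a - ?D a (b - a)) \<le> e * norm (b - a)" by (simp add: mult.commute)
  qed
qed

lemma smooth_on_compact_lipschitz:
  fixes G :: "'a::euclidean_space \<Rightarrow> 'b::real_normed_vector"
  assumes "open \<Omega>" "smooth_on \<Omega> G" "compact S" "convex S" "S \<subseteq> \<Omega>"
  obtains K where "0 \<le> K" "\<And>a b. a \<in> S \<Longrightarrow> b \<in> S \<Longrightarrow> norm (G b - G a) \<le> K * norm (b - a)"
    "\<And>a h. a \<in> S \<Longrightarrow> norm (\<D> G a h) \<le> K * norm h"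
proof -
  let ?D = "\<lambda>x. \<D> G x"
  define \<Phi> where "\<Phi> x = (\<Sum>b\<in>Basis. norm (?D x b))" for x
  have cont: "continuous_on S (\<lambda>x. ?D x b)" for b
    using assms(2,5) smooth_on_continuous smooth_on_directional continuous_on_subset by blast
  have "continuous_on S \<Phi>" unfolding \<Phi>_def by (intro continuous_on_sum continuous_on_norm cont)
  then have "bounded (\<Phi> ` S)" using assms(3) by (simp add: compact_continuous_image compact_imp_bounded)
  then obtain K where K: "0 < K" "\<And>x. x \<in> S \<Longrightarrow> norm (\<Phi> x) \<le> K" unfolding bounded_pos by blast
  have le: "norm (?D x h) \<le> K * norm h" if "x \<in> S" for x h
  proof -
    have "norm (?D x h) = norm (\<Sum>b\<in>Basis. (h \<bullet> b) *\<^sub>R ?D x b)"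
      using frechet_derivative_Basis[OF assms(2)] that assms(5) by (metis subsetD)
    also have "\<dots> \<le> (\<Sum>b\<in>Basis. norm h * norm (?D x b))"
      by (rule order_trans[OF norm_sum sum_mono]) (auto intro!: mult_right_mono Basis_le_norm)
    also have "\<dots> = \<Phi> x * norm h" by (simp add: \<Phi>_def sum_distrib_left sum_distrib_right mult.commute)
    also have "\<dots> \<le> K * norm h" using K(2)[OF that] by (intro mult_right_mono) auto
    finally show ?thesis .
  qed
  show ?thesis
  proof (rule that[of K])
    show "norm (G b - G a) \<le> K * norm (b - a)" if "a \<in> S" "b \<in> S" for a b
    proof (rule differentiable_bound[OF assms(4) _ _ that(2,1)])
      show "(G has_derivative ?D x) (at x within S)" if "x \<in> S" for x
        using assms(2,5) that smooth_on_has_derivative has_derivative_at_withinI by blast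
      show "onorm (?D x) \<le> K" if "x \<in> S" for x
        using le[OF that] by (rule onorm_le)
    qed
  qed (use K le in auto)
qed

lemma ode_solution_unique:
  fixes G :: "'a::euclidean_space \<Rightarrow> 'a"
  assumes "open \<Omega>" "smooth_on \<Omega> G" "compact S" "convex S" "S \<subseteq> \<Omega>"
    and "\<And>t. t \<in> {0..T} \<Longrightarrow> (y has_vector_derivative G (y t)) (at t within {0..T}) \<and> y t \<in> S"
    and "\<And>t. t \<in> {0..T} \<Longrightarrow> (x has_vector_derivative G (x t)) (at t within {0..T}) \<and> x t \<in> S"
    and "y 0 = x 0" "t \<in> {0..T}"
  shows "y t = x t"
proof -
  obtain K where K: "0 \<le> K" "\<And>a b. a \<in> S \<Longrightarrow> b \<in> S \<Longrightarrow> norm (G b - G a) \<le> K * norm (b - a)"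
    using smooth_on_compact_lipschitz[OF assms(1-5)] by metis
  have "(norm (y t - x t))\<^sup>2 \<le> exp ((2 * K + 1) * t) * ((norm (y 0 - x 0))\<^sup>2 + 0\<^sup>2 * t)"
    by (rule gronwall[where z' = "\<lambda>t. G (y t) - G (x t)" and T = T])
      (use assms K in \<open>auto intro: has_vector_derivative_diff\<close>)
  then show ?thesis using assms(8) by simp
qed


text \<open>Solutions with initial values on a line depend differentiably on the parameter of the line.
  The difference quotients \<open>q s = (y s - y 0) / s\<close> solve the linearized equation up to an error
  that tends to zero uniformly in time, so by Gronwall's inequality they form a uniform Cauchy
  family. Their limit is the variational field, and it solves the linearized equation because
  the derivatives of the quotients converge uniformly as well; existence of solutions of linear
  equations is thus a result and not an ingredient.\<close>

lemma ode_solution_variation: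
  fixes G :: "'a::euclidean_space \<Rightarrow> 'a" and y :: "real \<Rightarrow> real \<Rightarrow> 'a"
  assumes G: "open \<Omega>" "smooth_on \<Omega> G" "compact S" "convex S" "S \<subseteq> \<Omega>"
    and "0 < \<delta>"
    and sol: "\<And>s t. \<bar>s\<bar> < \<delta> \<Longrightarrow> t \<in> {0..1} \<Longrightarrow>
      (y s has_vector_derivative G (y s t)) (at t within {0..1}) \<and> y s t \<in> S"
    and init: "\<And>s. \<bar>s\<bar> < \<delta> \<Longrightarrow> y s 0 = y 0 0 + s *\<^sub>R \<eta>"
  shows "\<exists>z. z 0 = \<eta> \<and> (\<forall>t\<in>{0..1}.
    (z has_vector_derivative \<D> G (y 0 t) (z t)) (at t within {0..1}) \<and>
    ((\<lambda>s. y s t) has_vector_derivative z t) (at 0))"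
proof -
  let ?D = "\<lambda>t. \<D> G (y 0 t)"
  define q where "q s t = (y s t - y 0 t) /\<^sub>R s" for s t
  define q' where "q' s t = (G (y s t) - G (y 0 t)) /\<^sub>R s" for s t
  obtain K where K: "0 \<le> K" "\<And>a b. a \<in> S \<Longrightarrow> b \<in> S \<Longrightarrow> norm (G b - G a) \<le> K * norm (b - a)"
      "\<And>a h. a \<in> S \<Longrightarrow> norm (\<D> G a h) \<le> K * norm h"
    using smooth_on_compact_lipschitz[OF G] by metis
  have inS: "y s t \<in> S" if "\<bar>s\<bar> < \<delta>" "t \<in> {0..1}" for s t using sol that by blast
  have y0S: "y 0 t \<in> S" if "t \<in> {0..1}" for t using inS[of 0 t] that assms(6) by simp
  have D: "bounded_linear (?D t)" if "t \<in> {0..1}" for t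
    using G y0S[OF that] smooth_on_has_derivative has_derivative_bounded_linear by blast
  have dq: "(q s has_vector_derivative q' s t) (at t within {0..1})"
    if "\<bar>s\<bar> < \<delta>" "t \<in> {0..1}" for s t
    unfolding q_def[abs_def] q'_def using sol[OF that] sol[of 0 t] that(2) assms(6)
    by (auto intro!: derivative_eq_intros has_vector_derivative_scaleR has_vector_derivative_diff)
  have q0: "q s 0 = \<eta>" if "\<bar>s\<bar> < \<delta>" "s \<noteq> 0" for s
    using init[OF that(1)] that(2) by (simp add: q_def)
  define E where "E = exp (2 * K + 1)"
  have E1: "1 \<le> E" using K(1) by (simp add: E_def)
  have Et: "exp ((2 * K + 1) * t) * c \<le> E * c" if "t \<in> {0..1}" "0 \<le> c" for t c
    using K(1) that by (auto simp: E_def intro!: mult_right_mono mult_left_le)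
  have sqrt_le: "a \<le> E * b" if "a\<^sup>2 \<le> E * b\<^sup>2" "0 \<le> b" for a b :: real
  proof (rule power2_le_imp_le)
    have "E * b\<^sup>2 \<le> E\<^sup>2 * b\<^sup>2" using E1 by (intro mult_right_mono) (auto simp: power2_eq_square)
    then show "a\<^sup>2 \<le> (E * b)\<^sup>2" using that by (simp add: power_mult_distrib)
    show "0 \<le> E * b" using that E1 by simp
  qed
  define C where "C = E * norm \<eta>"
  have C0: "0 \<le> C" using E1 by (simp add: C_def)
  have qC: "norm (q s t) \<le> C" if s: "\<bar>s\<bar> < \<delta>" "s \<noteq> 0" and t: "t \<in> {0..1}" for s t
  proof -
    have "(norm (q s t))\<^sup>2 \<le> exp ((2 * K + 1) * t) * ((norm (q s 0))\<^sup>2 + 0\<^sup>2 * t)"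
    proof (rule gronwall[OF dq[OF s(1)] _ K(1) t])
      fix t :: real assume t: "t \<in> {0..1}"
      show "norm (q' s t) \<le> K * norm (q s t) + 0"
        using K(2)[OF y0S[OF t] inS[OF s(1) t]] s(2)
        by (simp add: q_def q'_def divide_simps mult.commute)
    qed
    then have "(norm (q s t))\<^sup>2 \<le> E * (norm \<eta>)\<^sup>2"
      using Et[OF t, of "(norm \<eta>)\<^sup>2"] q0[OF s] by simp
    then show ?thesis unfolding C_def by (rule sqrt_le) simp
  qed
  have err: "\<exists>d>0. d < \<delta> \<and> (\<forall>s t. s \<noteq> 0 \<and> \<bar>s\<bar> < d \<and> t \<in> {0..1} \<longrightarrow> norm (q' s t - ?D t (q s t)) \<le> e)"
    if "e > 0" for e
  proof -
    define e1 where "e1 = e / (C + 1)"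
    have e1: "e1 > 0" "e1 * C \<le> e"
      using that C0 by (auto simp: e1_def field_simps)
    obtain d1 where d1: "d1 > 0" "\<And>a b. a \<in> S \<Longrightarrow> b \<in> S \<Longrightarrow> dist a b < d1 \<Longrightarrow>
        norm (G b - G a - \<D> G a (b - a)) \<le> e1 * norm (b - a)"
      using smooth_on_compact_linearization[OF G e1(1)] by metis
    define d where "d = min (\<delta> / 2) (d1 / (C + 1))"
    show ?thesis
    proof (intro exI[of _ d] conjI allI impI)
      show "0 < d" "d < \<delta>" using d1(1) C0 assms(6) by (auto simp: d_def)
      fix s t :: real assume *: "s \<noteq> 0 \<and> \<bar>s\<bar> < d \<and> t \<in> {0..1}"
      then have s: "\<bar>s\<bar> < \<delta>" "s \<noteq> 0" and t: "t \<in> {0..1}" and sd: "\<bar>s\<bar> * (C + 1) < d1"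
        using assms(6) C0 by (auto simp: d_def field_simps)
      have diff: "y s t - y 0 t = s *\<^sub>R q s t" using s by (simp add: q_def)
      have "norm (y s t - y 0 t) \<le> \<bar>s\<bar> * C"
        unfolding diff using qC[OF s t] by (simp add: mult_left_mono)
      also have "\<dots> < d1" using sd s by (simp add: algebra_simps)
      finally have "norm (G (y s t) - G (y 0 t) - ?D t (y s t - y 0 t)) \<le> e1 * norm (y s t - y 0 t)"
        using d1(2)[OF y0S[OF t] inS[OF s(1) t]] by (simp add: dist_norm norm_minus_commute)
      moreover have "?D t (y s t - y 0 t) = s *\<^sub>R ?D t (q s t)"
        unfolding diff using D[OF t] by (simp add: linear_simps)
      moreover have "G (y s t) - G (y 0 t) = s *\<^sub>R q' s t" using s by (simp add: q'_def)
      ultimately have "norm (s *\<^sub>R (q' s t - ?D t (q s t))) \<le> e1 * norm (s *\<^sub>R q s t)"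
        by (simp add: diff scaleR_diff_right)
      then have "norm (q' s t - ?D t (q s t)) \<le> e1 * norm (q s t)" using s by simp
      also have "\<dots> \<le> e1 * C" using qC[OF s t] e1(1) by simp
      finally show "norm (q' s t - ?D t (q s t)) \<le> e" using e1(2) by simp
    qed
  qed
  have cauchy: "\<exists>d>0. d < \<delta> \<and> (\<forall>s s' t. s \<noteq> 0 \<and> \<bar>s\<bar> < d \<and> s' \<noteq> 0 \<and> \<bar>s'\<bar> < d \<and> t \<in> {0..1} \<longrightarrow>
      norm (q s t - q s' t) \<le> e)" if "e > 0" for e
  proof -
    define e1 where "e1 = e / (2 * E)"
    have e1: "e1 > 0" "E * (2 * e1) = e" using that E1 by (auto simp: e1_def)
    from err[OF e1(1)] obtain d where d: "d > 0" "d < \<delta>"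
      "\<And>s t. s \<noteq> 0 \<Longrightarrow> \<bar>s\<bar> < d \<Longrightarrow> t \<in> {0..1} \<Longrightarrow> norm (q' s t - ?D t (q s t)) \<le> e1" by metis
    show ?thesis
    proof (intro exI[of _ d] conjI allI impI d(1,2))
      fix s s' t :: real assume "s \<noteq> 0 \<and> \<bar>s\<bar> < d \<and> s' \<noteq> 0 \<and> \<bar>s'\<bar> < d \<and> t \<in> {0..1}"
      then have s: "s \<noteq> 0" "\<bar>s\<bar> < d" "\<bar>s\<bar> < \<delta>" and s': "s' \<noteq> 0" "\<bar>s'\<bar> < d" "\<bar>s'\<bar> < \<delta>"
        and t: "t \<in> {0..1}" using d(2) by auto
      have "(norm (q s t - q s' t))\<^sup>2 \<le> exp ((2 * K + 1) * t) * ((norm (q s 0 - q s' 0))\<^sup>2 + (2 * e1)\<^sup>2 * t)"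
      proof (rule gronwall[OF _ _ K(1) t])
        fix t :: real assume t: "t \<in> {0..1}"
        show "((\<lambda>t. q s t - q s' t) has_vector_derivative q' s t - q' s' t) (at t within {0..1})"
          using dq[OF s(3) t] dq[OF s'(3) t] by (rule has_vector_derivative_diff)
        have "q' s t - q' s' t = ?D t (q s t - q s' t) + (q' s t - ?D t (q s t)) - (q' s' t - ?D t (q s' t))"
          using D[OF t] by (simp add: linear_simps)
        also have "norm \<dots> \<le> norm (?D t (q s t - q s' t)) + norm (q' s t - ?D t (q s t)) + norm (q' s' t - ?D t (q s' t))"
          by (rule order_trans[OF norm_triangle_ineq4 add_mono[OF norm_triangle_ineq order_refl]])
        also have "\<dots> \<le> K * norm (q s t - q s' t) + 2 * e1"
          using K(3)[OF y0S[OF t], of "q s t - q s' t"] d(3)[OF s(1,2) t] d(3)[OF s'(1,2) t] by linarith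
        finally show "norm (q' s t - q' s' t) \<le> K * norm (q s t - q s' t) + 2 * e1" .
      qed
      also have "\<dots> = exp ((2 * K + 1) * t) * ((2 * e1)\<^sup>2 * t)" by (simp add: q0 s s')
      also have "\<dots> \<le> E * ((2 * e1)\<^sup>2 * t)" using t by (intro Et) auto
      also have "\<dots> \<le> E * (2 * e1)\<^sup>2" using t E1 by (simp add: mult_left_le)
      finally show "norm (q s t - q s' t) \<le> e"
        using sqrt_le[of "norm (q s t - q s' t)" "2 * e1"] e1 by simp
    qed
  qed
  \<comment> \<open>The theorem on limits of derivatives is about sequences, so the parameter runs through \<open>\<sigma>\<close>.\<close>
  define \<sigma> where "\<sigma> n = (\<delta> / 2) * inverse (real (Suc n))" for n
  have \<sigma>: "\<sigma> n \<noteq> 0" "\<bar>\<sigma> n\<bar> < \<delta>" for n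
  proof -
    have "inverse (real (Suc n)) \<le> 1" "0 < inverse (real (Suc n))" by (auto simp: field_simps)
    then show "\<sigma> n \<noteq> 0" "\<bar>\<sigma> n\<bar> < \<delta>"
      using assms(6) mult_left_mono[of "inverse (real (Suc n))" 1 "\<delta> / 2"] by (auto simp: \<sigma>_def abs_mult)
  qed
  have "\<sigma> \<longlonglongrightarrow> 0" unfolding \<sigma>_def using tendsto_mult[OF tendsto_const LIMSEQ_inverse_real_of_nat] by fastforce
  then have \<sigma>_small: "\<forall>\<^sub>F n in sequentially. \<bar>\<sigma> n\<bar> < d" if "d > 0" for d
    using that by (auto simp: tendsto_iff)
  have "\<exists>l. (\<lambda>n. q (\<sigma> n) t) \<longlonglongrightarrow> l" if t: "t \<in> {0..1}" for t
  proof -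
    have "Cauchy (\<lambda>n. q (\<sigma> n) t)"
    proof (rule metric_CauchyI)
      fix e :: real assume "e > 0"
      then obtain d where d: "d > 0"
        "\<And>s s' t. s \<noteq> 0 \<Longrightarrow> \<bar>s\<bar> < d \<Longrightarrow> s' \<noteq> 0 \<Longrightarrow> \<bar>s'\<bar> < d \<Longrightarrow> t \<in> {0..1} \<Longrightarrow> norm (q s t - q s' t) \<le> e / 2"
        using cauchy[of "e / 2"] by (metis half_gt_zero)
      obtain N where N: "\<And>n. n \<ge> N \<Longrightarrow> \<bar>\<sigma> n\<bar> < d"
        using \<sigma>_small[OF d(1)] by (auto simp: eventually_sequentially)
      show "\<exists>M. \<forall>m\<ge>M. \<forall>n\<ge>M. dist (q (\<sigma> m) t) (q (\<sigma> n) t) < e"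
      proof (intro exI[of _ N] allI impI)
        fix m n assume "N \<le> m" "N \<le> n"
        then have "norm (q (\<sigma> m) t - q (\<sigma> n) t) \<le> e / 2" by (intro d(2) \<sigma>(1) N t)
        then show "dist (q (\<sigma> m) t) (q (\<sigma> n) t) < e" using \<open>e > 0\<close> by (simp add: dist_norm)
      qed
    qed
    then show ?thesis by (simp add: Cauchy_convergent convergent_def[symmetric])
  qed
  then obtain z where z: "\<And>t. t \<in> {0..1} \<Longrightarrow> (\<lambda>n. q (\<sigma> n) t) \<longlonglongrightarrow> z t" by metis
  have unif: "\<exists>d>0. d < \<delta> \<and> (\<forall>s t. s \<noteq> 0 \<and> \<bar>s\<bar> < d \<and> t \<in> {0..1} \<longrightarrow> norm (q s t - z t) \<le> e)"
    if "e > 0" for e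
  proof -
    from cauchy[OF that] obtain d where d: "d > 0" "d < \<delta>"
      "\<And>s s' t. s \<noteq> 0 \<Longrightarrow> \<bar>s\<bar> < d \<Longrightarrow> s' \<noteq> 0 \<Longrightarrow> \<bar>s'\<bar> < d \<Longrightarrow> t \<in> {0..1} \<Longrightarrow> norm (q s t - q s' t) \<le> e"
      by metis
    show ?thesis
    proof (intro exI[of _ d] conjI allI impI d(1,2))
      fix s t :: real assume *: "s \<noteq> 0 \<and> \<bar>s\<bar> < d \<and> t \<in> {0..1}"
      show "norm (q s t - z t) \<le> e"
      proof (rule tendsto_upperbound)
        show "(\<lambda>n. norm (q s t - q (\<sigma> n) t)) \<longlonglongrightarrow> norm (q s t - z t)"
          using z * by (intro tendsto_intros) auto
        show "\<forall>\<^sub>F n in sequentially. norm (q s t - q (\<sigma> n) t) \<le> e"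
          using \<sigma>_small[OF d(1)] by (rule eventually_mono) (use d(3) * \<sigma>(1) in auto)
      qed simp
    qed
  qed
  have "\<exists>g. \<forall>t\<in>{0..1}. (\<lambda>n. q (\<sigma> n) t) \<longlonglongrightarrow> g t \<and>
      (g has_derivative (\<lambda>h. h *\<^sub>R ?D t (z t))) (at t within {0..1})"
  proof (rule has_derivative_sequence[where f' = "\<lambda>n t h. h *\<^sub>R q' (\<sigma> n) t" and ?x0.0 = 0])
    show "(q (\<sigma> n) has_derivative (\<lambda>h. h *\<^sub>R q' (\<sigma> n) t)) (at t within {0..1})" if "t \<in> {0..1}" for n t
      using dq[OF \<sigma>(2) that] by (simp add: has_vector_derivative_def)
    show "(\<lambda>n. q (\<sigma> n) 0) \<longlonglongrightarrow> z 0" by (rule z) simp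
    fix e :: real assume e: "e > 0"
    define e1 where "e1 = e / (K + 1)"
    have "e1 * (K + 1) = e" using K(1) by (simp add: e1_def)
    then have e1: "K * e1 + e1 = e" by (simp add: algebra_simps)
    have e1_pos: "e1 > 0" using e K(1) by (simp add: e1_def)
    obtain d1 where d1: "d1 > 0"
      "\<And>s t. s \<noteq> 0 \<Longrightarrow> \<bar>s\<bar> < d1 \<Longrightarrow> t \<in> {0..1} \<Longrightarrow> norm (q' s t - ?D t (q s t)) \<le> e1"
      using err[OF e1_pos] by metis
    obtain d2 where d2: "d2 > 0"
      "\<And>s t. s \<noteq> 0 \<Longrightarrow> \<bar>s\<bar> < d2 \<Longrightarrow> t \<in> {0..1} \<Longrightarrow> norm (q s t - z t) \<le> e1"
      using unif[OF e1_pos] by metis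
    show "\<forall>\<^sub>F n in sequentially. \<forall>t\<in>{0..1}. \<forall>h.
        norm (h *\<^sub>R q' (\<sigma> n) t - h *\<^sub>R ?D t (z t)) \<le> e * norm h"
      using \<sigma>_small[OF d1(1)] \<sigma>_small[OF d2(1)]
    proof eventually_elim
      case (elim n)
      show ?case
      proof (intro ballI allI)
        fix t h :: real assume t: "t \<in> {0..1}"
        have "q' (\<sigma> n) t - ?D t (z t) = (q' (\<sigma> n) t - ?D t (q (\<sigma> n) t)) + ?D t (q (\<sigma> n) t - z t)"
          using D[OF t] by (simp add: linear_simps)
        also have "norm \<dots> \<le> e1 + K * norm (q (\<sigma> n) t - z t)"
          using norm_triangle_le add_mono d1(2)[OF \<sigma>(1) elim(1) t] K(3)[OF y0S[OF t]] by blast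
        also have "\<dots> \<le> e"
          using mult_left_mono[OF d2(2)[OF \<sigma>(1) elim(2) t] K(1)] e1 by linarith
        finally show "norm (h *\<^sub>R q' (\<sigma> n) t - h *\<^sub>R ?D t (z t)) \<le> e * norm h"
          by (simp add: scaleR_diff_right[symmetric] mult_left_mono mult.commute[of e])
      qed
    qed
  qed auto
  then obtain g where g: "\<And>t. t \<in> {0..1} \<Longrightarrow> (\<lambda>n. q (\<sigma> n) t) \<longlonglongrightarrow> g t"
    "\<And>t. t \<in> {0..1} \<Longrightarrow> (g has_derivative (\<lambda>h. h *\<^sub>R ?D t (z t))) (at t within {0..1})" by blast
  have gz: "g t = z t" if "t \<in> {0..1}" for t using z g(1) that LIMSEQ_unique by blast
  show ?thesis
  proof (intro exI[of _ g] conjI ballI)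
    show "g 0 = \<eta>"
      using z[of 0] gz[of 0] q0[OF \<sigma>(2,1)] by (simp add: LIMSEQ_const_iff)
    fix t :: real assume t: "t \<in> {0..1}"
    show "(g has_vector_derivative ?D t (g t)) (at t within {0..1})"
      using g(2)[OF t] gz[OF t] by (simp add: has_vector_derivative_def)
    have quot: "norm (y (0 + s) t - y 0 t - s *\<^sub>R z t) / norm s = norm (q s t - z t)" if "s \<noteq> 0" for s
    proof -
      have "q s t - z t = (y s t - y 0 t - s *\<^sub>R z t) /\<^sub>R s"
        using that by (simp add: q_def scaleR_diff_right)
      then show ?thesis by (simp add: divide_inverse mult.commute)
    qed
    have "(\<lambda>s. norm (y (0 + s) t - y 0 t - s *\<^sub>R z t) / norm s) \<midarrow>0\<rightarrow> 0"
    proof (rule LIM_I)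
      fix e :: real assume e: "e > 0"
      obtain d where d: "d > 0"
        "\<And>s t. s \<noteq> 0 \<Longrightarrow> \<bar>s\<bar> < d \<Longrightarrow> t \<in> {0..1} \<Longrightarrow> norm (q s t - z t) \<le> e / 2"
        using unif[OF half_gt_zero[OF e]] by blast
      show "\<exists>d>0. \<forall>s. s \<noteq> 0 \<and> norm (s - 0) < d \<longrightarrow>
          norm (norm (y (0 + s) t - y 0 t - s *\<^sub>R z t) / norm s - 0) < e"
      proof (intro exI[of _ d] conjI allI impI d(1))
        fix s :: real assume s: "s \<noteq> 0 \<and> norm (s - 0) < d"
        have "norm (q s t - z t) < e" using d(2)[of s t] s t e by simp
        then show "norm (norm (y (0 + s) t - y 0 t - s *\<^sub>R z t) / norm s - 0) < e"
          using quot[of s] s by simp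
      qed
    qed
    then have "((\<lambda>s. y s t) has_derivative (\<lambda>h. h *\<^sub>R z t)) (at 0)"
      unfolding has_derivative_at using bounded_linear_scaleR_left by blast
    then show "((\<lambda>s. y s t) has_vector_derivative g t) (at 0)"
      using gz[OF t] by (simp add: has_vector_derivative_def)
  qed
qed

section \<open>Second derivatives and forms with smooth coefficients\<close>

text \<open>The mean value theorem in both directions, applied to the second difference over a
  parallelogram.\<close>

lemma mixed_difference_mean_value:
  fixes f :: "'a::euclidean_space \<Rightarrow> real"
  assumes f: "smooth_on S f" and s: "0 < s"
    and S: "\<And>a b. a \<in> {0..s} \<Longrightarrow> b \<in> {0..s} \<Longrightarrow> x + a *\<^sub>R h + b *\<^sub>R k \<in> S"
  obtains a b where "a \<in> {0..s}" "b \<in> {0..s}"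
    "f (x + s *\<^sub>R h + s *\<^sub>R k) - f (x + s *\<^sub>R h) - f (x + s *\<^sub>R k) + f x =
      s * (s * \<D> (\<lambda>y. \<D> f y h) (x + a *\<^sub>R h + b *\<^sub>R k) k)"
proof -
  let ?D = "\<lambda>y. \<D> f y h"
  have along: "((\<lambda>t. F (c t)) has_field_derivative \<D> F (c r) d) (at r)"
    if F: "smooth_on S F" and c: "(c has_derivative (\<lambda>h. h *\<^sub>R d)) (at r)" "c r \<in> S"
    for F :: "'a \<Rightarrow> real" and c :: "real \<Rightarrow> 'a" and d r
  proof -
    note D = smooth_on_has_derivative[OF F c(2)]
    have "((\<lambda>t. F (c t)) has_derivative (\<lambda>h. \<D> F (c r) (h *\<^sub>R d))) (at r)"
      using has_derivative_compose[OF c(1) D] .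
    moreover have "(\<lambda>h. \<D> F (c r) (h *\<^sub>R d)) = (*) (\<D> F (c r) d)"
      using has_derivative_bounded_linear[OF D]
      by (auto simp: fun_eq_iff bounded_linear.linear linear_cmul mult.commute)
    ultimately show ?thesis by (simp add: has_field_derivative_def)
  qed
  define G where "G a = f (x + a *\<^sub>R h + s *\<^sub>R k) - f (x + a *\<^sub>R h)" for a
  have "DERIV G a :> ?D (x + a *\<^sub>R h + s *\<^sub>R k) - ?D (x + a *\<^sub>R h)" if "0 \<le> a" "a \<le> s" for a
    unfolding G_def using that s S[of a s] S[of a 0]
    by (intro DERIV_diff along[OF f]) (auto intro!: derivative_eq_intros)
  from MVT2[OF s this] obtain a where a: "0 < a" "a < s"
    "G s - G 0 = (s - 0) * (?D (x + a *\<^sub>R h + s *\<^sub>R k) - ?D (x + a *\<^sub>R h))" by blast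
  have "DERIV (\<lambda>b. ?D (x + a *\<^sub>R h + b *\<^sub>R k)) b :> \<D> ?D (x + a *\<^sub>R h + b *\<^sub>R k) k"
    if "0 \<le> b" "b \<le> s" for b
    using that a S[of a b]
    by (intro along[OF smooth_on_directional[OF f]]) (auto intro!: derivative_eq_intros)
  from MVT2[OF s this] obtain b where b: "0 < b" "b < s"
    "?D (x + a *\<^sub>R h + s *\<^sub>R k) - ?D (x + a *\<^sub>R h + 0 *\<^sub>R k) =
      (s - 0) * \<D> ?D (x + a *\<^sub>R h + b *\<^sub>R k) k" by blast
  show ?thesis
    using that[of a b] a b by (simp add: G_def)
qed

text \<open>Both mixed second derivatives are limits of the same second difference quotient.\<close>

lemma symmetric_second_derivative:
  fixes f :: "'a::euclidean_space \<Rightarrow> real"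
  assumes "open S" "smooth_on S f" "x \<in> S"
  shows "\<D> (\<lambda>y. \<D> f y h) x k =
    \<D> (\<lambda>y. \<D> f y k) x h"
proof (rule ccontr)
  define P where "P y = \<D> (\<lambda>y. \<D> f y h) y k" for y
  define Q where "Q y = \<D> (\<lambda>y. \<D> f y k) y h" for y
  assume "\<D> (\<lambda>y. \<D> f y h) x k \<noteq>
    \<D> (\<lambda>y. \<D> f y k) x h"
  then have e: "dist (P x) (Q x) / 2 > 0" by (simp add: P_def Q_def)
  have "smooth_on S P" "smooth_on S Q"
    unfolding P_def Q_def using assms(2) by (auto intro: smooth_on_directional)
  then have "isCont P x" "isCont Q x"
    using assms(1,3) smooth_on_continuous continuous_on_interior interior_open by metis+
  then obtain d1 d2 where d: "d1 > 0" "\<And>y. dist y x < d1 \<Longrightarrow> dist (P y) (P x) < dist (P x) (Q x) / 2"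
      "d2 > 0" "\<And>y. dist y x < d2 \<Longrightarrow> dist (Q y) (Q x) < dist (P x) (Q x) / 2"
    using e unfolding continuous_at_eps_delta by metis
  obtain d3 where d3: "d3 > 0" "ball x d3 \<subseteq> S" using assms(1,3) openE by blast
  define d where "d = min d3 (min d1 d2)"
  define s where "s = d / (2 * (norm h + norm k + 1))"
  have d0: "d > 0" using d d3 by (simp add: d_def)
  then have s: "s > 0" by (simp add: s_def add_nonneg_pos)
  have sd: "s * (norm h + norm k) < d"
  proof -
    have "s * (2 * (norm h + norm k + 1)) = d"
      using add_nonneg_pos[of "norm h + norm k" 1] by (simp add: s_def)
    moreover have "s * (norm h + norm k) < s * (2 * (norm h + norm k + 1))"
      by (rule mult_strict_left_mono[OF _ s]) (smt (verit) norm_ge_zero)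
    ultimately show ?thesis by simp
  qed
  have near: "dist (x + a *\<^sub>R u + b *\<^sub>R w) x < d"
    if "a \<in> {0..s}" "b \<in> {0..s}" "(u = h \<and> w = k) \<or> (u = k \<and> w = h)" for a b u w
  proof -
    have "norm (a *\<^sub>R u + b *\<^sub>R w) \<le> a * norm u + b * norm w"
      by (rule order_trans[OF norm_triangle_ineq]) (use that in auto)
    also have "\<dots> \<le> s * norm u + s * norm w"
      using that by (intro add_mono mult_right_mono) auto
    also have "\<dots> < d" using sd that(3) by (auto simp: algebra_simps)
    finally show ?thesis by (simp add: dist_norm add.assoc)
  qed
  then have inS: "x + a *\<^sub>R u + b *\<^sub>R w \<in> S"
    if "a \<in> {0..s}" "b \<in> {0..s}" "(u = h \<and> w = k) \<or> (u = k \<and> w = h)" for a b u w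
    using that d3(2) by (force simp: d_def dist_commute)
  obtain a b where ab: "a \<in> {0..s}" "b \<in> {0..s}"
    "f (x + s *\<^sub>R h + s *\<^sub>R k) - f (x + s *\<^sub>R h) - f (x + s *\<^sub>R k) + f x = s * (s * P (x + a *\<^sub>R h + b *\<^sub>R k))"
    unfolding P_def using mixed_difference_mean_value[OF assms(2) s, of x h k] inS by metis
  obtain a' b' where ab': "a' \<in> {0..s}" "b' \<in> {0..s}"
    "f (x + s *\<^sub>R k + s *\<^sub>R h) - f (x + s *\<^sub>R k) - f (x + s *\<^sub>R h) + f x = s * (s * Q (x + a' *\<^sub>R k + b' *\<^sub>R h))"
    unfolding Q_def using mixed_difference_mean_value[OF assms(2) s, of x k h] inS by metis
  have "s * (s * P (x + a *\<^sub>R h + b *\<^sub>R k)) = s * (s * Q (x + a' *\<^sub>R k + b' *\<^sub>R h))"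
    using ab(3) ab'(3) by (simp add: algebra_simps)
  then have eq: "P (x + a *\<^sub>R h + b *\<^sub>R k) = Q (x + a' *\<^sub>R k + b' *\<^sub>R h)" using s by simp
  have "dist (P (x + a *\<^sub>R h + b *\<^sub>R k)) (P x) < dist (P x) (Q x) / 2"
    using near[OF ab(1,2)] by (intro d(2)) (auto simp: d_def)
  moreover have "dist (Q (x + a' *\<^sub>R k + b' *\<^sub>R h)) (Q x) < dist (P x) (Q x) / 2"
    using near[OF ab'(1,2)] by (intro d(4)) (auto simp: d_def)
  ultimately show False
    unfolding eq using dist_triangle_half_r by blast
qed

text \<open>A bilinear form on the model space with coefficients depending smoothly on a base point: a
  metric, seen in a chart.\<close>

definition smooth_form :: "'a::euclidean_space set \<Rightarrow> ('a \<Rightarrow> 'a \<Rightarrow> 'a \<Rightarrow> real) \<Rightarrow> bool" where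
  "smooth_form S b \<longleftrightarrow> open S \<and> (\<forall>x\<in>S. bilinear (b x)) \<and> (\<forall>u w. smooth_on S (\<lambda>x. b x u w))"

definition form_derivative :: "('a::euclidean_space \<Rightarrow> 'a \<Rightarrow> 'a \<Rightarrow> real) \<Rightarrow> 'a \<Rightarrow> 'a \<Rightarrow> 'a \<Rightarrow> 'a \<Rightarrow> real" where
  "form_derivative b x h u w = \<D> (\<lambda>y. b y u w) x h"

context
  fixes S :: "'a::euclidean_space set" and b :: "'a \<Rightarrow> 'a \<Rightarrow> 'a \<Rightarrow> real"
  assumes b: "smooth_form S b"
begin

lemma smooth_form_bilinear: "x \<in> S \<Longrightarrow> bilinear (b x)"
  using b by (simp add: smooth_form_def)

lemma smooth_form_open: "open S"
  using b by (simp add: smooth_form_def)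

lemma smooth_form_coefficient: "smooth_on S (\<lambda>x. b x u w)"
  using b by (simp add: smooth_form_def)

text \<open>With the coefficients of the form in the standard basis, smoothness and derivatives of the
  form as a function of all three arguments reduce to those of the coefficients.\<close>

lemma smooth_form_expand:
  assumes "x \<in> S"
  shows "b x u w = (\<Sum>i\<in>Basis. \<Sum>j\<in>Basis. (u \<bullet> i) * (w \<bullet> j) * b x i j)"
proof -
  note bl = smooth_form_bilinear[OF assms]
  have "b x u w = b x (\<Sum>i\<in>Basis. (u \<bullet> i) *\<^sub>R i) (\<Sum>j\<in>Basis. (w \<bullet> j) *\<^sub>R j)"
    by (simp add: euclidean_representation)
  also have "\<dots> = (\<Sum>(i, j)\<in>Basis \<times> Basis. b x ((u \<bullet> i) *\<^sub>R i) ((w \<bullet> j) *\<^sub>R j))"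
    using bl by (rule bilinear_sum)
  also have "\<dots> = (\<Sum>i\<in>Basis. \<Sum>j\<in>Basis. (u \<bullet> i) * (w \<bullet> j) * b x i j)"
    by (simp add: sum.cartesian_product bilinear_lmul[OF bl] bilinear_rmul[OF bl] mult_ac)
  finally show ?thesis .
qed

lemma smooth_on_form:
  fixes x u w :: "'b::euclidean_space \<Rightarrow> 'a"
  assumes "open T" "smooth_on T x" "smooth_on T u" "smooth_on T w" "x ` T \<subseteq> S"
  shows "smooth_on T (\<lambda>p. b (x p) (u p) (w p))"
proof (rule smooth_on_cong[OF assms(1)])
  show "smooth_on T (\<lambda>p. \<Sum>i\<in>Basis. \<Sum>j\<in>Basis. (u p \<bullet> i) * (w p \<bullet> j) * b (x p) i j)"
  proof (intro smooth_on_sum[OF assms(1)] smooth_on_mult[OF assms(1)] smooth_on_inner[OF assms(1)]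
      smooth_on_const[OF assms(1)] assms(3,4))
    show "smooth_on T (\<lambda>p. b (x p) i j)" for i j
      by (rule smooth_on_compose[OF assms(1) smooth_form_open smooth_form_coefficient assms(2,5)])
  qed
  show "(\<Sum>i\<in>Basis. \<Sum>j\<in>Basis. (u p \<bullet> i) * (w p \<bullet> j) * b (x p) i j) = b (x p) (u p) (w p)"
    if "p \<in> T" for p using smooth_form_expand[of "x p" "u p" "w p"] assms(5) that by auto
qed

lemma form_derivative_works:
  "x \<in> S \<Longrightarrow> ((\<lambda>y. b y u w) has_derivative (\<lambda>h. form_derivative b x h u w)) (at x)"
  unfolding form_derivative_def
  using smooth_on_has_derivative[OF smooth_form_coefficient] by simp

lemma form_derivative_expand:
  assumes "x \<in> S"
  shows "form_derivative b x h u w = (\<Sum>i\<in>Basis. \<Sum>j\<in>Basis. (u \<bullet> i) * (w \<bullet> j) * form_derivative b x h i j)"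
proof -
  have "((\<lambda>y. \<Sum>i\<in>Basis. \<Sum>j\<in>Basis. (u \<bullet> i) * (w \<bullet> j) * b y i j) has_derivative
      (\<lambda>h. \<Sum>i\<in>Basis. \<Sum>j\<in>Basis. (u \<bullet> i) * (w \<bullet> j) * form_derivative b x h i j)) (at x)"
    by (intro has_derivative_sum has_derivative_mult_right form_derivative_works assms)
  then have "((\<lambda>y. b y u w) has_derivative
      (\<lambda>h. \<Sum>i\<in>Basis. \<Sum>j\<in>Basis. (u \<bullet> i) * (w \<bullet> j) * form_derivative b x h i j)) (at x)"
    by (rule has_derivative_transform_within_open[OF _ smooth_form_open assms])
      (rule smooth_form_expand[symmetric])
  from has_derivative_unique[OF this form_derivative_works[OF assms]] show ?thesis by metis
qed

lemma form_derivative_linear: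
  assumes "x \<in> S"
  shows "linear (\<lambda>h. form_derivative b x h u w)" "linear (\<lambda>u. form_derivative b x h u w)"
    "linear (\<lambda>w. form_derivative b x h u w)"
proof -
  show "linear (\<lambda>h. form_derivative b x h u w)"
    using form_derivative_works[OF assms] has_derivative_linear by blast
  show "linear (\<lambda>u. form_derivative b x h u w)"
    by (subst (1) form_derivative_expand[OF assms], rule linearI)
      (simp_all add: inner_add_left sum.distrib sum_distrib_left algebra_simps)
  show "linear (\<lambda>w. form_derivative b x h u w)"
    by (subst (1) form_derivative_expand[OF assms], rule linearI)
      (simp_all add: inner_add_left sum.distrib sum_distrib_left algebra_simps)
qed

lemma smooth_on_form_derivative:
  fixes x h u w :: "'b::euclidean_space \<Rightarrow> 'a"
  assumes "open T" "smooth_on T x" "smooth_on T h" "smooth_on T u" "smooth_on T w" "x ` T \<subseteq> S"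
  shows "smooth_on T (\<lambda>p. form_derivative b (x p) (h p) (u p) (w p))"
proof (rule smooth_on_cong[OF assms(1)])
  show "smooth_on T (\<lambda>p. \<Sum>i\<in>Basis. \<Sum>j\<in>Basis. (u p \<bullet> i) * (w p \<bullet> j) *
      \<D> (\<lambda>y. b y i j) (x p) (h p))"
  proof (intro smooth_on_sum[OF assms(1)] smooth_on_mult[OF assms(1)] smooth_on_inner[OF assms(1)]
      smooth_on_const[OF assms(1)] assms(4,5))
    show "smooth_on T (\<lambda>p. \<D> (\<lambda>y. b y i j) (x p) (h p))" for i j
      by (rule smooth_on_derivative_along[OF assms(1) smooth_form_open smooth_form_coefficient assms(2,6,3)])
  qed
  show "(\<Sum>i\<in>Basis. \<Sum>j\<in>Basis. (u p \<bullet> i) * (w p \<bullet> j) *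
      \<D> (\<lambda>y. b y i j) (x p) (h p)) = form_derivative b (x p) (h p) (u p) (w p)"
    if "p \<in> T" for p
    using form_derivative_expand[of "x p" "h p" "u p" "w p"] assms(6) that
    by (auto simp: form_derivative_def)
qed

lemma form_has_derivative:
  fixes x u w :: "'b::real_normed_vector \<Rightarrow> 'a"
  assumes x: "(x has_derivative x') (at p within T)" and u: "(u has_derivative u') (at p within T)"
    and w: "(w has_derivative w') (at p within T)" and "x p \<in> S"
  shows "((\<lambda>p. b (x p) (u p) (w p)) has_derivative
    (\<lambda>h. form_derivative b (x p) (x' h) (u p) (w p) + b (x p) (u' h) (w p) + b (x p) (u p) (w' h))) (at p within T)"
proof -
  let ?q = "(x p, u p, w p)"
  let ?F = "\<lambda>q. b (fst q) (fst (snd q)) (snd (snd q))"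
  let ?E = "\<lambda>q. \<Sum>i\<in>Basis. \<Sum>j\<in>Basis. (fst (snd q) \<bullet> i) * (snd (snd q) \<bullet> j) * b (fst q) i j"
  let ?D = "\<lambda>k. form_derivative b (x p) (fst k) (u p) (w p) + b (x p) (fst (snd k)) (w p) + b (x p) (u p) (snd (snd k))"
  have bd: "((\<lambda>q. b (fst q) i j) has_derivative (\<lambda>k. form_derivative b (x p) (fst k) i j)) (at ?q)"
    for i j
    using has_derivative_compose[OF has_derivative_fst[OF has_derivative_ident], of "\<lambda>y. b y i j" _ ?q UNIV]
      form_derivative_works[OF assms(4)] by fastforce
  have "(?E has_derivative ?D) (at ?q)"
  proof (rule has_derivative_eq_rhs)
    show "(?E has_derivative (\<lambda>k. \<Sum>i\<in>Basis. \<Sum>j\<in>Basis.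
      (u p \<bullet> i) * (w p \<bullet> j) * form_derivative b (x p) (fst k) i j +
      ((u p \<bullet> i) * (snd (snd k) \<bullet> j) + (fst (snd k) \<bullet> i) * (w p \<bullet> j)) * b (x p) i j)) (at ?q)"
      by (intro has_derivative_sum has_derivative_eq_rhs[OF has_derivative_mult[OF has_derivative_mult[OF
          has_derivative_inner_left[OF has_derivative_fst[OF has_derivative_snd[OF has_derivative_ident]]]
          has_derivative_inner_left[OF has_derivative_snd[OF has_derivative_snd[OF has_derivative_ident]]]] bd]])
        simp
    show "(\<lambda>k. \<Sum>i\<in>Basis. \<Sum>j\<in>Basis.
      (u p \<bullet> i) * (w p \<bullet> j) * form_derivative b (x p) (fst k) i j +
      ((u p \<bullet> i) * (snd (snd k) \<bullet> j) + (fst (snd k) \<bullet> i) * (w p \<bullet> j)) * b (x p) i j) = ?D"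
    by (simp add: form_derivative_expand[OF assms(4), of _ "u p" "w p"]
      smooth_form_expand[OF assms(4), of _ "w p"] smooth_form_expand[OF assms(4), of "u p"]
      sum.distrib distrib_right fun_eq_iff)
  qed
  then have "(?F has_derivative ?D) (at ?q)"
  proof (rule has_derivative_transform_within_open[where s = "S \<times> UNIV"])
    show "?E q = ?F q" if "q \<in> S \<times> UNIV" for q
      using that by (intro smooth_form_expand[symmetric]) auto
  qed (use assms(4) smooth_form_open in \<open>auto simp: open_Times\<close>)
  from has_derivative_compose[OF has_derivative_Pair[OF x has_derivative_Pair[OF u w]] this]
  show ?thesis by simp
qed

lemma form_has_real_derivative:
  fixes x u w :: "real \<Rightarrow> 'a"
  assumes "(x has_vector_derivative x') (at t within T)" "(u has_vector_derivative u') (at t within T)"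
    "(w has_vector_derivative w') (at t within T)" "x t \<in> S"
  shows "((\<lambda>t. b (x t) (u t) (w t)) has_real_derivative
    (form_derivative b (x t) x' (u t) (w t) + b (x t) u' (w t) + b (x t) (u t) w')) (at t within T)"
  unfolding has_field_derivative_def
  by (rule has_derivative_eq_rhs[OF form_has_derivative[OF assms(1-3)[unfolded has_vector_derivative_def] assms(4)]])
    (simp add: fun_eq_iff algebra_simps linear_cmul[OF form_derivative_linear(1)[OF assms(4)]]
      bilinear_lmul[OF smooth_form_bilinear[OF assms(4)]] bilinear_rmul[OF smooth_form_bilinear[OF assms(4)]])

end

section \<open>Tangent vectors, fields, metrics and curves in a chart\<close>

text \<open>The components of a tangent vector are its values on the coordinate functions. The same sum
  defines the fibre part of the charts of the tangent bundle.\<close>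

definition coordinate_vector :: "('q \<Rightarrow> 'e::euclidean_space) \<Rightarrow> 'q tangent \<Rightarrow> 'e" where
  "coordinate_vector \<phi> v = (\<Sum>b\<in>Basis. v (\<lambda>x. \<phi> x \<bullet> b) *\<^sub>R b)"

lemma coordinate_vector_inner: "b \<in> Basis \<Longrightarrow> coordinate_vector \<phi> v \<bullet> b = v (\<lambda>x. \<phi> x \<bullet> b)"
  unfolding coordinate_vector_def by simp

lemma coordinate_vector_eqI:
  "(\<And>b. b \<in> Basis \<Longrightarrow> v (\<lambda>x. \<phi> x \<bullet> b) = w \<bullet> b) \<Longrightarrow> coordinate_vector \<phi> v = w"
  by (rule euclidean_eqI) (simp add: coordinate_vector_inner)

lemma coordinate_vector_add_scaled:
  "coordinate_vector \<phi> (add_scaled v s u) = coordinate_vector \<phi> v + s *\<^sub>R coordinate_vector \<phi> u"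
  by (rule coordinate_vector_eqI) (simp add: add_scaled_def inner_add_left coordinate_vector_inner)

lemma coordinate_vector_zero: "coordinate_vector \<phi> zero_vector = 0"
  by (rule coordinate_vector_eqI) (simp add: zero_vector_def)

locale atlas_chart =
  fixes A :: "('q, 'e::euclidean_space) atlas" and U :: "'q set" and \<phi> :: "'q \<Rightarrow> 'e"
  assumes atlas: "smooth_atlas A" and chart: "(U, \<phi>) \<in> A"
begin

abbreviation (input) "\<phi>' \<equiv> inv_into U \<phi>"
abbreviation "cvec \<equiv> chart_vector A (U, \<phi>)"
abbreviation "coord \<equiv> coordinate_vector \<phi>"

lemma inj: "inj_on \<phi> U" and open_image: "open (\<phi> ` U)"
  using atlas chart unfolding smooth_atlas_def by auto

lemma inv_chart: "y \<in> \<phi> ` U \<Longrightarrow> \<phi> (\<phi>' y) = y" "y \<in> \<phi> ` U \<Longrightarrow> \<phi>' y \<in> U"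
  by (auto simp: f_inv_into_f inv_into_into)

lemma chart_inv: "p \<in> U \<Longrightarrow> \<phi>' (\<phi> p) = p"
  using inj by simp

lemma in_carrier: "p \<in> U \<Longrightarrow> p \<in> carrier A"
  using chart by (auto simp: carrier_def)

lemma transition_smooth:
  "(V, \<psi>) \<in> A \<Longrightarrow> open (\<psi> ` (V \<inter> U)) \<and> smooth_on (\<psi> ` (V \<inter> U)) (\<lambda>y. \<phi> (inv_into V \<psi> y))"
  using atlas chart unfolding smooth_atlas_def comp_def by fastforce

lemma open_image_openin: "openin (manifold_topology A) N \<Longrightarrow> open (\<phi> ` (U \<inter> N))"
  using openin_manifold_topology[OF atlas, of N] chart by auto

lemma openin_preimage:
  assumes "open W"
  shows "openin (manifold_topology A) (U \<inter> \<phi> -` W)"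
  unfolding openin_manifold_topology[OF atlas]
proof (intro conjI ballI, safe)
  show "x \<in> carrier A" if "x \<in> U" for x using in_carrier that .
  fix V \<psi> assume V: "(V, \<psi>) \<in> A"
  then have injV: "inj_on \<psi> V" using atlas by (auto simp: smooth_atlas_def)
  have "open ((\<lambda>y. \<phi> (inv_into V \<psi> y)) -` W \<inter> \<psi> ` (V \<inter> U))"
    using transition_smooth[OF V] smooth_on_continuous assms continuous_open_preimage
    by (metis Int_commute)
  moreover have "\<psi> ` (V \<inter> (U \<inter> \<phi> -` W)) = (\<lambda>y. \<phi> (inv_into V \<psi> y)) -` W \<inter> \<psi> ` (V \<inter> U)"
    using injV by auto
  ultimately show "open (\<psi> ` (V \<inter> (U \<inter> \<phi> -` W)))" by simp
qed

lemma openin_domain: "openin (manifold_topology A) U"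
  using openin_preimage[OF open_UNIV] by simp

text \<open>Transition maps are smooth, so inside the domain of a chart smoothness need only be tested in
  that chart.\<close>

lemma smooth_fun_chart:
  assumes N: "openin (manifold_topology A) N" "N \<subseteq> U"
  shows "smooth_fun A N f \<longleftrightarrow> smooth_on (\<phi> ` N) (\<lambda>y. f (\<phi>' y))"
proof
  assume "smooth_fun A N f"
  then have "smooth_on (\<phi> ` (U \<inter> N)) (f \<circ> \<phi>')" using chart unfolding smooth_fun_def by fast
  then show "smooth_on (\<phi> ` N) (\<lambda>y. f (\<phi>' y))" using N(2) by (simp add: Int_absorb1 comp_def)
next
  assume f: "smooth_on (\<phi> ` N) (\<lambda>y. f (\<phi>' y))"
  show "smooth_fun A N f" unfolding smooth_fun_def
  proof safe
    fix V \<psi> assume V: "(V, \<psi>) \<in> A"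
    then have injV: "inj_on \<psi> V" using atlas by (auto simp: smooth_atlas_def)
    have opV: "open (\<psi> ` (V \<inter> N))"
      using openin_manifold_topology[OF atlas, of N] V N by auto
    have opU: "open (\<phi> ` N)"
      using open_image_openin[OF N(1)] N(2) by (simp add: Int_absorb1)
    have "smooth_on (\<psi> ` (V \<inter> N)) (\<lambda>y. f (\<phi>' (\<phi> (inv_into V \<psi> y))))"
      by (rule smooth_on_compose[OF opV opU f smooth_on_subset[OF conjunct2[OF transition_smooth[OF V]]]])
        (use N injV in auto)
    then show "smooth_on (\<psi> ` (V \<inter> N)) (f \<circ> inv_into V \<psi>)"
      by (rule smooth_on_cong[OF opV, rotated]) (use N injV in \<open>auto simp: chart_inv subset_iff\<close>)
  qed
qed

text \<open>A function that agrees in the chart with a smooth \<open>F\<close> near a point is smooth near that point, and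
  coordinate derivatives of \<open>F\<close> evaluate tangent vectors on it. All test functions on the manifold
  and on its tangent bundle are treated in this way.\<close>

lemma smooth_near_chartI:
  assumes "p \<in> U" "open W" "\<phi> p \<in> W" "smooth_on W F" "\<And>y. y \<in> W \<Longrightarrow> y \<in> \<phi> ` U \<Longrightarrow> f (\<phi>' y) = F y"
  shows "smooth_near A p f" "cvec p h f = \<D> F (\<phi> p) h"
    "((\<lambda>y. f (\<phi>' y)) has_derivative \<D> F (\<phi> p)) (at (\<phi> p))"
proof -
  let ?N = "U \<inter> \<phi> -` W"
  have N: "openin (manifold_topology A) ?N" using openin_preimage assms(2) .
  have im: "\<phi> ` ?N = W \<inter> \<phi> ` U" by auto
  have op: "open (W \<inter> \<phi> ` U)" using assms(2) open_image by blast
  have "smooth_on (W \<inter> \<phi> ` U) (\<lambda>y. f (\<phi>' y))"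
    by (rule smooth_on_cong[OF op _ smooth_on_subset[OF assms(4)]]) (use assms(5) in auto)
  then have "smooth_fun A ?N f" using smooth_fun_chart[OF N, of f] im by simp
  then show near: "smooth_near A p f"
    unfolding smooth_near_def using N assms(1,3) by blast
  show der: "((\<lambda>y. f (\<phi>' y)) has_derivative \<D> F (\<phi> p)) (at (\<phi> p))"
    by (rule has_derivative_transform_within_open[OF smooth_on_has_derivative[OF assms(4,3)] op])
      (use assms in auto)
  show "cvec p h f = \<D> F (\<phi> p) h"
    using near frechet_derivative_at[OF der] by (simp add: chart_vector_def comp_def)
qed

lemma smooth_near_chartE:
  assumes "smooth_near A p f" "p \<in> U"
  obtains N where "openin (manifold_topology A) N" "p \<in> N" "N \<subseteq> U" "open (\<phi> ` N)"
    "smooth_on (\<phi> ` N) (\<lambda>y. f (\<phi>' y))" "\<And>x. x \<in> N \<Longrightarrow> smooth_near A x f"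
proof -
  obtain N where N: "openin (manifold_topology A) N" "p \<in> N" "smooth_fun A N f"
    using assms(1) unfolding smooth_near_def by blast
  have N': "openin (manifold_topology A) (U \<inter> N)" using openin_domain N(1) by blast
  have "smooth_on (\<phi> ` (U \<inter> N)) (\<lambda>y. f (\<phi>' y))"
    using N(3) chart unfolding smooth_fun_def comp_def by fast
  then show ?thesis
    using that[of "U \<inter> N"] N' N assms(2) open_image_openin[OF N(1)] by (auto simp: smooth_near_def)
qed

lemma smooth_near_has_derivative:
  assumes "smooth_near A p f" "p \<in> U"
  shows "((\<lambda>y. f (\<phi>' y)) has_derivative (\<lambda>h. cvec p h f)) (at (\<phi> p))"
proof -
  obtain N where "p \<in> N" "smooth_on (\<phi> ` N) (\<lambda>y. f (\<phi>' y))"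
    using smooth_near_chartE[OF assms] by metis
  then have "((\<lambda>y. f (\<phi>' y)) has_derivative \<D> (\<lambda>y. f (\<phi>' y)) (\<phi> p)) (at (\<phi> p))"
    by (intro smooth_on_has_derivative) auto
  then show ?thesis using assms(1) by (simp add: chart_vector_def comp_def)
qed

lemma smooth_near_coordinate: "p \<in> U \<Longrightarrow> smooth_near A p (\<lambda>x. \<phi> x \<bullet> b)"
  and cvec_coordinate: "p \<in> U \<Longrightarrow> cvec p h (\<lambda>x. \<phi> x \<bullet> b) = h \<bullet> b"
proof -
  assume p: "p \<in> U"
  have sm: "smooth_on (\<phi> ` U) (\<lambda>y. y \<bullet> b)"
    using open_image by (intro smooth_on_inner smooth_on_ident smooth_on_const)
  have fd: "\<D> (\<lambda>y. y \<bullet> b) (\<phi> p) h = h \<bullet> b"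
    using frechet_derivative_at[OF bounded_linear_imp_has_derivative[OF bounded_linear_inner_left]] by metis
  note * = smooth_near_chartI[OF p open_image _ sm, where f = "\<lambda>x. \<phi> x \<bullet> b"]
  show "smooth_near A p (\<lambda>x. \<phi> x \<bullet> b)" using p by (intro *(1)) (auto simp: inv_chart)
  show "cvec p h (\<lambda>x. \<phi> x \<bullet> b) = h \<bullet> b" using p fd by (subst *(2)) (auto simp: inv_chart)
qed

lemma coord_cvec [simp]: "p \<in> U \<Longrightarrow> coord (cvec p h) = h"
  by (rule coordinate_vector_eqI) (simp add: cvec_coordinate)

text \<open>By the chain rule, a vector given in another chart is carried into this one by the derivative
  of the transition map.\<close>

lemma tangent_space_chart: "p \<in> U \<Longrightarrow> tangent_space A p = range (cvec p)"
proof
  assume p: "p \<in> U"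
  show "range (cvec p) \<subseteq> tangent_space A p"
    unfolding tangent_space_def using chart p by fastforce
  show "tangent_space A p \<subseteq> range (cvec p)"
  proof
    fix v assume "v \<in> tangent_space A p"
    then obtain V \<psi> h where V: "(V, \<psi>) \<in> A" "p \<in> V" "v = chart_vector A (V, \<psi>) p h"
      unfolding tangent_space_def by auto
    interpret V: atlas_chart A V \<psi> by unfold_locales (use atlas V in auto)
    let ?\<tau> = "\<lambda>y. \<phi> (inv_into V \<psi> y)"
    have "(?\<tau> has_derivative \<D> ?\<tau> (\<psi> p)) (at (\<psi> p))"
      using transition_smooth[OF V(1)] V(2) p by (intro smooth_on_has_derivative) auto
    note \<tau> = this
    have "v f = cvec p (\<D> ?\<tau> (\<psi> p) h) f" for f
    proof (cases "smooth_near A p f")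
      case True
      have "((\<lambda>y. f (\<phi>' (?\<tau> y))) has_derivative
          (\<lambda>h. cvec p (\<D> ?\<tau> (\<psi> p) h) f)) (at (\<psi> p))"
        using has_derivative_compose[OF \<tau>, of "\<lambda>y. f (\<phi>' y)" "\<lambda>h. cvec p h f"]
          smooth_near_has_derivative[OF True p] V.chart_inv[OF V(2)] by simp
      then have "((\<lambda>y. f (inv_into V \<psi> y)) has_derivative
          (\<lambda>h. cvec p (\<D> ?\<tau> (\<psi> p) h) f)) (at (\<psi> p))"
        by (rule has_derivative_transform_within_open[where s = "\<psi> ` (V \<inter> U)"])
          (use transition_smooth[OF V(1)] V(2) p in \<open>auto simp: V.chart_inv chart_inv\<close>)
      from has_derivative_unique[OF this V.smooth_near_has_derivative[OF True V(2)]]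
      show ?thesis by (simp add: V(3) fun_eq_iff)
    qed (simp add: V(3) chart_vector_def)
    then show "v \<in> range (cvec p)" by blast
  qed
qed

lemma cvec_coord: "p \<in> U \<Longrightarrow> v \<in> tangent_space A p \<Longrightarrow> cvec p (coord v) = v"
  by (auto simp: tangent_space_chart)

lemma cvec_in_tangent_space: "p \<in> U \<Longrightarrow> cvec p h \<in> tangent_space A p"
  by (simp add: tangent_space_chart)

lemma cvec_linear: "p \<in> U \<Longrightarrow> linear (\<lambda>h. cvec p h f)"
proof (cases "smooth_near A p f")
  case False
  then show ?thesis by (simp add: chart_vector_def linear_zero)
qed (use smooth_near_has_derivative has_derivative_linear in blast)

lemma add_scaled_cvec: "p \<in> U \<Longrightarrow> add_scaled (cvec p h) s (cvec p k) = cvec p (h + s *\<^sub>R k)"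
  by (simp add: add_scaled_def fun_eq_iff linear_add[OF cvec_linear] linear_cmul[OF cvec_linear])

lemma zero_vector_cvec: "p \<in> U \<Longrightarrow> zero_vector = cvec p 0"
  by (simp add: zero_vector_def fun_eq_iff linear_0[OF cvec_linear])

lemma tangent_space_add_scaled:
  "p \<in> U \<Longrightarrow> v \<in> tangent_space A p \<Longrightarrow> w \<in> tangent_space A p \<Longrightarrow> add_scaled v s w \<in> tangent_space A p"
  by (auto simp: tangent_space_chart add_scaled_cvec)

lemma tangent_vector_apply:
  "p \<in> U \<Longrightarrow> v \<in> tangent_space A p \<Longrightarrow> smooth_near A p f \<Longrightarrow>
    v f = \<D> (\<lambda>y. f (\<phi>' y)) (\<phi> p) (coord v)"
  using smooth_near_has_derivative[of p f] frechet_derivative_at cvec_coord by metis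

lemma lincomb_cvec: 
  assumes "p \<in> U" "finite S" "\<And>\<alpha>. \<alpha> \<in> S \<Longrightarrow> X \<alpha> p \<in> tangent_space A p"
  shows "lincomb S x X p = cvec p (\<Sum>\<alpha>\<in>S. x \<alpha> *\<^sub>R coord (X \<alpha> p))"
  by (simp add: lincomb_def fun_eq_iff linear_sum[OF cvec_linear[OF assms(1)]]
    linear_cmul[OF cvec_linear[OF assms(1)]] cvec_coord[OF assms(1) assms(3)])

text \<open>The coordinate fields are admissible test fields in the definition of a metric. This makes the
  coefficients of the metric in the chart smooth.\<close>

lemma coordinate_field: "vector_field A U (\<lambda>q. cvec q h)"
  unfolding vector_field_def
proof (intro conjI ballI allI impI)
  show "cvec q h \<in> tangent_space A q" if "q \<in> U" for q using that by (rule cvec_in_tangent_space)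
  fix N f assume N: "openin (manifold_topology A) N \<and> N \<subseteq> U \<and> smooth_fun A N f"
  have sm: "smooth_on (\<phi> ` N) (\<lambda>y. f (\<phi>' y))" using smooth_fun_chart N by blast
  have op: "open (\<phi> ` N)" using open_image_openin[of N] N by (simp add: Int_absorb1)
  have "smooth_on (\<phi> ` N) (\<lambda>y. cvec (\<phi>' y) h f)"
  proof (rule smooth_on_cong[OF op _ smooth_on_directional[OF sm, of h]])
    fix y assume "y \<in> \<phi> ` N"
    then obtain x where x: "x \<in> N" "y = \<phi> x" by blast
    then have "\<phi>' y = x" using N chart_inv by blast
    moreover have "smooth_near A x f" using N x by (auto simp: smooth_near_def)
    ultimately show "\<D> (\<lambda>y. f (\<phi>' y)) y h = cvec (\<phi>' y) h f"
      using x by (simp add: chart_vector_def comp_def)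
  qed
  then show "smooth_fun A N (\<lambda>q. cvec q h f)" using smooth_fun_chart N by blast
qed

lemma vector_field_coord_smooth:
  assumes "vector_field A N X" "U \<subseteq> N"
  shows "smooth_on (\<phi> ` U) (\<lambda>y. coord (X (\<phi>' y)))"
proof -
  have "smooth_on (\<phi> ` U) (\<lambda>y. X (\<phi>' y) (\<lambda>x. \<phi> x \<bullet> b))" for b
  proof -
    have "smooth_on (\<phi> ` U) (\<lambda>y. \<phi> (\<phi>' y) \<bullet> b)"
      by (rule smooth_on_cong[OF open_image _ smooth_on_inner[OF open_image smooth_on_ident[OF open_image]
              smooth_on_const[OF open_image]]]) (auto simp: inv_chart)
    then have "smooth_fun A U (\<lambda>x. \<phi> x \<bullet> b)"
      using smooth_fun_chart[OF openin_domain] by simp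
    then have "smooth_fun A U (\<lambda>q. X q (\<lambda>x. \<phi> x \<bullet> b))"
      using assms openin_domain unfolding vector_field_def by blast
    then show ?thesis using smooth_fun_chart[OF openin_domain] by simp
  qed
  then show ?thesis unfolding coordinate_vector_def
    using open_image by (intro smooth_on_sum smooth_on_scaleR smooth_on_const)
qed

definition chart_metric :: "('q \<Rightarrow> 'q tangent \<Rightarrow> 'q tangent \<Rightarrow> real) \<Rightarrow> 'e \<Rightarrow> 'e \<Rightarrow> 'e \<Rightarrow> real" where
  "chart_metric g y u w = g (\<phi>' y) (cvec (\<phi>' y) u) (cvec (\<phi>' y) w)"

lemma metric_chart:
  "q \<in> U \<Longrightarrow> u \<in> tangent_space A q \<Longrightarrow> w \<in> tangent_space A q \<Longrightarrow>
    g q u w = chart_metric g (\<phi> q) (coord u) (coord w)"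
  by (simp add: chart_metric_def chart_inv cvec_coord)

context
  fixes g assumes g: "riemannian_metric A g"
begin

lemma metric_commute:
  "q \<in> U \<Longrightarrow> u \<in> tangent_space A q \<Longrightarrow> v \<in> tangent_space A q \<Longrightarrow> g q u v = g q v u"
  and metric_pos: "q \<in> U \<Longrightarrow> u \<in> tangent_space A q \<Longrightarrow> u \<noteq> zero_vector \<Longrightarrow> 0 < g q u u"
  and metric_add_scaled: "q \<in> U \<Longrightarrow> u \<in> tangent_space A q \<Longrightarrow> v \<in> tangent_space A q \<Longrightarrow>
    w \<in> tangent_space A q \<Longrightarrow> g q (add_scaled u s v) w = g q u w + s * g q v w"
  using g in_carrier[of q] unfolding riemannian_metric_def by blast+

lemma chart_metric_commute: "y \<in> \<phi> ` U \<Longrightarrow> chart_metric g y u w = chart_metric g y w u"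
  unfolding chart_metric_def by (intro metric_commute cvec_in_tangent_space inv_chart)

lemma chart_metric_pos: "y \<in> \<phi> ` U \<Longrightarrow> u \<noteq> 0 \<Longrightarrow> 0 < chart_metric g y u u"
proof -
  assume y: "y \<in> \<phi> ` U" "u \<noteq> 0"
  then have "cvec (\<phi>' y) u \<noteq> zero_vector"
    using coord_cvec[of "\<phi>' y" u] coordinate_vector_zero[of \<phi>] inv_chart(2) by metis
  then show ?thesis
    unfolding chart_metric_def by (intro metric_pos cvec_in_tangent_space inv_chart(2) y(1))
qed

lemma chart_metric_smooth_form: "smooth_form (\<phi> ` U) (chart_metric g)"
  unfolding smooth_form_def
proof (intro conjI ballI allI open_image)
  fix y assume y: "y \<in> \<phi> ` U"
  let ?q = "\<phi>' y"
  have q: "?q \<in> U" using y by (rule inv_chart)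
  have lin: "chart_metric g y (u + s *\<^sub>R v) w = chart_metric g y u w + s * chart_metric g y v w" for u v w s
    using metric_add_scaled[OF q] cvec_in_tangent_space[OF q]
    by (simp add: chart_metric_def add_scaled_cvec[OF q, symmetric])
  have zero: "chart_metric g y 0 w = 0" for w using lin[of 0 1 0 w] by simp
  have l1: "linear (\<lambda>u. chart_metric g y u w)" for w
  proof (rule linearI)
    show "chart_metric g y (u + v) w = chart_metric g y u w + chart_metric g y v w" for u v
      using lin[of u 1 v w] by simp
    show "chart_metric g y (s *\<^sub>R v) w = s *\<^sub>R chart_metric g y v w" for s v
      using lin[of 0 s v w] zero by simp
  qed
  then have "linear (\<lambda>w. chart_metric g y u w)" for u
    by (subst chart_metric_commute[OF y])
  then show "bilinear (chart_metric g y)" using l1 by (simp add: bilinear_def)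
next
  fix u w
  have "smooth_fun A U (\<lambda>q. g q (cvec q u) (cvec q w))"
    using g openin_domain coordinate_field unfolding riemannian_metric_def by blast
  then show "smooth_on (\<phi> ` U) (\<lambda>y. chart_metric g y u w)"
    using smooth_fun_chart[OF openin_domain] by (simp add: chart_metric_def)
qed

end

text \<open>The values of \<open>\<phi>\<close> outside \<open>U\<close> are arbitrary, so the curve has to stay in \<open>U\<close> for times close to
  \<open>t\<close>.\<close>

lemma velocity_chart:
  assumes "((\<lambda>s. \<phi> (c s)) has_vector_derivative h) (at t)" "\<forall>\<^sub>F s in nhds t. c s \<in> U"
  shows "velocity A c t = cvec (c t) h"
proof
  fix f
  have ct: "c t \<in> U" using assms(2) by (rule eventually_nhds_x_imp_x)
  show "velocity A c t f = cvec (c t) h f"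
  proof (cases "smooth_near A (c t) f")
    case True
    have "((\<lambda>s. f (\<phi>' (\<phi> (c s)))) has_derivative (\<lambda>x. cvec (c t) (x *\<^sub>R h) f)) (at t)"
      using has_derivative_compose[OF assms(1)[unfolded has_vector_derivative_def]
          smooth_near_has_derivative[OF True ct]] .
    then have "((\<lambda>s. f (c s)) has_derivative (\<lambda>x. cvec (c t) (x *\<^sub>R h) f)) (at t)"
      by (rule has_derivative_transform_eventually)
        (use assms(2) ct in \<open>auto simp: chart_inv eventually_nhds_conv_at elim: eventually_mono\<close>)
    moreover have "(\<lambda>x. cvec (c t) (x *\<^sub>R h) f) = (*) (cvec (c t) h f)"
      by (auto simp: fun_eq_iff linear_cmul[OF cvec_linear[OF ct]])
    ultimately have "((\<lambda>s. f (c s)) has_real_derivative cvec (c t) h f) (at t)"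
      by (simp add: has_field_derivative_def)
    then show ?thesis using True by (simp add: velocity_def DERIV_imp_deriv)
  qed (simp add: velocity_def chart_vector_def)
qed

text \<open>Since the indicator function of an open set is smooth near the points of the set, a
  differentiable curve is continuous.\<close>

lemma differentiable_curve_continuous:
  assumes "differentiable_curve A c t" "openin (manifold_topology A) N" "c t \<in> N"
  shows "\<forall>\<^sub>F s in nhds t. c s \<in> N"
proof -
  let ?f = "\<lambda>x. if x \<in> N then 1 else 0 :: real"
  have "smooth_fun A N ?f" unfolding smooth_fun_def
  proof safe
    fix V \<psi> assume V: "(V, \<psi>) \<in> A"
    then have injV: "inj_on \<psi> V" using atlas by (auto simp: smooth_atlas_def)
    have op: "open (\<psi> ` (V \<inter> N))" using openin_manifold_topology[OF atlas, of N] V assms(2) by auto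
    show "smooth_on (\<psi> ` (V \<inter> N)) (?f \<circ> inv_into V \<psi>)"
      by (rule smooth_on_cong[OF op _ smooth_on_const[OF op, of 1]]) (use injV in auto)
  qed
  then have "(\<lambda>s. ?f (c s)) differentiable (at t)"
    using assms unfolding differentiable_curve_def smooth_near_def by blast
  then have "isCont (\<lambda>s. ?f (c s)) t" by (rule differentiable_imp_continuous_within)
  then have "((\<lambda>s. ?f (c s)) \<longlongrightarrow> ?f (c t)) (at t)" unfolding isCont_def .
  then have "\<forall>\<^sub>F s in at t. ?f (c s) > 0" by (rule order_tendstoD(1)) (use assms(3) in simp)
  then have "\<forall>\<^sub>F s in at t. c s \<in> N" by (rule eventually_mono) (auto split: if_splits)
  then show ?thesis using assms(3) by (simp add: eventually_nhds_conv_at)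
qed

lemma differentiable_curve_chart:
  assumes "differentiable_curve A c t" "c t \<in> U"
  shows "((\<lambda>s. \<phi> (c s)) has_vector_derivative coord (velocity A c t)) (at t)"
proof -
  have "((\<lambda>s. \<phi> (c s) \<bullet> b) has_vector_derivative velocity A c t (\<lambda>x. \<phi> x \<bullet> b)) (at t)" for b
  proof -
    have "(\<lambda>s. \<phi> (c s) \<bullet> b) differentiable (at t)"
      using assms smooth_near_coordinate[OF assms(2)] unfolding differentiable_curve_def by blast
    then show ?thesis
      using smooth_near_coordinate[OF assms(2)]
      by (simp add: velocity_def DERIV_deriv_iff_real_differentiable has_real_derivative_iff_has_vector_derivative[symmetric])
  qed
  then have "((\<lambda>s. \<Sum>b\<in>Basis. (\<phi> (c s) \<bullet> b) *\<^sub>R b) has_vector_derivative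
      (\<Sum>b\<in>Basis. velocity A c t (\<lambda>x. \<phi> x \<bullet> b) *\<^sub>R b)) (at t)"
    by (intro has_vector_derivative_sum) (auto intro!: derivative_eq_intros
      simp: has_real_derivative_iff_has_vector_derivative)
  then show ?thesis by (simp add: euclidean_representation coordinate_vector_def)
qed

end

section \<open>The tangent bundle in a chart and lifts of vector fields\<close>

text \<open>The derivative of \<open>f\<close> at a moving point in a moving direction: the product rule with one term for
  the point and one for the direction.\<close>

lemma derivative_has_derivative:
  fixes f :: "'a::euclidean_space \<Rightarrow> 'b::real_normed_vector"
  assumes f: "open S" "smooth_on S f" and x: "(x has_derivative x') (at p within T)"
    and u: "(u has_derivative u') (at p within T)" and xp: "x p \<in> S"
  shows "((\<lambda>p. \<D> f (x p) (u p)) has_derivative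
    (\<lambda>h. \<D> (\<lambda>y. \<D> f y (u p)) (x p) (x' h) +
      \<D> f (x p) (u' h))) (at p within T)"
proof -
  let ?D = "\<lambda>y. \<D> f y"
  let ?D2 = "\<lambda>h. \<D> (\<lambda>y. ?D y h) (x p)"
  let ?E = "\<lambda>q. \<Sum>b\<in>Basis. (snd q \<bullet> b) *\<^sub>R ?D (fst q) b"
  have D2: "((\<lambda>y. ?D y h) has_derivative ?D2 h) (at (x p))" for h
    by (rule smooth_on_has_derivative[OF smooth_on_directional[OF f(2)] xp])
  have "((\<lambda>y. \<Sum>b\<in>Basis. (u p \<bullet> b) *\<^sub>R ?D y b) has_derivative
      (\<lambda>h. \<Sum>b\<in>Basis. (u p \<bullet> b) *\<^sub>R ?D2 b h)) (at (x p))"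
    by (intro has_derivative_sum has_derivative_scaleR_right D2)
  then have "((\<lambda>y. ?D y (u p)) has_derivative (\<lambda>h. \<Sum>b\<in>Basis. (u p \<bullet> b) *\<^sub>R ?D2 b h)) (at (x p))"
    by (rule has_derivative_transform_within_open[OF _ f(1) xp])
      (rule frechet_derivative_Basis[OF f(2), symmetric])
  then have D2u: "?D2 (u p) h = (\<Sum>b\<in>Basis. (u p \<bullet> b) *\<^sub>R ?D2 b h)" for h
    using fun_cong[OF has_derivative_unique[OF D2], of _ _ h] by blast
  have D1: "((\<lambda>q. ?D (fst q) b) has_derivative (\<lambda>k. ?D2 b (fst k))) (at (x p, u p))" for b
    using has_derivative_compose[OF has_derivative_fst[OF has_derivative_ident], of "\<lambda>y. ?D y b" _ "(x p, u p)" UNIV]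
      D2 by fastforce
  have "((\<lambda>q. (snd q \<bullet> b) *\<^sub>R ?D (fst q) b) has_derivative
      (\<lambda>k. (u p \<bullet> b) *\<^sub>R ?D2 b (fst k) + (snd k \<bullet> b) *\<^sub>R ?D (x p) b)) (at (x p, u p))" for b
    using has_derivative_scaleR[OF has_derivative_inner_left[OF has_derivative_snd[OF has_derivative_ident]] D1[of b], of b]
    by simp
  then have "(?E has_derivative (\<lambda>k. \<Sum>b\<in>Basis. (u p \<bullet> b) *\<^sub>R ?D2 b (fst k) + (snd k \<bullet> b) *\<^sub>R ?D (x p) b)) (at (x p, u p))"
    by (intro has_derivative_sum)
  then have "(?E has_derivative (\<lambda>k. ?D2 (u p) (fst k) + ?D (x p) (snd k))) (at (x p, u p))"
    unfolding sum.distrib D2u[symmetric] frechet_derivative_Basis[OF f(2) xp, symmetric] .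
  then have "((\<lambda>q. ?D (fst q) (snd q)) has_derivative (\<lambda>k. ?D2 (u p) (fst k) + ?D (x p) (snd k))) (at (x p, u p))"
  proof (rule has_derivative_transform_within_open[where s = "S \<times> UNIV"])
    show "?E q = ?D (fst q) (snd q)" if "q \<in> S \<times> UNIV" for q
      using that by (intro frechet_derivative_Basis[OF f(2), symmetric]) auto
  qed (use f(1) xp in \<open>auto simp: open_Times\<close>)
  from has_derivative_compose[OF has_derivative_Pair[OF x u] this] show ?thesis by simp
qed

context atlas_chart
begin

definition tangent_domain :: "('q \<times> 'q tangent) set" where
  "tangent_domain = {(q, v). q \<in> U \<and> v \<in> tangent_space A q}"

definition tangent_chart :: "'q \<times> 'q tangent \<Rightarrow> 'e \<times> 'e" where
  "tangent_chart = (\<lambda>(q, v). (\<phi> q, coord v))"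

lemma tangent_chart_in_atlas: "(tangent_domain, tangent_chart) \<in> tangent_atlas A"
  unfolding tangent_atlas_def tangent_domain_def tangent_chart_def coordinate_vector_def
  using chart by force

lemma tangent_chart_inv:
  "inj_on tangent_chart tangent_domain" "tangent_chart ` tangent_domain = \<phi> ` U \<times> UNIV"
  "y \<in> \<phi> ` U \<Longrightarrow> inv_into tangent_domain tangent_chart (y, \<xi>) = (\<phi>' y, cvec (\<phi>' y) \<xi>)"
proof -
  show 1: "inj_on tangent_chart tangent_domain"
    using inj by (auto simp: inj_on_def tangent_chart_def tangent_domain_def) (metis cvec_coord)
  have 2: "(\<phi>' y, cvec (\<phi>' y) \<xi>) \<in> tangent_domain \<and> tangent_chart (\<phi>' y, cvec (\<phi>' y) \<xi>) = (y, \<xi>)"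
    if "y \<in> \<phi> ` U" for y \<xi>
    using that by (auto simp: tangent_chart_def tangent_domain_def chart_inv cvec_in_tangent_space)
  show "tangent_chart ` tangent_domain = \<phi> ` U \<times> UNIV"
  proof
    show "\<phi> ` U \<times> UNIV \<subseteq> tangent_chart ` tangent_domain"
      using 2 by (metis (no_types, lifting) imageI mem_Sigma_iff subrelI)
  qed (auto simp: tangent_chart_def tangent_domain_def)
  show "inv_into tangent_domain tangent_chart (y, \<xi>) = (\<phi>' y, cvec (\<phi>' y) \<xi>)" if "y \<in> \<phi> ` U"
    using 1 2[OF that] inv_into_f_eq by metis
qed

lemma coord_change_of_chart:
  assumes V: "(V, \<psi>) \<in> A" "p \<in> V" "p \<in> U"
  shows "coord (chart_vector A (V, \<psi>) p \<xi>) = \<D> (\<lambda>y. \<phi> (inv_into V \<psi> y)) (\<psi> p) \<xi>"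
proof -
  interpret V: atlas_chart A V \<psi> by unfold_locales (use atlas V in auto)
  let ?\<tau> = "\<lambda>y. \<phi> (inv_into V \<psi> y)"
  have "(?\<tau> has_derivative \<D> ?\<tau> (\<psi> p)) (at (\<psi> p))"
    using transition_smooth[OF V(1)] V by (intro smooth_on_has_derivative) auto
  then have d: "((\<lambda>y. ?\<tau> y \<bullet> b) has_derivative (\<lambda>\<xi>. \<D> ?\<tau> (\<psi> p) \<xi> \<bullet> b)) (at (\<psi> p))" for b
    by (rule has_derivative_inner_left)
  show ?thesis
  proof (rule coordinate_vector_eqI)
    fix b
    have "((\<lambda>y. ?\<tau> y \<bullet> b) has_derivative (\<lambda>h. V.cvec p h (\<lambda>x. \<phi> x \<bullet> b))) (at (\<psi> p))"
      using V.smooth_near_has_derivative[OF smooth_near_coordinate[OF V(3)] V(2)] by simp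
    from has_derivative_unique[OF this d]
    show "V.cvec p \<xi> (\<lambda>x. \<phi> x \<bullet> b) = \<D> ?\<tau> (\<psi> p) \<xi> \<bullet> b" by metis
  qed
qed

end

text \<open>The transition maps of the tangent bundle are \<open>(y, \<xi>) \<mapsto> (\<tau> y, D\<tau>(y) \<xi>)\<close> for the transition maps
  \<open>\<tau>\<close> of the base. Once this is a smooth atlas, everything proved about charts and curves applies to the
  tangent bundle too.\<close>

lemma smooth_atlas_tangent:
  fixes A :: "('q, 'e::euclidean_space) atlas"
  assumes "smooth_atlas A" shows "smooth_atlas (tangent_atlas A)"
proof -
  have charts: "\<exists>U \<phi>. atlas_chart A U \<phi> \<and> TU = atlas_chart.tangent_domain A U \<and>
      T\<phi> = atlas_chart.tangent_chart \<phi>" if T: "(TU, T\<phi>) \<in> tangent_atlas A" for TU T\<phi>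
  proof -
    obtain U \<phi> where U: "(U, \<phi>) \<in> A" "TU = {(q, v). q \<in> U \<and> v \<in> tangent_space A q}"
        "T\<phi> = (\<lambda>(q, v). (\<phi> q, \<Sum>b\<in>Basis. v (\<lambda>x. \<phi> x \<bullet> b) *\<^sub>R b))"
      using T unfolding tangent_atlas_def by auto
    interpret atlas_chart A U \<phi> by unfold_locales (use assms U in auto)
    show ?thesis
      using atlas_chart_axioms U(2,3)
      by (intro exI[of _ U] exI[of _ \<phi>])
        (auto simp: tangent_domain_def tangent_chart_def coordinate_vector_def)
  qed
  have trans: "open (T\<phi> ` (TU \<inter> TV)) \<and> smooth_on (T\<phi> ` (TU \<inter> TV)) (T\<psi> \<circ> inv_into TU T\<phi>)"
    if TU: "(TU, T\<phi>) \<in> tangent_atlas A" and TV: "(TV, T\<psi>) \<in> tangent_atlas A" for TU T\<phi> TV T\<psi>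
  proof -
    obtain U \<phi> where U: "atlas_chart A U \<phi>" and TU': "TU = atlas_chart.tangent_domain A U"
      "T\<phi> = atlas_chart.tangent_chart \<phi>" using charts[OF TU] by blast
    interpret U: atlas_chart A U \<phi> by fact
    obtain V \<psi> where V: "atlas_chart A V \<psi>" and TV': "TV = atlas_chart.tangent_domain A V"
      "T\<psi> = atlas_chart.tangent_chart \<psi>" using charts[OF TV] by blast
    interpret V: atlas_chart A V \<psi> by fact
    let ?\<tau> = "\<lambda>y. \<psi> (inv_into U \<phi> y)"
    let ?S = "\<phi> ` (U \<inter> V)"
    have \<tau>: "open ?S" "smooth_on ?S ?\<tau>"
      using V.transition_smooth[OF U.chart] by auto
    have im: "T\<phi> ` (TU \<inter> TV) = ?S \<times> UNIV"
    proof
      show "?S \<times> UNIV \<subseteq> T\<phi> ` (TU \<inter> TV)"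
      proof safe
        fix q \<xi> assume "q \<in> U" "q \<in> V"
        then have "(q, U.cvec q \<xi>) \<in> TU \<inter> TV" "T\<phi> (q, U.cvec q \<xi>) = (\<phi> q, \<xi>)"
          by (auto simp: TU' TV' U.tangent_domain_def V.tangent_domain_def U.tangent_chart_def
              U.cvec_in_tangent_space)
        then show "(\<phi> q, \<xi>) \<in> T\<phi> ` (TU \<inter> TV)" by force
      qed
    qed (auto simp: TU' TV' U.tangent_domain_def V.tangent_domain_def U.tangent_chart_def)
    have op: "open (?S \<times> (UNIV :: 'e set))" using \<tau>(1) by (simp add: open_Times)
    have "smooth_on (?S \<times> UNIV) (\<lambda>p. (?\<tau> (fst p), \<D> ?\<tau> (fst p) (snd p)))"
      by (intro smooth_on_Pair[OF op] smooth_on_compose[OF op \<tau>] smooth_on_derivative_along[OF op \<tau>]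
          smooth_on_fst[OF op] smooth_on_snd[OF op] smooth_on_ident[OF op]) auto
    then have "smooth_on (?S \<times> UNIV) (T\<psi> \<circ> inv_into TU T\<phi>)"
    proof (rule smooth_on_cong[OF op, rotated])
      fix p :: "'e \<times> 'e" assume "p \<in> ?S \<times> UNIV"
      then obtain q \<xi> where p: "p = (\<phi> q, \<xi>)" "q \<in> U" "q \<in> V" by auto
      then show "(?\<tau> (fst p), \<D> ?\<tau> (fst p) (snd p)) = (T\<psi> \<circ> inv_into TU T\<phi>) p"
        using V.coord_change_of_chart[OF U.chart, of q \<xi>]
        by (simp add: TU' TV' U.tangent_chart_inv U.chart_inv V.tangent_chart_def)
    qed
    then show ?thesis using im op by simp
  qed
  have "inj_on T\<phi> TU \<and> open (T\<phi> ` TU)" if TU: "(TU, T\<phi>) \<in> tangent_atlas A" for TU T\<phi>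
  proof -
    obtain U \<phi> where U: "atlas_chart A U \<phi>" and TU': "TU = atlas_chart.tangent_domain A U"
      "T\<phi> = atlas_chart.tangent_chart \<phi>" using charts[OF TU] by blast
    interpret U: atlas_chart A U \<phi> by fact
    show ?thesis using U.tangent_chart_inv U.open_image by (simp add: TU' open_Times)
  qed
  then show ?thesis using trans unfolding smooth_atlas_def by blast
qed

context atlas_chart
begin

lemma atlas_chart_tangent: "atlas_chart (tangent_atlas A) tangent_domain tangent_chart"
  by unfold_locales (use smooth_atlas_tangent[OF atlas] tangent_chart_in_atlas in auto)

abbreviation "tvec \<equiv> chart_vector (tangent_atlas A) (tangent_domain, tangent_chart)"

lemma tangent_smooth_nearI:
  assumes "q \<in> U" "v \<in> tangent_space A q" "open W" "(\<phi> q, coord v) \<in> W" "smooth_on W F"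
    and "\<And>y \<xi>. (y, \<xi>) \<in> W \<Longrightarrow> y \<in> \<phi> ` U \<Longrightarrow> f (\<phi>' y, cvec (\<phi>' y) \<xi>) = F (y, \<xi>)"
  shows "smooth_near (tangent_atlas A) (q, v) f"
    "tvec (q, v) h f = \<D> F (\<phi> q, coord v) h"
proof -
  interpret T: atlas_chart "tangent_atlas A" tangent_domain tangent_chart by (rule atlas_chart_tangent)
  have *: "(q, v) \<in> tangent_domain" "tangent_chart (q, v) = (\<phi> q, coord v)"
    using assms(1,2) by (auto simp: tangent_domain_def tangent_chart_def)
  have "f (inv_into tangent_domain tangent_chart p) = F p"
    if "p \<in> W" "p \<in> tangent_chart ` tangent_domain" for p
    using that assms(6)[of "fst p" "snd p"] tangent_chart_inv(3)[of "fst p" "snd p"]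
    by (auto simp: tangent_chart_inv(2))
  note T.smooth_near_chartI[OF *(1) assms(3) _ assms(5) this]
  then show "smooth_near (tangent_atlas A) (q, v) f"
    "tvec (q, v) h f = \<D> F (\<phi> q, coord v) h"
    using *(2) assms(4) by auto
qed

lemma smooth_near_base_function:
  assumes f: "smooth_near A q f" and q: "q \<in> U" "v \<in> tangent_space A q"
  shows "smooth_near (tangent_atlas A) (q, v) (\<lambda>p. f (fst p))"
    "tvec (q, v) (h, k) (\<lambda>p. f (fst p)) = cvec q h f"
proof -
  obtain N where N: "q \<in> N" "open (\<phi> ` N)" "smooth_on (\<phi> ` N) (\<lambda>y. f (\<phi>' y))"
    using smooth_near_chartE[OF f q(1)] by metis
  have op: "open (\<phi> ` N \<times> (UNIV :: 'e set))" using N(2) by (simp add: open_Times)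
  have sm: "smooth_on (\<phi> ` N \<times> (UNIV :: 'e set)) (\<lambda>p. f (\<phi>' (fst p)))"
    by (rule smooth_on_compose[OF op N(2,3) smooth_on_fst[OF op smooth_on_ident[OF op]]]) auto
  have mem: "(\<phi> q, coord v) \<in> \<phi> ` N \<times> UNIV" using N(1) by auto
  note * = tangent_smooth_nearI[OF q op mem sm, where f = "\<lambda>p. f (fst p)"]
  show "smooth_near (tangent_atlas A) (q, v) (\<lambda>p. f (fst p))" by (rule *(1)) simp
  have "((\<lambda>p. f (\<phi>' (fst p))) has_derivative (\<lambda>h. cvec q (fst h) f)) (at (\<phi> q, coord v))"
    using has_derivative_compose[OF has_derivative_fst[OF has_derivative_ident], of "\<lambda>y. f (\<phi>' y)" _ "(\<phi> q, coord v)" UNIV]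
      smooth_near_has_derivative[OF f q(1)] by fastforce
  from fun_cong[OF frechet_derivative_at[OF this], of "(h, k)"]
  show "tvec (q, v) (h, k) (\<lambda>p. f (fst p)) = cvec q h f"
    by (subst *(2)) auto
qed

lemma smooth_near_fibre_function:
  assumes f: "smooth_near A q f" and q: "q \<in> U" "v \<in> tangent_space A q"
  defines "Df \<equiv> \<lambda>y. \<D> (\<lambda>y. f (\<phi>' y)) y"
  shows "smooth_near (tangent_atlas A) (q, v) (\<lambda>p. snd p f)"
    "tvec (q, v) (h, k) (\<lambda>p. snd p f) =
      \<D> (\<lambda>y. Df y (coord v)) (\<phi> q) h + Df (\<phi> q) k"
proof -
  obtain N where N: "q \<in> N" "N \<subseteq> U" "open (\<phi> ` N)" "smooth_on (\<phi> ` N) (\<lambda>y. f (\<phi>' y))"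
    "\<And>x. x \<in> N \<Longrightarrow> smooth_near A x f"
    using smooth_near_chartE[OF f q(1)] by metis
  have op: "open (\<phi> ` N \<times> (UNIV :: 'e set))" using N(3) by (simp add: open_Times)
  have sm: "smooth_on (\<phi> ` N \<times> (UNIV :: 'e set)) (\<lambda>p. Df (fst p) (snd p))"
    unfolding Df_def by (rule smooth_on_derivative_along[OF op N(3,4) smooth_on_fst[OF op smooth_on_ident[OF op]] _
      smooth_on_snd[OF op smooth_on_ident[OF op]]]) auto
  have mem: "(\<phi> q, coord v) \<in> \<phi> ` N \<times> UNIV" using N(1) by auto
  have eq: "snd (\<phi>' y, cvec (\<phi>' y) \<xi>) f = (\<lambda>p. Df (fst p) (snd p)) (y, \<xi>)"
    if "(y, \<xi>) \<in> \<phi> ` N \<times> UNIV" for y \<xi>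
  proof -
    obtain x where x: "x \<in> N" "y = \<phi> x" using \<open>(y, \<xi>) \<in> _\<close> by auto
    then have "\<phi>' y = x" using N(2) chart_inv by blast
    then show ?thesis using x N(5)[OF x(1)] by (simp add: chart_vector_def comp_def Df_def)
  qed
  note * = tangent_smooth_nearI[OF q op mem sm, where f = "\<lambda>p. snd p f"]
  show "smooth_near (tangent_atlas A) (q, v) (\<lambda>p. snd p f)" by (rule *(1)) (rule eq)
  have "((\<lambda>p. Df (fst p) (snd p)) has_derivative
      (\<lambda>h. \<D> (\<lambda>y. Df y (coord v)) (\<phi> q) (fst h) + Df (\<phi> q) (snd h))) (at (\<phi> q, coord v))"
    unfolding Df_def
    using derivative_has_derivative[OF N(3,4) has_derivative_fst[OF has_derivative_ident]
      has_derivative_snd[OF has_derivative_ident], of "(\<phi> q, coord v)" UNIV] N(1) by simp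
  from fun_cong[OF frechet_derivative_at[OF this], of "(h, k)"]
  have "\<D> (\<lambda>p. Df (fst p) (snd p)) (\<phi> q, coord v) (h, k) =
      \<D> (\<lambda>y. Df y (coord v)) (\<phi> q) h + Df (\<phi> q) k"
    by simp
  moreover have "tvec (q, v) (h, k) (\<lambda>p. snd p f) =
      \<D> (\<lambda>p. Df (fst p) (snd p)) (\<phi> q, coord v) (h, k)"
    by (rule *(2)) (rule eq)
  ultimately show "tvec (q, v) (h, k) (\<lambda>p. snd p f) =
      \<D> (\<lambda>y. Df y (coord v)) (\<phi> q) h + Df (\<phi> q) k"
    by simp
qed

lemma tvec_coordinates:
  assumes "q \<in> U" "v \<in> tangent_space A q" "b \<in> Basis"
  shows "tvec (q, v) (h, k) (\<lambda>p. \<phi> (fst p) \<bullet> b) = h \<bullet> b"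
    "tvec (q, v) (h, k) (\<lambda>p. snd p (\<lambda>x. \<phi> x \<bullet> b)) = k \<bullet> b"
proof -
  interpret T: atlas_chart "tangent_atlas A" tangent_domain tangent_chart by (rule atlas_chart_tangent)
  have p: "(q, v) \<in> tangent_domain" using assms by (simp add: tangent_domain_def)
  have "(\<lambda>p. \<phi> (fst p) \<bullet> b) = (\<lambda>p. tangent_chart p \<bullet> (b, 0))"
    "(\<lambda>p. snd p (\<lambda>x. \<phi> x \<bullet> b)) = (\<lambda>p. tangent_chart p \<bullet> (0, b))"
    by (auto simp: tangent_chart_def fun_eq_iff coordinate_vector_inner[OF assms(3)])
  then show "tvec (q, v) (h, k) (\<lambda>p. \<phi> (fst p) \<bullet> b) = h \<bullet> b"
    "tvec (q, v) (h, k) (\<lambda>p. snd p (\<lambda>x. \<phi> x \<bullet> b)) = k \<bullet> b"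
    using T.cvec_coordinate[OF p] by auto
qed

text \<open>The lift is the velocity of a line in a fibre, which is also a line in the chart.\<close>

lemma vertical_lift_chart:
  assumes "q \<in> U" "v \<in> tangent_space A q" "X q \<in> tangent_space A q"
  shows "vertical_lift A X (q, v) = tvec (q, v) (0, coord (X q))"
proof -
  interpret T: atlas_chart "tangent_atlas A" tangent_domain tangent_chart by (rule atlas_chart_tangent)
  have "((\<lambda>s. tangent_chart (q, add_scaled v s (X q))) has_vector_derivative (0, coord (X q))) (at 0)"
    by (auto simp: tangent_chart_def coordinate_vector_add_scaled intro!: derivative_eq_intros
        has_vector_derivative_Pair)
  moreover have "\<forall>\<^sub>F s in nhds 0. (q, add_scaled v s (X q)) \<in> tangent_domain"
    using assms by (simp add: tangent_domain_def tangent_space_add_scaled)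
  ultimately show ?thesis
    using T.velocity_chart by (auto simp: vertical_lift_def add_scaled_def)
qed

definition chart_field :: "('q \<Rightarrow> 'q tangent) \<Rightarrow> 'e \<Rightarrow> 'e" where
  "chart_field X y = coord (X (\<phi>' y))"

lemma chart_field_smooth:
  "vector_field A (carrier A) X \<Longrightarrow> smooth_on (\<phi> ` U) (chart_field X)"
  unfolding chart_field_def using vector_field_coord_smooth in_carrier by blast

text \<open>The complete lift of \<open>X\<close> has components \<open>(X, DX \<xi>)\<close>: on a fibre function \<open>v \<mapsto> v f\<close> these
  give \<open>D\<^sup>2f(X, \<xi>) + Df(DX \<xi>)\<close>, which is the derivative of \<open>X f\<close> along \<open>\<xi>\<close> since second
  derivatives are symmetric. Coordinate functions detect the components, so no other tangent
  vector has the two defining properties.\<close>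

lemma complete_lift_chart:
  assumes X: "vector_field A (carrier A) X" and q: "q \<in> U" "v \<in> tangent_space A q"
  shows "complete_lift A X (q, v) =
    tvec (q, v) (chart_field X (\<phi> q), \<D> (chart_field X) (\<phi> q) (coord v))"
proof -
  interpret T: atlas_chart "tangent_atlas A" tangent_domain tangent_chart by (rule atlas_chart_tangent)
  have p: "(q, v) \<in> tangent_domain" using q by (simp add: tangent_domain_def)
  let ?X = "chart_field X" and ?y = "\<phi> q" and ?\<xi> = "coord v"
  let ?h = "?X ?y" and ?k = "\<D> ?X ?y ?\<xi>"
  have XT: "X x \<in> tangent_space A x" if "x \<in> U" for x
    using X in_carrier[OF that] unfolding vector_field_def by blast
  have dX: "(?X has_derivative \<D> ?X ?y) (at ?y)"
    using smooth_on_has_derivative[OF chart_field_smooth[OF X]] q(1) by blast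
  have along: "smooth_near A q (\<lambda>x. X x f) \<and>
      v (\<lambda>x. X x f) = \<D> (\<lambda>y. \<D> (\<lambda>y. f (\<phi>' y)) y ?h) ?y ?\<xi> +
        \<D> (\<lambda>y. f (\<phi>' y)) ?y ?k"
    and sym: "\<D> (\<lambda>y. \<D> (\<lambda>y. f (\<phi>' y)) y ?h) ?y ?\<xi> =
      \<D> (\<lambda>y. \<D> (\<lambda>y. f (\<phi>' y)) y ?\<xi>) ?y ?h"
    if f: "smooth_near A q f" for f
  proof -
    let ?D = "\<lambda>y. \<D> (\<lambda>y. f (\<phi>' y)) y"
    obtain N where N: "q \<in> N" "N \<subseteq> U" "open (\<phi> ` N)" "smooth_on (\<phi> ` N) (\<lambda>y. f (\<phi>' y))"
        "\<And>x. x \<in> N \<Longrightarrow> smooth_near A x f"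
      using smooth_near_chartE[OF f q(1)] by metis
    show "\<D> (\<lambda>y. ?D y ?h) ?y ?\<xi> = \<D> (\<lambda>y. ?D y ?\<xi>) ?y ?h"
      using symmetric_second_derivative[OF N(3,4)] N(1) by blast
    have sm: "smooth_on (\<phi> ` N) (\<lambda>y. ?D y (?X y))"
      by (rule smooth_on_derivative_along[OF N(3,3,4) smooth_on_ident[OF N(3)] _
            smooth_on_subset[OF chart_field_smooth[OF X]]]) (use N(2) in auto)
    have eq: "X (\<phi>' y) f = ?D y (?X y)" if "y \<in> \<phi> ` N" for y
    proof -
      obtain x where x: "x \<in> N" "y = \<phi> x" using \<open>y \<in> \<phi> ` N\<close> by blast
      then have "\<phi>' y = x" using N(2) chart_inv by blast
      then show ?thesis
        using tangent_vector_apply[OF _ XT N(5)] x N(2) by (auto simp: chart_field_def)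
    qed
    note * = smooth_near_chartI[OF q(1) N(3) _ sm, where f = "\<lambda>x. X x f"]
    have "v (\<lambda>x. X x f) = cvec q ?\<xi> (\<lambda>x. X x f)" using cvec_coord[OF q] by simp
    also have "\<dots> = \<D> (\<lambda>y. ?D y (?X y)) ?y ?\<xi>"
      using N(1) eq by (intro *(2)) auto
    also have "\<dots> = \<D> (\<lambda>y. ?D y ?h) ?y ?\<xi> + ?D ?y ?k"
      using fun_cong[OF frechet_derivative_at[OF derivative_has_derivative[OF N(3,4) has_derivative_ident dX]], of ?\<xi>]
        N(1) by simp
    finally show "smooth_near A q (\<lambda>x. X x f) \<and>
      v (\<lambda>x. X x f) = \<D> (\<lambda>y. ?D y ?h) ?y ?\<xi> + ?D ?y ?k"
      using *(1) N(1) eq by auto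
  qed
  show ?thesis
    unfolding complete_lift_def prod.case
  proof (rule the_equality)
    show "tvec (q, v) (?h, ?k) \<in> tangent_space (tangent_atlas A) (q, v) \<and>
      (\<forall>f. smooth_near A q f \<longrightarrow> tvec (q, v) (?h, ?k) (\<lambda>p. f (fst p)) = X q f \<and>
        tvec (q, v) (?h, ?k) (\<lambda>p. snd p f) = v (\<lambda>x. X x f))"
    proof (intro conjI allI impI)
      show "tvec (q, v) (?h, ?k) \<in> tangent_space (tangent_atlas A) (q, v)"
        by (rule T.cvec_in_tangent_space[OF p])
      fix f assume f: "smooth_near A q f"
      show "tvec (q, v) (?h, ?k) (\<lambda>p. f (fst p)) = X q f"
        using smooth_near_base_function(2)[OF f q] cvec_coord[OF q(1) XT[OF q(1)]]
        by (simp add: chart_field_def chart_inv[OF q(1)])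
      show "tvec (q, v) (?h, ?k) (\<lambda>p. snd p f) = v (\<lambda>x. X x f)"
        using smooth_near_fibre_function(2)[OF f q] along[OF f] sym[OF f] by simp
    qed
  next
    fix z assume z: "z \<in> tangent_space (tangent_atlas A) (q, v) \<and>
      (\<forall>f. smooth_near A q f \<longrightarrow> z (\<lambda>p. f (fst p)) = X q f \<and> z (\<lambda>p. snd p f) = v (\<lambda>x. X x f))"
    then obtain h k where hk: "z = tvec (q, v) (h, k)"
      using T.tangent_space_chart[OF p] by auto
    have "h = ?h"
    proof (rule euclidean_eqI)
      fix b :: 'e assume b: "b \<in> Basis"
      show "h \<bullet> b = ?h \<bullet> b"
        using z[THEN conjunct2, rule_format, OF smooth_near_coordinate[OF q(1)], of b]
          tvec_coordinates(1)[OF q b, of h k] b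
        by (simp add: hk chart_field_def chart_inv[OF q(1)] coordinate_vector_inner)
    qed
    moreover have "k = ?k"
    proof (rule euclidean_eqI)
      fix b :: 'e assume b: "b \<in> Basis"
      note c = smooth_near_coordinate[OF q(1), of b]
      show "k \<bullet> b = ?k \<bullet> b"
        using z[THEN conjunct2, rule_format, OF c] tvec_coordinates(2)[OF q b, of h k] tvec_coordinates(2)[OF q b, of ?h ?k]
          smooth_near_fibre_function(2)[OF c q, of ?h ?k] along[OF c] sym[OF c]
        by (simp add: hk)
    qed
    ultimately show "z = tvec (q, v) (?h, ?k)" using hk by simp
  qed
qed

end

section \<open>Second-order equations constrained to a distribution\<close>

context
  fixes S :: "'a::euclidean_space set" and b :: "'a \<Rightarrow> 'a \<Rightarrow> 'a \<Rightarrow> real"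
  assumes b: "smooth_form S b"
    and commute: "\<And>y u w. y \<in> S \<Longrightarrow> b y u w = b y w u"
    and pos: "\<And>y u. y \<in> S \<Longrightarrow> u \<noteq> 0 \<Longrightarrow> 0 < b y u u"
begin

text \<open>Gram-Schmidt orthogonalization. Without scaling to unit length it only divides by the positive
  functions \<open>b(Y, Y)\<close>, so the new fields are smooth.\<close>

lemma smooth_orthogonal_frame:
  assumes "\<And>a. a < k \<Longrightarrow> smooth_on S (E a)"
    and "\<And>y a. y \<in> S \<Longrightarrow> a < k \<Longrightarrow> E a y \<notin> span ((\<lambda>i. E i y) ` {..<a})"
  shows "\<exists>Y :: nat \<Rightarrow> 'a \<Rightarrow> 'a. (\<forall>a<k. smooth_on S (Y a)) \<and> (\<forall>y\<in>S. (\<forall>a<k. Y a y \<noteq> 0) \<and>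
    (\<forall>a<k. \<forall>c<k. a \<noteq> c \<longrightarrow> b y (Y a y) (Y c y) = 0) \<and>
    span ((\<lambda>a. Y a y) ` {..<k}) = span ((\<lambda>a. E a y) ` {..<k}))"
  using assms
proof (induction k)
  case (Suc k)
  have "\<exists>Y :: nat \<Rightarrow> 'a \<Rightarrow> 'a. (\<forall>a<k. smooth_on S (Y a)) \<and> (\<forall>y\<in>S. (\<forall>a<k. Y a y \<noteq> 0) \<and>
    (\<forall>a<k. \<forall>c<k. a \<noteq> c \<longrightarrow> b y (Y a y) (Y c y) = 0) \<and>
    span ((\<lambda>a. Y a y) ` {..<k}) = span ((\<lambda>a. E a y) ` {..<k}))"
    by (rule Suc.IH) (use Suc.prems in auto)
  then obtain Y :: "nat \<Rightarrow> 'a \<Rightarrow> 'a" where Y: "\<And>a. a < k \<Longrightarrow> smooth_on S (Y a)"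
    "\<And>y a. y \<in> S \<Longrightarrow> a < k \<Longrightarrow> Y a y \<noteq> 0"
    "\<And>y a c. y \<in> S \<Longrightarrow> a < k \<Longrightarrow> c < k \<Longrightarrow> a \<noteq> c \<Longrightarrow> b y (Y a y) (Y c y) = 0"
    "\<And>y. y \<in> S \<Longrightarrow> span ((\<lambda>a. Y a y) ` {..<k}) = span ((\<lambda>a. E a y) ` {..<k})" by metis
  define w where "w y = (\<Sum>c<k. (b y (E k y) (Y c y) / b y (Y c y) (Y c y)) *\<^sub>R Y c y)" for y
  define Z where "Z = Y(k := \<lambda>y. E k y - w y)"
  note S = smooth_form_open[OF b]
  have nz: "b y (Y c y) (Y c y) \<noteq> 0" if "y \<in> S" "c < k" for y c
    using pos[OF that(1) Y(2)[OF that]] by simp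
  have sm: "smooth_on S (\<lambda>y. E k y - w y)"
    unfolding w_def
  proof (intro smooth_on_minus[OF S] smooth_on_sum[OF S] smooth_on_scaleR[OF S] smooth_on_divide[OF S])
    show "smooth_on S (E k)" using Suc.prems(1) by simp
    fix c assume "c \<in> {..<k}"
    then have c: "c < k" by simp
    show "smooth_on S (Y c)" by (rule Y(1)[OF c])
    show "smooth_on S (\<lambda>y. b y (E k y) (Y c y))" "smooth_on S (\<lambda>y. b y (Y c y) (Y c y))"
      using Suc.prems(1) Y(1)[OF c] by (auto intro!: smooth_on_form[OF b S smooth_on_ident[OF S]])
    show "b y (Y c y) (Y c y) \<noteq> 0" if "y \<in> S" for y by (rule nz[OF that c])
  qed
  have pt: "E k y - w y \<noteq> 0 \<and> (\<forall>c<k. b y (E k y - w y) (Y c y) = 0) \<and>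
    span (insert (E k y - w y) ((\<lambda>a. Y a y) ` {..<k})) = span (insert (E k y) ((\<lambda>a. E a y) ` {..<k}))"
    if y: "y \<in> S" for y
  proof (intro conjI allI impI)
    have wY: "w y \<in> span ((\<lambda>a. Y a y) ` {..<k})"
      unfolding w_def by (intro span_sum span_scale span_base) auto
    then show "E k y - w y \<noteq> 0" using Suc.prems(2)[OF y, of k] Y(4)[OF y] by auto
    note bl = smooth_form_bilinear[OF b y]
    fix c assume c: "c < k"
    have "b y (w y) (Y c y) = (\<Sum>d<k. b y ((b y (E k y) (Y d y) / b y (Y d y) (Y d y)) *\<^sub>R Y d y) (Y c y))"
      using linear_sum[of "\<lambda>u. b y u (Y c y)"] bl unfolding w_def bilinear_def by simp
    also have "\<dots> = (\<Sum>d<k. if d = c then b y (E k y) (Y c y) else 0)"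
      by (rule sum.cong) (use nz[OF y] Y(3)[OF y] c in \<open>auto simp: bilinear_lmul[OF bl]\<close>)
    finally show "b y (E k y - w y) (Y c y) = 0"
      using c by (simp add: bilinear_lsub[OF bl])
  next
    have wY: "w y \<in> span ((\<lambda>a. Y a y) ` {..<k})"
      unfolding w_def by (intro span_sum span_scale span_base) auto
    have "span (insert (E k y - w y) ((\<lambda>a. Y a y) ` {..<k})) = span (insert (E k y) ((\<lambda>a. Y a y) ` {..<k}))"
      using eq_span_insert_eq[of "E k y - w y" "E k y"] wY by (simp add: span_neg)
    also have "\<dots> = span (insert (E k y) ((\<lambda>a. E a y) ` {..<k}))"
      using Y(4)[OF y] by (simp add: span_insert)
    finally show "span (insert (E k y - w y) ((\<lambda>a. Y a y) ` {..<k})) = span (insert (E k y) ((\<lambda>a. E a y) ` {..<k}))" .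
  qed
  show ?case
  proof (intro exI[of _ Z] conjI ballI allI impI)
    show "smooth_on S (Z a)" if "a < Suc k" for a using that sm Y(1) by (auto simp: Z_def less_Suc_eq)
    fix y assume y: "y \<in> S"
    show "Z a y \<noteq> 0" if "a < Suc k" for a using that pt[OF y] Y(2)[OF y] by (auto simp: Z_def less_Suc_eq)
    show "b y (Z a y) (Z c y) = 0" if "a < Suc k" "c < Suc k" "a \<noteq> c" for a c
      using that pt[OF y] Y(3)[OF y] commute[OF y] by (auto simp: Z_def less_Suc_eq)
    have "(\<lambda>a. Z a y) ` {..<Suc k} = insert (E k y - w y) ((\<lambda>a. Y a y) ` {..<k})"
      by (auto simp: lessThan_Suc Z_def)
    then show "span ((\<lambda>a. Z a y) ` {..<Suc k}) = span ((\<lambda>a. E a y) ` {..<Suc k})"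
      using pt[OF y] by (simp add: lessThan_Suc)
  qed
qed simp

text \<open>Let \<open>P\<close> be the orthogonal projection onto the distribution. Along a curve in the
  distribution \<open>P \<xi> = \<xi>\<close>, hence \<open>\<xi>' = (DP \<cdot> x') \<xi> + P \<xi>'\<close>. The first term is a quadratic
  function of \<open>\<xi> = x'\<close>, and the second is determined by the products of \<open>\<xi>'\<close> with elements of the
  distribution, which is what Lagrange's equations prescribe. This puts the constrained
  motions among the solutions of an unconstrained smooth equation, without solving for
  multipliers.\<close>

lemma constrained_spray:
  fixes E :: "nat \<Rightarrow> 'a \<Rightarrow> 'a"
  assumes E: "\<And>a. a < k \<Longrightarrow> smooth_on S (E a)"
    "\<And>y a. y \<in> S \<Longrightarrow> a < k \<Longrightarrow> E a y \<notin> span ((\<lambda>i. E i y) ` {..<a})"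
  obtains F :: "'a \<Rightarrow> 'a \<Rightarrow> 'a" where "smooth_on (S \<times> UNIV) (\<lambda>p. F (fst p) (snd p))"
    "\<And>y \<xi> r. y \<in> S \<Longrightarrow> F y (r *\<^sub>R \<xi>) = r\<^sup>2 *\<^sub>R F y \<xi>"
    "\<And>x \<xi> \<xi>' t. (x has_vector_derivative \<xi> t) (at t) \<Longrightarrow> (\<xi> has_vector_derivative \<xi>') (at t) \<Longrightarrow> x t \<in> S \<Longrightarrow>
      \<forall>\<^sub>F s in nhds t. \<xi> s \<in> span ((\<lambda>a. E a (x s)) ` {..<k}) \<Longrightarrow>
      (\<And>a. a < k \<Longrightarrow> b (x t) \<xi>' (E a (x t)) =
        1/2 * form_derivative b (x t) (E a (x t)) (\<xi> t) (\<xi> t) - form_derivative b (x t) (\<xi> t) (\<xi> t) (E a (x t))) \<Longrightarrow>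
      \<xi>' = F (x t) (\<xi> t)"
proof -
  obtain Y :: "nat \<Rightarrow> 'a \<Rightarrow> 'a" where Y0: "\<forall>a<k. smooth_on S (Y a)"
    "\<forall>y\<in>S. (\<forall>a<k. Y a y \<noteq> 0) \<and> (\<forall>a<k. \<forall>c<k. a \<noteq> c \<longrightarrow> b y (Y a y) (Y c y) = 0) \<and>
      span ((\<lambda>a. Y a y) ` {..<k}) = span ((\<lambda>a. E a y) ` {..<k})"
  proof -
    assume *: thesis if "\<forall>a<k. smooth_on S (Y a)"
    "\<forall>y\<in>S. (\<forall>a<k. Y a y \<noteq> 0) \<and> (\<forall>a<k. \<forall>c<k. a \<noteq> c \<longrightarrow> b y (Y a y) (Y c y) = 0) \<and>
      span ((\<lambda>a. Y a y) ` {..<k}) = span ((\<lambda>a. E a y) ` {..<k})" for Y :: "nat \<Rightarrow> 'a \<Rightarrow> 'a"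
    show thesis
      by (rule exE[OF smooth_orthogonal_frame[OF E]], assumption+, elim conjE, rule *)
  qed
  have Y: "\<And>a. a < k \<Longrightarrow> smooth_on S (Y a)"
    "\<And>y a. y \<in> S \<Longrightarrow> a < k \<Longrightarrow> Y a y \<noteq> 0"
    "\<And>y a c. y \<in> S \<Longrightarrow> a < k \<Longrightarrow> c < k \<Longrightarrow> a \<noteq> c \<Longrightarrow> b y (Y a y) (Y c y) = 0"
    "\<And>y. y \<in> S \<Longrightarrow> span ((\<lambda>a. Y a y) ` {..<k}) = span ((\<lambda>a. E a y) ` {..<k})"
    using Y0 by blast+
  note S = smooth_form_open[OF b]
  define P where "P y w = (\<Sum>a<k. (b y w (Y a y) / b y (Y a y) (Y a y)) *\<^sub>R Y a y)" for y w
  define Q where "Q p = P (fst p) (snd p)" for p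
  define N where "N y \<xi> = (\<Sum>a<k. ((1/2 * form_derivative b y (Y a y) \<xi> \<xi> - form_derivative b y \<xi> \<xi> (Y a y)) /
    b y (Y a y) (Y a y)) *\<^sub>R Y a y)" for y \<xi>
  define F where "F y \<xi> = \<D> Q (y, \<xi>) (\<xi>, 0) + N y \<xi>" for y \<xi>
  have op: "open (S \<times> (UNIV :: 'a set))" using S by (simp add: open_Times)
  note fst = smooth_on_fst[OF op smooth_on_ident[OF op]] and snd = smooth_on_snd[OF op smooth_on_ident[OF op]]
  have nz: "b y (Y c y) (Y c y) \<noteq> 0" if "y \<in> S" "c < k" for y c
    using pos[OF that(1) Y(2)[OF that]] by simp
  have Yf: "smooth_on (S \<times> (UNIV :: 'a set)) (\<lambda>p. Y a (fst p))" if "a < k" for a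
    by (rule smooth_on_compose[OF op S Y(1)[OF that] fst]) auto
  have fstS: "fst ` (S \<times> (UNIV :: 'a set)) \<subseteq> S" by auto
  have Q: "smooth_on (S \<times> UNIV) Q"
    unfolding Q_def P_def
    by (intro smooth_on_sum[OF op] smooth_on_scaleR[OF op] smooth_on_divide[OF op]
      smooth_on_form[OF b op fst _ _ fstS] snd Yf) (auto simp: nz)
  have Nsm: "smooth_on (S \<times> UNIV) (\<lambda>p. N (fst p) (snd p))"
    unfolding N_def
    by (intro smooth_on_sum[OF op] smooth_on_scaleR[OF op] smooth_on_divide[OF op] smooth_on_minus[OF op]
      smooth_on_mult[OF op] smooth_on_const[OF op]
      smooth_on_form[OF b op fst _ _ fstS] smooth_on_form_derivative[OF b op fst _ _ _ fstS] snd Yf) (auto simp: nz)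
  have linP: "linear (P y)" if "y \<in> S" for y
    using smooth_form_bilinear[OF b that]
    by (intro linearI) (simp_all add: P_def bilinear_ladd bilinear_lmul add_divide_distrib scaleR_add_left
      sum.distrib scaleR_sum_right)
  have dQ: "(Q has_derivative \<D> Q (y, \<xi>)) (at (y, \<xi>))" if "y \<in> S" for y \<xi>
    using smooth_on_has_derivative[OF Q] that by auto
  \<comment> \<open>\<open>Q\<close> is linear in its second argument, hence equal to its derivative there.\<close>
  have dQ2: "\<D> Q (y, \<xi>) (0, h) = P y h" if y: "y \<in> S" for y \<xi> h
  proof -
    have "((\<lambda>w. (y, w)) has_derivative (\<lambda>h. (0, h))) (at \<xi>)"
      by (auto intro!: derivative_eq_intros)
    from has_derivative_compose[OF this dQ[OF y]]
    have "(P y has_derivative (\<lambda>h. \<D> Q (y, \<xi>) (0, h))) (at \<xi>)"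
      by (simp add: Q_def)
    moreover have "(P y has_derivative P y) (at \<xi>)"
      using linP[OF y] by (intro bounded_linear_imp_has_derivative) (simp add: linear_conv_bounded_linear)
    ultimately show ?thesis using has_derivative_unique by metis
  qed
  have dQ1: "((\<lambda>z. P z \<xi>) has_derivative (\<lambda>h. \<D> Q (y, \<xi>) (h, 0))) (at y)"
    if y: "y \<in> S" for y \<xi>
  proof -
    have "((\<lambda>z. (z, \<xi>)) has_derivative (\<lambda>h. (h, 0))) (at y)"
      by (auto intro!: derivative_eq_intros)
    from has_derivative_compose[OF this dQ[OF y]] show ?thesis by (simp add: Q_def)
  qed
  have "smooth_on (S \<times> UNIV) (\<lambda>p. \<D> Q p (snd p, 0))"
    by (intro smooth_on_derivative_along[OF op op Q smooth_on_ident[OF op]] smooth_on_Pair[OF op] snd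
      smooth_on_const[OF op]) auto
  then have Fsm: "smooth_on (S \<times> UNIV) (\<lambda>p. F (fst p) (snd p))"
    unfolding F_def using Nsm by (simp add: smooth_on_add[OF op])
  have hom: "F y (r *\<^sub>R \<xi>) = r\<^sup>2 *\<^sub>R F y \<xi>" if y: "y \<in> S" for y \<xi> r
  proof -
    note fl = form_derivative_linear[OF b y, THEN linear_cmul]
    have "((\<lambda>z. r *\<^sub>R P z \<xi>) has_derivative (\<lambda>h. r *\<^sub>R \<D> Q (y, \<xi>) (h, 0))) (at y)"
      by (intro has_derivative_scaleR_right dQ1 y)
    then have "((\<lambda>z. P z (r *\<^sub>R \<xi>)) has_derivative (\<lambda>h. r *\<^sub>R \<D> Q (y, \<xi>) (h, 0))) (at y)"
      by (rule has_derivative_transform_within_open[OF _ S y]) (simp add: linear_cmul[OF linP])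
    from fun_cong[OF has_derivative_unique[OF dQ1[OF y] this], of "r *\<^sub>R \<xi>"]
    have "\<D> Q (y, r *\<^sub>R \<xi>) (r *\<^sub>R \<xi>, 0) = r *\<^sub>R \<D> Q (y, \<xi>) (r *\<^sub>R (\<xi>, 0))"
      by simp
    also have "\<dots> = r\<^sup>2 *\<^sub>R \<D> Q (y, \<xi>) (\<xi>, 0)"
      using linear_cmul[OF has_derivative_linear[OF dQ[OF y]]] by (simp add: power2_eq_square del: scaleR_Pair)
    finally have 1: "\<D> Q (y, r *\<^sub>R \<xi>) (r *\<^sub>R \<xi>, 0) = r\<^sup>2 *\<^sub>R \<D> Q (y, \<xi>) (\<xi>, 0)" .
    have "N y (r *\<^sub>R \<xi>) = r\<^sup>2 *\<^sub>R N y \<xi>"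
      unfolding N_def scaleR_sum_right
      by (rule sum.cong) (simp_all add: fl power2_eq_square field_simps)
    with 1 show ?thesis by (simp add: F_def scaleR_add_right)
  qed
  have eq: "\<xi>' = F (x t) (\<xi> t)"
    if x: "(x has_vector_derivative \<xi> t) (at t)" and \<xi>: "(\<xi> has_vector_derivative \<xi>') (at t)" and xt: "x t \<in> S"
      and ev: "\<forall>\<^sub>F s in nhds t. \<xi> s \<in> span ((\<lambda>a. E a (x s)) ` {..<k})"
      and L: "\<And>a. a < k \<Longrightarrow> b (x t) \<xi>' (E a (x t)) =
        1/2 * form_derivative b (x t) (E a (x t)) (\<xi> t) (\<xi> t) - form_derivative b (x t) (\<xi> t) (\<xi> t) (E a (x t))"
    for x \<xi> \<xi>' t
  proof -
    note bl = smooth_form_bilinear[OF b xt] and fl = form_derivative_linear[OF b xt]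
    have Pid: "P y u = u" if y: "y \<in> S" and u: "u \<in> span ((\<lambda>a. E a y) ` {..<k})" for y u
    proof -
      have "P y (Y c y) = Y c y" if c: "c < k" for c
      proof -
        have "P y (Y c y) = (\<Sum>a<k. if a = c then Y c y else 0)"
          unfolding P_def by (rule sum.cong) (use nz[OF y] Y(3)[OF y] c in auto)
        then show ?thesis using c by simp
      qed
      then have "P y u = id u" if "u \<in> span ((\<lambda>a. Y a y) ` {..<k})" for u
        by (intro linear_eq_on[OF linP[OF y] linear_id that]) auto
      then show ?thesis using Y(4)[OF y] u by simp
    qed
    have "isCont x t" using x by (rule has_vector_derivative_continuous)
    then have "\<forall>\<^sub>F s in nhds t. x s \<in> S"
      using S xt unfolding continuous_at_open eventually_nhds by metis
    then have evQ: "\<forall>\<^sub>F s in nhds t. Q (x s, \<xi> s) = \<xi> s"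
      using ev by eventually_elim (simp add: Q_def Pid)
    have "((\<lambda>s. Q (x s, \<xi> s)) has_derivative (\<lambda>h. \<D> Q (x t, \<xi> t) (h *\<^sub>R \<xi> t, h *\<^sub>R \<xi>'))) (at t)"
      using has_derivative_compose[OF has_derivative_Pair[OF x[unfolded has_vector_derivative_def]
          \<xi>[unfolded has_vector_derivative_def]] dQ[OF xt]] .
    then have "(\<xi> has_derivative (\<lambda>h. \<D> Q (x t, \<xi> t) (h *\<^sub>R \<xi> t, h *\<^sub>R \<xi>'))) (at t)"
      by (rule has_derivative_transform_eventually) (use evQ in \<open>auto simp: eventually_nhds_conv_at\<close>)
    from fun_cong[OF has_derivative_unique[OF this \<xi>[unfolded has_vector_derivative_def]], of 1]
    have "\<xi>' = \<D> Q (x t, \<xi> t) (\<xi> t, \<xi>')" by simp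
    also have "\<dots> = \<D> Q (x t, \<xi> t) (\<xi> t, 0) + \<D> Q (x t, \<xi> t) (0, \<xi>')"
      by (simp flip: linear_add[OF has_derivative_linear[OF dQ[OF xt]]])
    also have "\<D> Q (x t, \<xi> t) (0, \<xi>') = P (x t) \<xi>'" by (rule dQ2[OF xt])
    also have "P (x t) \<xi>' = N (x t) (\<xi> t)"
    proof -
      have "linear (b (x t) \<xi>')" using bl by (simp add: bilinear_def)
      moreover have "linear (\<lambda>u. 1/2 * form_derivative b (x t) u (\<xi> t) (\<xi> t) - form_derivative b (x t) (\<xi> t) (\<xi> t) u)"
        using linear_compose_sub[OF linear_compose_scale_right[OF fl(1), of "1/2"] fl(3)] by simp
      ultimately have "b (x t) \<xi>' u = 1/2 * form_derivative b (x t) u (\<xi> t) (\<xi> t) - form_derivative b (x t) (\<xi> t) (\<xi> t) u"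
        if "u \<in> span ((\<lambda>a. E a (x t)) ` {..<k})" for u
        by (rule linear_eq_on[OF _ _ that]) (use L in auto)
      moreover have "Y a (x t) \<in> span ((\<lambda>a. E a (x t)) ` {..<k})" if "a < k" for a
        unfolding Y(4)[OF xt, symmetric] using that by (auto intro: span_base)
      ultimately show ?thesis unfolding P_def N_def by (intro sum.cong) auto
    qed
    finally show ?thesis by (simp add: F_def)
  qed
  show ?thesis by (rule that[of F]) (fact Fsm hom eq)+
qed

end

section \<open>Nonholonomic motions in a chart\<close>

lemma span_image_lessThan:
  fixes f :: "nat \<Rightarrow> 'a::real_vector"
  shows "w \<in> span (f ` {..<k}) \<longleftrightarrow> (\<exists>x. w = (\<Sum>a<k. x a *\<^sub>R f a))"
proof (induction k arbitrary: w)
  case (Suc k)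
  have "w \<in> span (f ` {..<Suc k}) \<longleftrightarrow> (\<exists>c. w - c *\<^sub>R f k \<in> span (f ` {..<k}))"
    by (simp add: lessThan_Suc span_insert)
  also have "\<dots> \<longleftrightarrow> (\<exists>c x. w - c *\<^sub>R f k = (\<Sum>a<k. x a *\<^sub>R f a))" by (simp add: Suc.IH)
  also have "\<dots> \<longleftrightarrow> (\<exists>x. w = (\<Sum>a<Suc k. x a *\<^sub>R f a))"
  proof safe
    fix c x assume "w - c *\<^sub>R f k = (\<Sum>a<k. x a *\<^sub>R f a)"
    then have "w = (\<Sum>a<Suc k. (x(k := c)) a *\<^sub>R f a)" by (simp add: algebra_simps)
    then show "\<exists>x. w = (\<Sum>a<Suc k. x a *\<^sub>R f a)" by blast
  next
    fix x show "\<exists>c y. (\<Sum>a<Suc k. x a *\<^sub>R f a) - c *\<^sub>R f k = (\<Sum>a<k. y a *\<^sub>R f a)"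
      by (intro exI[of _ "x k"] exI[of _ x]) simp
  qed
  finally show ?case .
qed simp

locale nonholonomic_chart = atlas_chart A U \<phi>
  for A :: "('q, 'e::euclidean_space) atlas" and U \<phi> +
  fixes g m D X \<Gamma>
  assumes metric: "riemannian_metric A g" and frame: "adapted_frame A g m D X"
    and nonholonomic: "nonholonomic_vector_field A (kinetic_lagrangian g) m D X \<Gamma>"
begin

abbreviation "E a \<equiv> chart_field (X a)"
abbreviation "G \<equiv> chart_metric g"

definition chart_distribution :: "'e \<Rightarrow> 'e set" where
  "chart_distribution y = span ((\<lambda>a. E a y) ` {..<m})"

lemma m_le: "m \<le> DIM('e)" and frame_field: "a < DIM('e) \<Longrightarrow> vector_field A (carrier A) (X a)"
  using frame unfolding adapted_frame_def global_frame_def by auto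

lemma frame_tangent: "q \<in> U \<Longrightarrow> a < DIM('e) \<Longrightarrow> X a q \<in> tangent_space A q"
  using frame_field in_carrier unfolding vector_field_def by blast

lemma frame_smooth: "a < DIM('e) \<Longrightarrow> smooth_on (\<phi> ` U) (E a)"
  by (intro chart_field_smooth frame_field)

lemma coord_frame: "q \<in> U \<Longrightarrow> coord (X a q) = E a (\<phi> q)"
  by (simp add: chart_field_def chart_inv)

lemma distribution_eq: "q \<in> U \<Longrightarrow> D q = {lincomb {..<m} x X q | x. True}"
  using frame in_carrier unfolding adapted_frame_def by blast

lemma lincomb_eq: "q \<in> U \<Longrightarrow> S \<subseteq> {..<DIM('e)} \<Longrightarrow> lincomb S x X q = cvec q (\<Sum>a\<in>S. x a *\<^sub>R E a (\<phi> q))"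
  using lincomb_cvec[of q S X x] frame_tangent[of q] by (auto simp: coord_frame finite_subset)

lemma distribution_chart: "q \<in> U \<Longrightarrow> v \<in> D q \<longleftrightarrow> v \<in> tangent_space A q \<and> coord v \<in> chart_distribution (\<phi> q)"
proof -
  assume q: "q \<in> U"
  have l: "lincomb {..<m} x X q = cvec q (\<Sum>a<m. x a *\<^sub>R E a (\<phi> q))" for x
    using lincomb_eq[OF q] m_le by auto
  show ?thesis
    unfolding distribution_eq[OF q] chart_distribution_def span_image_lessThan l
    using cvec_coord[OF q] cvec_in_tangent_space[OF q] coord_cvec[OF q] by (auto, metis)
qed

lemma distribution_tangent: "q \<in> U \<Longrightarrow> v \<in> D q \<Longrightarrow> v \<in> tangent_space A q"
  by (simp add: distribution_chart)

lemma cvec_in_distribution: "q \<in> U \<Longrightarrow> w \<in> chart_distribution (\<phi> q) \<Longrightarrow> cvec q w \<in> D q"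
  by (simp add: distribution_chart cvec_in_tangent_space)

lemma frame_coefficients_unique:
  assumes q: "q \<in> U" and "(\<Sum>a<DIM('e). w a *\<^sub>R E a (\<phi> q)) = (\<Sum>a<DIM('e). w' a *\<^sub>R E a (\<phi> q))" "a < DIM('e)"
  shows "w a = w' a"
proof -
  let ?n = "DIM('e)"
  let ?v = "cvec q (\<Sum>a<?n. w a *\<^sub>R E a (\<phi> q))"
  have ex1: "\<exists>!w. (\<forall>\<alpha>\<ge>?n. w \<alpha> = 0) \<and> ?v = lincomb {..<?n} w X q"
    using frame in_carrier[OF q] cvec_in_tangent_space[OF q]
    unfolding adapted_frame_def global_frame_def by blast
  define r where "r w a = (if a < ?n then w a else 0)" for w :: "nat \<Rightarrow> real" and a
  \<comment> \<open>Coefficients are unique among those that vanish from the dimension on.\<close>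
  have "(\<forall>\<alpha>\<ge>?n. r w \<alpha> = 0) \<and> ?v = lincomb {..<?n} (r w) X q" "(\<forall>\<alpha>\<ge>?n. r w' \<alpha> = 0) \<and> ?v = lincomb {..<?n} (r w') X q"
    by (simp_all add: r_def lincomb_eq[OF q] assms(2))
  then have "r w a = r w' a" using ex1 by metis
  then show ?thesis using assms(3) by (simp add: r_def)
qed

lemma frame_independent:
  assumes y: "y \<in> \<phi> ` U" and a: "a < m"
  shows "E a y \<notin> span ((\<lambda>i. E i y) ` {..<a})"
proof
  let ?n = "DIM('e)"
  assume "E a y \<in> span ((\<lambda>i. E i y) ` {..<a})"
  then obtain x where x: "E a y = (\<Sum>i<a. x i *\<^sub>R E i y)" unfolding span_image_lessThan by blast
  have an: "a < ?n" using a m_le by simp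
  have "(\<Sum>i<?n. (if i < a then x i else 0) *\<^sub>R E i y) = (\<Sum>i<a. x i *\<^sub>R E i y)"
    by (rule sum.mono_neutral_cong_right) (use an in auto)
  also have "\<dots> = (\<Sum>i<?n. (if i = a then 1 else 0) *\<^sub>R E i y)"
    using an x by (simp add: if_distrib[of "\<lambda>c. c *\<^sub>R _"] cong: if_cong)
  finally have "(\<Sum>i<?n. (if i < a then x i else 0) *\<^sub>R E i y) = (\<Sum>i<?n. (if i = a then 1 else 0) *\<^sub>R E i y)" .
  then have "(\<Sum>i<?n. (if i < a then x i else 0) *\<^sub>R E i (\<phi> (\<phi>' y))) = (\<Sum>i<?n. (if i = a then 1 else 0) *\<^sub>R E i (\<phi> (\<phi>' y)))"
    by (simp only: inv_chart(1)[OF y])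
  from frame_coefficients_unique[OF inv_chart(2)[OF y] this an] show False by simp
qed

lemma quasi_velocity_distribution:
  assumes q: "q \<in> U" and v: "v \<in> D q"
  shows "coord v = (\<Sum>a<m. quasi_velocity DIM('e) X (q, v) a *\<^sub>R E a (\<phi> q))"
proof -
  let ?n = "DIM('e)"
  obtain x where x: "coord v = (\<Sum>a<m. x a *\<^sub>R E a (\<phi> q))"
    using v unfolding distribution_chart[OF q] chart_distribution_def span_image_lessThan by blast
  define w where "w a = (if a < m then x a else 0)" for a
  have s: "(\<Sum>a<?n. w a *\<^sub>R E a (\<phi> q)) = (\<Sum>a<m. x a *\<^sub>R E a (\<phi> q))"
    unfolding w_def by (rule sum.mono_neutral_cong_right) (use m_le in auto)
  have w: "(\<forall>\<alpha>\<ge>?n. w \<alpha> = 0) \<and> v = lincomb {..<?n} w X q"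
  proof
    show "\<forall>\<alpha>\<ge>?n. w \<alpha> = 0" using m_le by (simp add: w_def)
    show "v = lincomb {..<?n} w X q"
      using cvec_coord[OF q distribution_tangent[OF q v]] by (simp add: lincomb_eq[OF q] s x)
  qed
  have ex1: "\<exists>!w. (\<forall>\<alpha>\<ge>?n. w \<alpha> = 0) \<and> v = lincomb {..<?n} w X q"
    using frame in_carrier[OF q] distribution_tangent[OF q v]
    unfolding adapted_frame_def global_frame_def by blast
  have "quasi_velocity ?n X (q, v) = w"
    unfolding quasi_velocity_def prod.case by (rule the1_equality[where a = w]) (fact ex1 w)+
  then show ?thesis using x by (simp add: w_def)
qed

lemma kinetic_lagrangian_chart:
  assumes q: "q \<in> U" "v \<in> tangent_space A q"
  shows "smooth_near (tangent_atlas A) (q, v) (kinetic_lagrangian g)"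
    "tvec (q, v) (h, k) (kinetic_lagrangian g) =
      1/2 * form_derivative G (\<phi> q) h (coord v) (coord v) + G (\<phi> q) k (coord v)"
proof -
  let ?W = "\<phi> ` U \<times> (UNIV :: 'e set)"
  let ?F = "\<lambda>p. 1/2 * G (fst p) (snd p) (snd p)"
  note G = chart_metric_smooth_form[OF metric]
  have op: "open ?W" using open_image by (simp add: open_Times)
  have sm: "smooth_on ?W ?F"
    by (intro smooth_on_mult[OF op] smooth_on_const[OF op] smooth_on_form[OF G op]
      smooth_on_fst[OF op] smooth_on_snd[OF op] smooth_on_ident[OF op]) auto
  have mem: "(\<phi> q, coord v) \<in> ?W" using q by auto
  have eq: "kinetic_lagrangian g (\<phi>' y, cvec (\<phi>' y) \<xi>) = ?F (y, \<xi>)" for y \<xi>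
    by (simp add: kinetic_lagrangian_def chart_metric_def)
  note * = tangent_smooth_nearI[OF q op mem sm, where f = "kinetic_lagrangian g"]
  show "smooth_near (tangent_atlas A) (q, v) (kinetic_lagrangian g)" by (rule *(1)) (rule eq)
  have d: "(?F has_derivative (\<lambda>p. 1/2 * (form_derivative G (\<phi> q) (fst p) (coord v) (coord v) +
      G (\<phi> q) (snd p) (coord v) + G (\<phi> q) (coord v) (snd p)))) (at (\<phi> q, coord v))"
    using has_derivative_mult_right[OF form_has_derivative[OF G has_derivative_fst[OF has_derivative_ident]
      has_derivative_snd[OF has_derivative_ident] has_derivative_snd[OF has_derivative_ident],
      of "(\<phi> q, coord v)" UNIV], of "1/2"] q by simp
  have "tvec (q, v) (h, k) (kinetic_lagrangian g) = \<D> ?F (\<phi> q, coord v) (h, k)"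
    by (rule *(2)) (rule eq)
  also have "\<dots> = 1/2 * form_derivative G (\<phi> q) h (coord v) (coord v) + G (\<phi> q) k (coord v)"
    using fun_cong[OF frechet_derivative_at[OF d], of "(h, k)"] chart_metric_commute[OF metric, of "\<phi> q" "coord v" k] q
    by simp
  finally show "tvec (q, v) (h, k) (kinetic_lagrangian g) =
      1/2 * form_derivative G (\<phi> q) h (coord v) (coord v) + G (\<phi> q) k (coord v)" .
qed

text \<open>The vertical derivative of the kinetic energy along \<open>Y\<close> is the momentum \<open>g(v, Y)\<close>. It is needed as a
  smooth function on the tangent bundle, because the nonholonomic field differentiates it.\<close>

lemma vertical_lift_kinetic_lagrangian:
  assumes Y: "vector_field A (carrier A) Y" and q: "q \<in> U" "v \<in> tangent_space A q"
  shows "vertical_lift A Y (q, v) (kinetic_lagrangian g) = G (\<phi> q) (coord v) (chart_field Y (\<phi> q))"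
    "smooth_near (tangent_atlas A) (q, v) (\<lambda>p. vertical_lift A Y p (kinetic_lagrangian g))"
    "tvec (q, v) (h, k) (\<lambda>p. vertical_lift A Y p (kinetic_lagrangian g)) =
      form_derivative G (\<phi> q) h (coord v) (chart_field Y (\<phi> q)) + G (\<phi> q) k (chart_field Y (\<phi> q)) +
      G (\<phi> q) (coord v) (\<D> (chart_field Y) (\<phi> q) h)"
proof -
  let ?W = "\<phi> ` U \<times> (UNIV :: 'e set)"
  let ?Y = "chart_field Y"
  let ?F = "\<lambda>p. G (fst p) (snd p) (?Y (fst p))"
  note G = chart_metric_smooth_form[OF metric]
  have V: "vertical_lift A Y (q, v) (kinetic_lagrangian g) = G (\<phi> q) (coord v) (?Y (\<phi> q))"
    if q: "q \<in> U" "v \<in> tangent_space A q" for q v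
  proof -
    have YT: "Y q \<in> tangent_space A q" using Y in_carrier[OF q(1)] unfolding vector_field_def by blast
    have "coord (Y q) = ?Y (\<phi> q)" by (simp add: chart_field_def chart_inv[OF q(1)])
    then show ?thesis
      unfolding vertical_lift_chart[of q v Y, OF q YT] kinetic_lagrangian_chart(2)[OF q]
      using linear_0[OF form_derivative_linear(1)[OF G]] chart_metric_commute[OF metric] q by simp
  qed
  show "vertical_lift A Y (q, v) (kinetic_lagrangian g) = G (\<phi> q) (coord v) (?Y (\<phi> q))" by (rule V[OF q])
  have op: "open ?W" using open_image by (simp add: open_Times)
  note fst = smooth_on_fst[OF op smooth_on_ident[OF op]]
  have sm: "smooth_on ?W ?F"
    by (intro smooth_on_form[OF G op fst] smooth_on_snd[OF op] smooth_on_ident[OF op]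
      smooth_on_compose[OF op open_image chart_field_smooth[OF Y] fst]) auto
  have mem: "(\<phi> q, coord v) \<in> ?W" using q by auto
  have eq: "vertical_lift A Y (\<phi>' y, cvec (\<phi>' y) \<xi>) (kinetic_lagrangian g) = ?F (y, \<xi>)" if "y \<in> \<phi> ` U" for y \<xi>
    using V[OF inv_chart(2)[OF that] cvec_in_tangent_space[OF inv_chart(2)[OF that]], of \<xi>] inv_chart[OF that]
    by simp
  note * = tangent_smooth_nearI[OF q op mem sm, where f = "\<lambda>p. vertical_lift A Y p (kinetic_lagrangian g)"]
  show "smooth_near (tangent_atlas A) (q, v) (\<lambda>p. vertical_lift A Y p (kinetic_lagrangian g))"
    by (rule *(1)) (rule eq)
  have "((\<lambda>p. ?Y (fst p)) has_derivative (\<lambda>h. \<D> ?Y (\<phi> q) (fst h))) (at (\<phi> q, coord v))"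
    using has_derivative_compose[OF has_derivative_fst[OF has_derivative_ident], of ?Y _ "(\<phi> q, coord v)" UNIV]
      smooth_on_has_derivative[OF chart_field_smooth[OF Y]] q by fastforce
  from form_has_derivative[OF G has_derivative_fst[OF has_derivative_ident] has_derivative_snd[OF has_derivative_ident] this]
  have d: "(?F has_derivative (\<lambda>p. form_derivative G (\<phi> q) (fst p) (coord v) (?Y (\<phi> q)) +
      G (\<phi> q) (snd p) (?Y (\<phi> q)) + G (\<phi> q) (coord v) (\<D> ?Y (\<phi> q) (fst p)))) (at (\<phi> q, coord v))"
    using q by simp
  have "tvec (q, v) (h, k) (\<lambda>p. vertical_lift A Y p (kinetic_lagrangian g)) = \<D> ?F (\<phi> q, coord v) (h, k)"
    by (rule *(2)) (rule eq)
  also have "\<dots> = form_derivative G (\<phi> q) h (coord v) (?Y (\<phi> q)) + G (\<phi> q) k (?Y (\<phi> q)) +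
      G (\<phi> q) (coord v) (\<D> ?Y (\<phi> q) h)"
    using fun_cong[OF frechet_derivative_at[OF d], of "(h, k)"] by simp
  finally show "tvec (q, v) (h, k) (\<lambda>p. vertical_lift A Y p (kinetic_lagrangian g)) =
      form_derivative G (\<phi> q) h (coord v) (?Y (\<phi> q)) + G (\<phi> q) k (?Y (\<phi> q)) +
      G (\<phi> q) (coord v) (\<D> ?Y (\<phi> q) h)" .
qed

text \<open>The accelerations at \<open>x\<close> that nonholonomic motions with velocity \<open>\<xi>\<close> can have: they differ from
  the derivative along \<open>\<xi>\<close> of the field with constant coefficients extending \<open>\<xi>\<close> by an element
  of the distribution, and they satisfy Lagrange's equations on the distribution.\<close>

definition nonholonomic_acceleration :: "'e \<Rightarrow> 'e \<Rightarrow> 'e \<Rightarrow> bool" where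
  "nonholonomic_acceleration x \<xi> \<alpha> \<longleftrightarrow> (\<exists>w f. \<xi> = (\<Sum>a<m. w a *\<^sub>R E a x) \<and>
    \<alpha> = (\<Sum>a<m. w a *\<^sub>R \<D> (E a) x \<xi> + f a *\<^sub>R E a x) \<and>
    (\<forall>c<m. G x \<alpha> (E c x) = 1/2 * form_derivative G x (E c x) \<xi> \<xi> - form_derivative G x \<xi> \<xi> (E c x)))"

text \<open>Coordinate functions test the base and the fibre components of the velocity. In the
  nonholonomic equation both lifts of \<open>X c\<close> contribute the term \<open>G \<xi> (D(X c) \<xi>)\<close>, which cancels.\<close>

lemma integral_curve_chart:
  assumes "differentiable_curve (tangent_atlas A) \<gamma> t" "velocity (tangent_atlas A) \<gamma> t = \<Gamma> (\<gamma> t)"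
    "\<gamma> t \<in> total_space A D" "fst (\<gamma> t) \<in> U"
  defines "x \<equiv> \<lambda>s. \<phi> (fst (\<gamma> s))" and "\<xi> \<equiv> \<lambda>s. coord (snd (\<gamma> s))"
  shows "\<exists>\<xi>'. (x has_vector_derivative \<xi> t) (at t) \<and> (\<xi> has_vector_derivative \<xi>') (at t) \<and>
    nonholonomic_acceleration (x t) (\<xi> t) \<xi>'"
proof -
  interpret T: atlas_chart "tangent_atlas A" tangent_domain tangent_chart by (rule atlas_chart_tangent)
  obtain q v where qv: "\<gamma> t = (q, v)" by fastforce
  have q: "q \<in> U" "v \<in> D q" using assms(3,4) by (auto simp: qv total_space_def)
  have vT: "v \<in> tangent_space A q" using q by (rule distribution_tangent)
  have xt: "x t = \<phi> q" and \<xi>t: "\<xi> t = coord v" by (simp_all add: x_def \<xi>_def qv)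
  note G = chart_metric_smooth_form[OF metric]
  have dom: "\<gamma> t \<in> tangent_domain" using q vT by (simp add: qv tangent_domain_def)
  obtain h k where hk: "T.coord (velocity (tangent_atlas A) \<gamma> t) = (h, k)" by fastforce
  have d: "((\<lambda>s. tangent_chart (\<gamma> s)) has_vector_derivative (h, k)) (at t)"
    using T.differentiable_curve_chart[OF assms(1) dom] hk by simp
  have "fst (tangent_chart (\<gamma> s)) = x s" "snd (tangent_chart (\<gamma> s)) = \<xi> s" for s
    by (auto simp: tangent_chart_def x_def \<xi>_def split: prod.split)
  then have dx: "(x has_vector_derivative h) (at t)" and d\<xi>: "(\<xi> has_vector_derivative k) (at t)"
    using has_derivative_fst[OF d[unfolded has_vector_derivative_def]]
      has_derivative_snd[OF d[unfolded has_vector_derivative_def]]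
    by (simp_all add: has_vector_derivative_def)
  have vel: "\<Gamma> (q, v) = tvec (q, v) (h, k)"
    using T.velocity_chart[OF d T.differentiable_curve_continuous[OF assms(1) T.openin_domain dom]] assms(2)
    by (simp add: qv)
  let ?L = "kinetic_lagrangian g"
  let ?w = "quasi_velocity DIM('e) X (q, v)"
  obtain f where f: "\<And>p. p \<in> total_space A D \<Longrightarrow> \<Gamma> p = (\<lambda>F. \<Sum>a<m. quasi_velocity DIM('e) X p a * complete_lift A (X a) p F
                        + f a p * vertical_lift A (X a) p F)"
    and nh: "\<And>p Y. p \<in> total_space A D \<Longrightarrow> Y \<in> sections A D \<Longrightarrow> \<Gamma> p (\<lambda>p'. vertical_lift A Y p' ?L) - complete_lift A Y p ?L = 0"
    using nonholonomic unfolding nonholonomic_vector_field_def by blast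
  have pD: "(q, v) \<in> total_space A D" using assms(3) qv by simp
  have \<Gamma>F: "tvec (q, v) (h, k) F = (\<Sum>a<m. ?w a * tvec (q, v) (E a (\<phi> q), \<D> (E a) (\<phi> q) (coord v)) F
      + f a (q, v) * tvec (q, v) (0, E a (\<phi> q)) F)" for F
  proof -
    have "complete_lift A (X a) (q, v) = tvec (q, v) (E a (\<phi> q), \<D> (E a) (\<phi> q) (coord v)) \<and>
        vertical_lift A (X a) (q, v) = tvec (q, v) (0, E a (\<phi> q))" if "a < m" for a
      using complete_lift_chart[OF frame_field q(1) vT, of a] vertical_lift_chart[of q v "X a", OF q(1) vT frame_tangent[OF q(1)]]
        coord_frame[OF q(1)] that m_le by simp
    then show ?thesis using f[OF pD] vel by (simp add: fun_eq_iff)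
  qed
  have w: "coord v = (\<Sum>a<m. ?w a *\<^sub>R E a (\<phi> q))" by (rule quasi_velocity_distribution[OF q])
  have h: "h = coord v"
  proof (rule euclidean_eqI)
    fix b :: 'e assume "b \<in> Basis"
    note c = tvec_coordinates(1)[OF q(1) vT this]
    show "h \<bullet> b = coord v \<bullet> b"
      using \<Gamma>F[of "\<lambda>p. \<phi> (fst p) \<bullet> b"] unfolding c w inner_sum_left by simp
  qed
  have k: "k = (\<Sum>a<m. ?w a *\<^sub>R \<D> (E a) (\<phi> q) (coord v) + f a (q, v) *\<^sub>R E a (\<phi> q))"
  proof (rule euclidean_eqI)
    fix b :: 'e assume "b \<in> Basis"
    note c = tvec_coordinates(2)[OF q(1) vT this]
    show "k \<bullet> b = (\<Sum>a<m. ?w a *\<^sub>R \<D> (E a) (\<phi> q) (coord v) + f a (q, v) *\<^sub>R E a (\<phi> q)) \<bullet> b"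
      using \<Gamma>F[of "\<lambda>p. snd p (\<lambda>x. \<phi> x \<bullet> b)"] unfolding c inner_sum_left by (simp add: inner_add_left)
  qed
  have nhc: "G (\<phi> q) k (E c (\<phi> q)) =
      1/2 * form_derivative G (\<phi> q) (E c (\<phi> q)) (coord v) (coord v) - form_derivative G (\<phi> q) (coord v) (coord v) (E c (\<phi> q))"
    if c: "c < m" for c
  proof -
    have cn: "c < DIM('e)" using c m_le by simp
    \<comment> \<open>The frame fields themselves are the sections on which the equation is tested.\<close>
    have "X c \<in> sections A D"
      unfolding sections_def
    proof (safe intro!: frame_field[OF cn])
      fix r assume r: "r \<in> carrier A"
      have "X c r = lincomb {..<m} (\<lambda>a. if a = c then 1 else 0) X r"
        using c by (simp add: lincomb_def fun_eq_iff if_distrib[of "\<lambda>x. x * _"] cong: if_cong)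
      then show "X c r \<in> D r" using frame r unfolding adapted_frame_def by blast
    qed
    from nh[OF pD this]
    have "tvec (q, v) (h, k) (\<lambda>p'. vertical_lift A (X c) p' ?L) -
        tvec (q, v) (E c (\<phi> q), \<D> (E c) (\<phi> q) (coord v)) ?L = 0"
      using vel complete_lift_chart[OF frame_field[OF cn] q(1) vT] by simp
    then show ?thesis
      unfolding vertical_lift_kinetic_lagrangian(3)[OF frame_field[OF cn] q(1) vT]
        kinetic_lagrangian_chart(2)[OF q(1) vT] h
      using chart_metric_commute[OF metric, of "\<phi> q" "\<D> (E c) (\<phi> q) (coord v)" "coord v"] q
      by simp
  qed
  have "nonholonomic_acceleration (x t) (\<xi> t) k"
    unfolding nonholonomic_acceleration_def xt \<xi>t
    by (intro exI[of _ ?w] exI[of _ "\<lambda>a. f a (q, v)"] conjI allI impI w k nhc)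
  moreover have "(x has_vector_derivative \<xi> t) (at t)" using dx by (simp add: h \<xi>t)
  ultimately show ?thesis using d\<xi> by blast
qed

end

section \<open>The nonholonomic exponential map in a chart\<close>

text \<open>Induction along an interval: look at the infimum of the times at which \<open>P\<close> fails.\<close>

lemma unit_interval_induction:
  assumes closed: "\<And>t. t \<in> {0..1::real} \<Longrightarrow> (\<And>s. 0 \<le> s \<Longrightarrow> s < t \<Longrightarrow> P s) \<Longrightarrow> P t"
    and open_right: "\<And>t. t \<in> {0..1} \<Longrightarrow> P t \<Longrightarrow> \<forall>\<^sub>F s in at_right t. P s"
    and t: "t \<in> {0..1}"
  shows "P t"
proof (rule ccontr)
  define Z where "Z = {t \<in> {0..1}. \<not> P t}"
  define T where "T = Inf Z"
  assume "\<not> P t"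
  then have Z: "t \<in> Z" "bdd_below Z" "Z \<noteq> {}" using t by (auto simp: Z_def bdd_below_def)
  have T: "T \<in> {0..1}"
    using cInf_lower[OF Z(1,2)] cInf_greatest[OF Z(3), of 0] t by (auto simp: T_def Z_def)
  have below: "P s" if "0 \<le> s" "s < T" for s
  proof (rule ccontr)
    assume "\<not> P s"
    then have "s \<in> Z" using that T by (auto simp: Z_def)
    then show False using cInf_lower[OF _ Z(2)] that(2) unfolding T_def by fastforce
  qed
  then have PT: "P T" by (rule closed[OF T])
  have "\<exists>b>T. \<forall>s>T. s < b \<longrightarrow> P s"
    using open_right[OF T PT] by (simp add: eventually_at_right_field)
  then obtain b where b: "b > T" "\<And>s. T < s \<Longrightarrow> s < b \<Longrightarrow> P s" by blast
  have "b \<le> s" if "s \<in> Z" for s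
  proof -
    have "T \<le> s" using cInf_lower[OF that Z(2)] by (simp add: T_def)
    then show ?thesis using PT b(2)[of s] that by (force simp: Z_def)
  qed
  then have "b \<le> T" unfolding T_def by (rule cInf_greatest[OF Z(3)])
  then show False using b(1) by simp
qed

lemma unit_interval_subset: "is_interval I \<Longrightarrow> 0 \<in> I \<Longrightarrow> 1 \<in> I \<Longrightarrow> {0..1 :: real} \<subseteq> I"
  unfolding is_interval_1 by (meson atLeastAtMost_iff subsetI)

lemma onorm_scaleR_left_le: "norm v \<le> B \<Longrightarrow> onorm (\<lambda>h :: real. h *\<^sub>R v) \<le> B"
proof (rule onorm_le)
  fix h :: real assume "norm v \<le> B"
  then show "norm (h *\<^sub>R v) \<le> B * norm h" using mult_right_mono[of "norm v" B "norm h"] by (simp add: mult.commute)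
qed

lemma topspace_manifold_topology:
  assumes "smooth_atlas A" shows "topspace (manifold_topology A) = carrier A"
proof
  show "topspace (manifold_topology A) \<subseteq> carrier A"
    using openin_manifold_topology[OF assms] openin_topspace by blast
  have "open (\<psi> ` (V \<inter> carrier A))" if "(V, \<psi>) \<in> A" for V \<psi>
  proof -
    have "V \<inter> carrier A = V" using that by (auto simp: carrier_def)
    then show ?thesis using assms that by (auto simp: smooth_atlas_def)
  qed
  then have "openin (manifold_topology A) (carrier A)"
    unfolding openin_manifold_topology[OF assms] by blast
  then show "carrier A \<subseteq> topspace (manifold_topology A)" by (rule openin_subset)
qed

text \<open>The Hausdorff property enters here. A curve whose coordinates stay in a compact part of the
  chart cannot leave the chart.\<close>

lemma closedin_compact_chart_image:
  assumes "smooth_manifold A" "(U, \<phi>) \<in> A" "compact K" "K \<subseteq> \<phi> ` U"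
  shows "closedin (manifold_topology A) (inv_into U \<phi> ` K)"
proof -
  interpret atlas_chart A U \<phi> by unfold_locales (use assms in \<open>auto simp: smooth_manifold_def\<close>)
  let ?X = "subtopology euclidean (\<phi> ` U)"
  have "continuous_map ?X (manifold_topology A) \<phi>'"
    unfolding continuous_map_def
  proof (intro conjI allI impI)
    have "topspace (manifold_topology A) \<supseteq> U" using openin_domain openin_subset by blast
    then show "\<phi>' \<in> topspace ?X \<rightarrow> topspace (manifold_topology A)" using inv_chart(2) by auto
    fix N assume "openin (manifold_topology A) N"
    then have "open (\<phi> ` (U \<inter> N))" by (rule open_image_openin)
    moreover have "{y \<in> topspace ?X. \<phi>' y \<in> N} = \<phi> ` (U \<inter> N) \<inter> \<phi> ` U"
      by (auto simp: chart_inv dest: inj_onD[OF inj])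
    ultimately show "openin ?X {y \<in> topspace ?X. \<phi>' y \<in> N}"
      by (auto simp: openin_subtopology)
  qed
  moreover have "compactin ?X K" using assms(3,4) by (simp add: compactin_subtopology)
  ultimately have "compactin (manifold_topology A) (\<phi>' ` K)" using image_compactin by blast
  then show ?thesis
    using assms(1) compactin_imp_closedin unfolding smooth_manifold_def by blast
qed

text \<open>Functions lifted from the base test curves in the tangent bundle, so projections of
  differentiable curves are differentiable.\<close>

lemma differentiable_curve_base:
  assumes "smooth_atlas A" "differentiable_curve (tangent_atlas A) \<gamma> t"
    "fst (\<gamma> t) \<in> carrier A" "snd (\<gamma> t) \<in> tangent_space A (fst (\<gamma> t))"
  shows "differentiable_curve A (\<lambda>s. fst (\<gamma> s)) t"
proof -
  obtain U \<phi> where U: "(U, \<phi>) \<in> A" "fst (\<gamma> t) \<in> U" using assms(3) unfolding carrier_def by auto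
  interpret atlas_chart A U \<phi> by unfold_locales (use assms U in auto)
  show ?thesis unfolding differentiable_curve_def
  proof (intro allI impI)
    fix f assume "smooth_near A (fst (\<gamma> t)) f"
    from smooth_near_base_function(1)[OF this U(2) assms(4)]
    show "(\<lambda>s. f (fst (\<gamma> s))) differentiable (at t)"
      using assms(2) unfolding differentiable_curve_def by fastforce
  qed
qed

context nonholonomic_chart
begin

text \<open>Integral curves stay in the total space of the distribution on an open interval, so near each
  time their velocity lies in the span of the frame; this is what makes the equation of
  \<open>constrained_spray\<close> available.\<close>

lemma nonholonomic_spray:
  obtains F where "smooth_on (\<phi> ` U \<times> UNIV) (\<lambda>p. F (fst p) (snd p))"
    "\<And>y \<xi> r. y \<in> \<phi> ` U \<Longrightarrow> F y (r *\<^sub>R \<xi>) = r\<^sup>2 *\<^sub>R F y \<xi>"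
    "\<And>\<gamma> I t. integral_curve (tangent_atlas A) (total_space A D) \<Gamma> \<gamma> I \<Longrightarrow> open I \<Longrightarrow> t \<in> I \<Longrightarrow> fst (\<gamma> t) \<in> U \<Longrightarrow>
      ((\<lambda>s. tangent_chart (\<gamma> s)) has_vector_derivative
        (snd (tangent_chart (\<gamma> t)), F (fst (tangent_chart (\<gamma> t))) (snd (tangent_chart (\<gamma> t))))) (at t)"
    "\<And>\<gamma> I t. integral_curve (tangent_atlas A) (total_space A D) \<Gamma> \<gamma> I \<Longrightarrow> open I \<Longrightarrow> t \<in> I \<Longrightarrow> fst (\<gamma> t) \<in> U \<Longrightarrow>
      nonholonomic_acceleration (fst (tangent_chart (\<gamma> t))) (snd (tangent_chart (\<gamma> t)))
        (F (fst (tangent_chart (\<gamma> t))) (snd (tangent_chart (\<gamma> t))))"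
proof -
  interpret T: atlas_chart "tangent_atlas A" tangent_domain tangent_chart by (rule atlas_chart_tangent)
  note G = chart_metric_smooth_form[OF metric]
  have Esm: "smooth_on (\<phi> ` U) (E a)" if "a < m" for a using frame_smooth that m_le by simp
  show thesis
  proof (rule constrained_spray[OF G, where k = m and E = E])
    show "smooth_on (\<phi> ` U) (E a)" if "a < m" for a by (rule Esm[OF that])
  next
  fix F assume F: "smooth_on (\<phi> ` U \<times> UNIV) (\<lambda>p. F (fst p) (snd p))"
    "\<And>y \<xi> r. y \<in> \<phi> ` U \<Longrightarrow> F y (r *\<^sub>R \<xi>) = r\<^sup>2 *\<^sub>R F y \<xi>"
    and Feq: "\<And>x \<xi> \<xi>' t. (x has_vector_derivative \<xi> t) (at t) \<Longrightarrow> (\<xi> has_vector_derivative \<xi>') (at t) \<Longrightarrow> x t \<in> \<phi> ` U \<Longrightarrow>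
      \<forall>\<^sub>F s in nhds t. \<xi> s \<in> span ((\<lambda>a. E a (x s)) ` {..<m}) \<Longrightarrow>
      (\<And>a. a < m \<Longrightarrow> G (x t) \<xi>' (E a (x t)) =
        1/2 * form_derivative G (x t) (E a (x t)) (\<xi> t) (\<xi> t) - form_derivative G (x t) (\<xi> t) (\<xi> t) (E a (x t))) \<Longrightarrow>
      \<xi>' = F (x t) (\<xi> t)"
  have main: "((\<lambda>s. tangent_chart (\<gamma> s)) has_vector_derivative
        (snd (tangent_chart (\<gamma> t)), F (fst (tangent_chart (\<gamma> t))) (snd (tangent_chart (\<gamma> t))))) (at t) \<and>
      nonholonomic_acceleration (fst (tangent_chart (\<gamma> t))) (snd (tangent_chart (\<gamma> t)))
        (F (fst (tangent_chart (\<gamma> t))) (snd (tangent_chart (\<gamma> t))))"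
    if \<gamma>: "integral_curve (tangent_atlas A) (total_space A D) \<Gamma> \<gamma> I" and I: "open I" "t \<in> I" and tU: "fst (\<gamma> t) \<in> U"
    for \<gamma> I t
  proof -
    have ic: "\<gamma> s \<in> total_space A D" "differentiable_curve (tangent_atlas A) \<gamma> s" "velocity (tangent_atlas A) \<gamma> s = \<Gamma> (\<gamma> s)"
      if "s \<in> I" for s using \<gamma> that unfolding integral_curve_def by auto
    let ?x = "\<lambda>s. \<phi> (fst (\<gamma> s))" and ?\<xi> = "\<lambda>s. coord (snd (\<gamma> s))"
    have tc: "tangent_chart (\<gamma> s) = (?x s, ?\<xi> s)" for s by (simp add: tangent_chart_def split: prod.split)
    obtain \<xi>' where c: "(?x has_vector_derivative ?\<xi> t) (at t)" "(?\<xi> has_vector_derivative \<xi>') (at t)"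
      "nonholonomic_acceleration (?x t) (?\<xi> t) \<xi>'"
      using integral_curve_chart[OF ic(2,3,1)[OF I(2)] tU] by blast
    have dom: "\<gamma> t \<in> tangent_domain"
      using ic(1)[OF I(2)] tU distribution_tangent by (auto simp: total_space_def tangent_domain_def)
    have "\<forall>\<^sub>F s in nhds t. ?\<xi> s \<in> span ((\<lambda>a. E a (?x s)) ` {..<m})"
      using T.differentiable_curve_continuous[OF ic(2)[OF I(2)] T.openin_domain dom]
        eventually_nhds_in_open[OF I]
    proof eventually_elim
      case (elim s)
      then have "fst (\<gamma> s) \<in> U" "snd (\<gamma> s) \<in> D (fst (\<gamma> s))"
        using ic(1)[of s] by (auto simp: tangent_domain_def total_space_def)
      then show ?case using distribution_chart by (auto simp: chart_distribution_def)
    qed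
    then have eq: "\<xi>' = F (?x t) (?\<xi> t)"
      using tU c(3) by (intro Feq[of ?x ?\<xi> t, OF c(1,2)]) (auto simp: nonholonomic_acceleration_def)
    show ?thesis
    proof
      show "((\<lambda>s. tangent_chart (\<gamma> s)) has_vector_derivative
        (snd (tangent_chart (\<gamma> t)), F (fst (tangent_chart (\<gamma> t))) (snd (tangent_chart (\<gamma> t))))) (at t)"
        unfolding tc using has_vector_derivative_Pair[OF c(1,2)] by (simp add: eq)
      show "nonholonomic_acceleration (fst (tangent_chart (\<gamma> t))) (snd (tangent_chart (\<gamma> t)))
        (F (fst (tangent_chart (\<gamma> t))) (snd (tangent_chart (\<gamma> t))))"
        unfolding tc fst_conv snd_conv using c(3) unfolding eq .
    qed
  qed
  show thesis by (rule that[of F]) (use F main in blast)+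
  qed (use chart_metric_commute[OF metric] chart_metric_pos[OF metric] frame_independent in blast)+
qed

text \<open>A bootstrap estimate. As long as \<open>|\<xi>| \<le> \<rho>\<close>, the acceleration is at most \<open>C \<rho>\<^sup>2 \<le> \<rho> / 4\<close>, so up to time
  one the speed remains at most \<open>\<rho> / 4 + \<rho> / 4 = \<rho> / 2\<close> and the point remains within \<open>\<rho> \<le> r / 2\<close> of the
  initial one. The bounds \<open>\<rho>\<close> and \<open>r\<close> are thus reproduced with room to spare and
  cannot be violated for a first time.\<close>

lemma integral_curve_confined:
  assumes A: "smooth_manifold A" and q: "q \<in> U"
    and ode: "\<And>t. t \<in> I \<Longrightarrow> fst (\<gamma> t) \<in> U \<Longrightarrow> ((\<lambda>s. tangent_chart (\<gamma> s)) has_vector_derivative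
        (snd (tangent_chart (\<gamma> t)), F (fst (tangent_chart (\<gamma> t))) (snd (tangent_chart (\<gamma> t))))) (at t)"
    and r: "cball (\<phi> q) r \<subseteq> \<phi> ` U" and C: "\<And>y \<xi>. y \<in> cball (\<phi> q) r \<Longrightarrow> norm (F y \<xi>) \<le> C * (norm \<xi>)\<^sup>2"
    and \<rho>: "0 < \<rho>" "\<rho> \<le> r / 2" "C * \<rho> \<le> 1 / 4" "0 \<le> C"
    and \<gamma>: "integral_curve (tangent_atlas A) (total_space A D) \<Gamma> \<gamma> I" and I: "{0..1} \<subseteq> I"
    and \<gamma>0: "\<gamma> 0 = (q, v)" "norm (coord v) \<le> \<rho> / 4" and t: "t \<in> {0..1}"
  shows "\<gamma> t \<in> tangent_domain \<and> tangent_chart (\<gamma> t) \<in> ball (\<phi> q) r \<times> ball 0 \<rho>"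
proof (rule unit_interval_induction[OF _ _ t])
  interpret T: atlas_chart "tangent_atlas A" tangent_domain tangent_chart by (rule atlas_chart_tangent)
  let ?P = "\<lambda>t. \<gamma> t \<in> tangent_domain \<and> tangent_chart (\<gamma> t) \<in> ball (\<phi> q) r \<times> ball 0 \<rho>"
  have ic: "\<gamma> s \<in> total_space A D" "differentiable_curve (tangent_atlas A) \<gamma> s"
    if "s \<in> {0..1}" for s using \<gamma> I that unfolding integral_curve_def by auto
  show "\<forall>\<^sub>F s in at_right t. ?P s" if 2: "t \<in> {0..1}" "?P t" for t
  proof -
    have "openin (manifold_topology (tangent_atlas A)) (tangent_domain \<inter> tangent_chart -` (ball (\<phi> q) r \<times> ball 0 \<rho>))"
      by (intro T.openin_preimage open_Times open_ball)
    from T.differentiable_curve_continuous[OF ic(2)[OF 2(1)] this] 2(2)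
    have "\<forall>\<^sub>F s in nhds t. ?P s" by simp
    then show ?thesis by (simp add: eventually_nhds_conv_at eventually_at_split)
  qed
  show "?P t" if 1: "t \<in> {0..1}" "\<And>s. 0 \<le> s \<Longrightarrow> s < t \<Longrightarrow> ?P s" for t
  proof -
    have dom: "\<gamma> s \<in> tangent_domain" if "s \<in> {0..1}" "fst (\<gamma> s) \<in> U" for s
      using ic(1)[OF that(1)] that(2) distribution_tangent by (auto simp: total_space_def tangent_domain_def)
    define y where "y s = tangent_chart (\<gamma> s)" for s
    have y0: "y 0 = (\<phi> q, coord v)" by (simp add: y_def \<gamma>0 tangent_chart_def)
    have yd: "(y has_vector_derivative (snd (y s), F (fst (y s)) (snd (y s)))) (at s)"
      if "s \<in> {0..1}" "fst (\<gamma> s) \<in> U" for s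
      unfolding y_def using ode that I by blast
    have fd: "((\<lambda>s. fst (y s)) has_derivative (\<lambda>h. h *\<^sub>R snd (y s))) (at s)"
      "((\<lambda>s. snd (y s)) has_derivative (\<lambda>h. h *\<^sub>R F (fst (y s)) (snd (y s)))) (at s)"
      if "s \<in> {0..1}" "fst (\<gamma> s) \<in> U" for s
      using has_derivative_fst[OF yd[OF that, unfolded has_vector_derivative_def]]
        has_derivative_snd[OF yd[OF that, unfolded has_vector_derivative_def]] by simp_all
    have inside: "y s \<in> cball (\<phi> q) (r / 2) \<times> cball 0 (\<rho> / 2)" if s: "0 \<le> s" "s < t" for s
    proof -
      have s1: "s \<le> 1" using s 1(1) by simp
      have \<rho>s: "\<rho> * s \<le> \<rho>" using s1 \<rho>(1) by (simp add: mult_left_le)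
      have P: "\<gamma> \<tau> \<in> tangent_domain" "fst (\<gamma> \<tau>) \<in> U" "fst (y \<tau>) \<in> cball (\<phi> q) r" "norm (snd (y \<tau>)) \<le> \<rho>" "\<tau> \<in> {0..1}"
        if "\<tau> \<in> {0..s}" for \<tau>
        using 1(2)[of \<tau>] that s s1 by (auto simp: y_def tangent_domain_def mem_Times_iff)
      have "norm (fst (y s) - fst (y 0)) \<le> \<rho> * norm (s - 0)"
      proof (rule differentiable_bound[of "{0..s}"])
        show "((\<lambda>s. fst (y s)) has_derivative (\<lambda>h. h *\<^sub>R snd (y \<tau>))) (at \<tau> within {0..s})" if "\<tau> \<in> {0..s}" for \<tau>
          using fd(1) P[OF that] has_derivative_at_withinI by blast
        show "onorm (\<lambda>h. h *\<^sub>R snd (y \<tau>)) \<le> \<rho>" if "\<tau> \<in> {0..s}" for \<tau>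
          using P(4)[OF that] by (rule onorm_scaleR_left_le)
      qed (use s in auto)
      also have "\<dots> \<le> r / 2" using s \<rho>(2) \<rho>s by simp
      finally have 1: "fst (y s) \<in> cball (\<phi> q) (r / 2)" by (simp add: y0 dist_norm norm_minus_commute)
      have "norm (snd (y s) - snd (y 0)) \<le> (\<rho> / 4) * norm (s - 0)"
      proof (rule differentiable_bound[of "{0..s}"])
        show "((\<lambda>s. snd (y s)) has_derivative (\<lambda>h. h *\<^sub>R F (fst (y \<tau>)) (snd (y \<tau>)))) (at \<tau> within {0..s})" if "\<tau> \<in> {0..s}" for \<tau>
          using fd(2) P[OF that] has_derivative_at_withinI by blast
        show "onorm (\<lambda>h. h *\<^sub>R F (fst (y \<tau>)) (snd (y \<tau>))) \<le> \<rho> / 4" if "\<tau> \<in> {0..s}" for \<tau>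
        proof -
          have "norm (F (fst (y \<tau>)) (snd (y \<tau>))) \<le> C * (norm (snd (y \<tau>)))\<^sup>2" by (rule C[OF P(3)[OF that]])
          also have "\<dots> \<le> C * \<rho>\<^sup>2" using P(4)[OF that] \<rho> by (intro mult_left_mono power_mono) auto
          also have "\<dots> = (C * \<rho>) * \<rho>" by (simp add: power2_eq_square)
          also have "\<dots> \<le> \<rho> / 4" using \<rho> mult_right_mono[OF \<rho>(3), of \<rho>] by simp
          finally show ?thesis by (rule onorm_scaleR_left_le)
        qed
      qed (use s in auto)
      also have "\<dots> \<le> \<rho> / 4" using s \<rho>s by simp
      finally have "norm (snd (y s)) \<le> \<rho> / 2"
        using \<gamma>0(2) norm_triangle_ineq2[of "snd (y s)" "snd (y 0)"] by (simp add: y0)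
      then show ?thesis using 1 by (simp add: mem_Times_iff)
    qed
    have r0: "r > 0" using \<rho> by simp
    show ?thesis
    proof (cases "t = 0")
      case True
      then show ?thesis using y0 \<gamma>0 \<rho> r0 q dom[of 0] by (auto simp: y_def)
    next
      case False
      then have t: "0 < t" "t \<le> 1" using 1(1) by auto
      let ?K = "\<phi>' ` cball (\<phi> q) (r / 2)"
      have left: "\<forall>\<^sub>F s in at_left t. 0 < s \<and> s < t"
        using t(1) by (auto simp: eventually_at_left_field)
      have "fst (\<gamma> t) \<in> ?K"
      proof (rule ccontr)
        assume notK: "fst (\<gamma> t) \<notin> ?K"
        have "closedin (manifold_topology A) ?K"
          using A chart r r0 by (intro closedin_compact_chart_image) auto
        moreover have tc: "fst (\<gamma> t) \<in> carrier A" "snd (\<gamma> t) \<in> D (fst (\<gamma> t))"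
          using ic(1)[OF 1(1)] by (auto simp: total_space_def)
        ultimately have N: "openin (manifold_topology A) (carrier A - ?K)" "fst (\<gamma> t) \<in> carrier A - ?K"
          using notK topspace_manifold_topology[OF atlas] by (auto simp: closedin_def)
        obtain V \<psi> where V: "(V, \<psi>) \<in> A" "fst (\<gamma> t) \<in> V" using tc(1) unfolding carrier_def by auto
        interpret V: nonholonomic_chart A V \<psi> g m D X \<Gamma>
          by unfold_locales (use V atlas metric frame nonholonomic in auto)
        have "differentiable_curve A (\<lambda>s. fst (\<gamma> s)) t"
          using differentiable_curve_base[OF atlas ic(2)[OF 1(1)] tc(1)] V.distribution_tangent[OF V(2) tc(2)] by blast
        from differentiable_curve_continuous[OF this N]
        have "\<forall>\<^sub>F s in at_left t. fst (\<gamma> s) \<notin> ?K"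
          unfolding eventually_nhds_conv_at eventually_at_split by (auto elim: eventually_mono)
        then have "\<forall>\<^sub>F s in at_left t. False"
          using left
        proof eventually_elim
          case (elim s)
          have "\<gamma> s \<in> tangent_domain" using 1(2)[of s] elim by simp
          then have "\<phi>' (fst (y s)) = fst (\<gamma> s)"
            by (auto simp: y_def tangent_chart_def tangent_domain_def chart_inv)
          then have "fst (\<gamma> s) \<in> ?K" using inside[of s] elim by (auto simp: mem_Times_iff intro: rev_image_eqI)
          then show False using elim by simp
        qed
        then show False by simp
      qed
      then obtain z where z: "z \<in> cball (\<phi> q) (r / 2)" "fst (\<gamma> t) = \<phi>' z" by blast
      have "cball (\<phi> q) (r / 2) \<subseteq> \<phi> ` U"
        by (rule order_trans[OF subset_cball r]) (use r0 in simp)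
      then have tU: "fst (\<gamma> t) \<in> U" using inv_chart(2)[of z] z by auto
      have "isCont y t"
        using yd[OF 1(1) tU] by (rule has_vector_derivative_continuous)
      then have "(y \<longlongrightarrow> y t) (at_left t)"
        unfolding isCont_def by (rule tendsto_within_subset) auto
      moreover have "\<forall>\<^sub>F s in at_left t. y s \<in> cball (\<phi> q) (r / 2) \<times> cball 0 (\<rho> / 2)"
        using left by eventually_elim (auto intro!: inside)
      moreover have "closed (cball (\<phi> q) (r / 2) \<times> cball (0 :: 'e) (\<rho> / 2))" by (intro closed_Times closed_cball)
      ultimately have "y t \<in> cball (\<phi> q) (r / 2) \<times> cball 0 (\<rho> / 2)"
        using Lim_in_closed_set trivial_limit_at_left_real by blast
      then show ?thesis using dom[OF 1(1) tU] r0 \<rho>(1) by (auto simp: y_def mem_Times_iff)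
    qed
  qed
qed


text \<open>Near \<open>q\<close> the exponential map is described by solutions of one smooth second-order equation:
  \<open>y w\<close> is the motion in the chart with initial velocity \<open>w\<close>. The compact set \<open>S\<close> serves for
  uniform estimates; it is invariant under shrinking of velocities because motions will be
  slowed down.\<close>

definition exp_motion where
  "exp_motion W q F S w y \<longleftrightarrow>
    cvec q w \<in> W q \<and> nh_exp A D \<Gamma> q (cvec q w) \<in> U \<and> \<phi> (nh_exp A D \<Gamma> q (cvec q w)) = fst (y 1) \<and>
    y 0 = (\<phi> q, w) \<and> nonholonomic_acceleration (\<phi> q) w (F (\<phi> q) w) \<and>
    (\<forall>t\<in>{0..1::real}. (y has_vector_derivative (snd (y t), F (fst (y t)) (snd (y t)))) (at t within {0..1}) \<and> y t \<in> S)"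

definition exp_motions where
  "exp_motions W q F S \<epsilon> y \<longleftrightarrow> smooth_on (\<phi> ` U \<times> UNIV) (\<lambda>p. F (fst p) (snd p)) \<and>
    (\<forall>x\<in>\<phi> ` U. \<forall>\<xi> r. F x (r *\<^sub>R \<xi>) = r\<^sup>2 *\<^sub>R F x \<xi>) \<and>
    compact S \<and> convex S \<and> S \<subseteq> \<phi> ` U \<times> UNIV \<and>
    (\<forall>x \<xi>. \<forall>r\<in>{0..1}. (x, \<xi>) \<in> S \<longrightarrow> (x, r *\<^sub>R \<xi>) \<in> S) \<and> (0 :: real) < \<epsilon> \<and>
    (\<forall>w\<in>chart_distribution (\<phi> q). norm w < \<epsilon> \<longrightarrow> exp_motion W q F S w (y w))"

text \<open>The domain contains a ball for the norm of the metric, and this norm is bounded by a multiple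
  of the Euclidean norm of the chart.\<close>

lemma exp_domain_chart:
  assumes q: "q \<in> U" and W: "exp_domain A g D \<Gamma> W"
  shows "\<exists>\<epsilon>>0. \<forall>w\<in>chart_distribution (\<phi> q). norm w < \<epsilon> \<longrightarrow> cvec q w \<in> W q"
proof -
  have "zero_vector \<in> W q" "\<And>v. v \<in> W q \<Longrightarrow> \<exists>\<epsilon>>0. \<forall>u\<in>D q. sqrt (g q (add_scaled u (-1) v) (add_scaled u (-1) v)) < \<epsilon> \<longrightarrow> u \<in> W q"
    using W in_carrier[OF q] unfolding exp_domain_def by auto
  then obtain \<epsilon> where \<epsilon>: "\<epsilon> > 0" "\<And>u. u \<in> D q \<Longrightarrow>
      sqrt (g q (add_scaled u (-1) zero_vector) (add_scaled u (-1) zero_vector)) < \<epsilon> \<Longrightarrow> u \<in> W q" by blast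
  have az: "add_scaled u (-1) zero_vector = u" for u :: "'q tangent"
    by (simp add: add_scaled_def zero_vector_def)
  obtain B where B: "B > 0" "\<And>u w. norm (G (\<phi> q) u w) \<le> B * norm u * norm w"
    using bilinear_bounded_pos[OF smooth_form_bilinear[OF chart_metric_smooth_form[OF metric]]] q by blast
  show ?thesis
  proof (intro exI[of _ "\<epsilon> / sqrt B"] conjI ballI impI)
    show "0 < \<epsilon> / sqrt B" using \<epsilon> B by simp
    fix w assume w: "w \<in> chart_distribution (\<phi> q)" "norm w < \<epsilon> / sqrt B"
    have "g q (cvec q w) (cvec q w) = G (\<phi> q) w w" by (simp add: chart_metric_def chart_inv[OF q])
    also have "\<dots> \<le> B * (norm w)\<^sup>2" using B(2)[of w w] by (simp add: power2_eq_square)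
    finally have "sqrt (g q (cvec q w) (cvec q w)) \<le> sqrt B * norm w"
      using real_sqrt_le_mono by (fastforce simp: real_sqrt_mult)
    also have "\<dots> < \<epsilon>" using w(2) B(1) by (simp add: field_simps)
    finally show "cvec q w \<in> W q" using \<epsilon>(2)[OF cvec_in_distribution[OF q w(1)]] by (simp add: az)
  qed
qed

text \<open>The domain of the exponential map supplies an integral curve for every small initial velocity.
  Any two of them are confined to \<open>S\<close> and solve the same equation, hence they end at the same point,
  which is therefore the value of the flow.\<close>

lemma exp_motions_exist:
  assumes A: "smooth_manifold A" and q: "q \<in> U" and W: "exp_domain A g D \<Gamma> W"
  shows "\<exists>F S \<epsilon> y. exp_motions W q F S \<epsilon> y"
proof (rule nonholonomic_spray)
  let ?TA = "tangent_atlas A" and ?C = "total_space A D"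
  fix F
  assume F: "smooth_on (\<phi> ` U \<times> UNIV) (\<lambda>p. F (fst p) (snd p))"
    and hom: "\<And>y \<xi> r. y \<in> \<phi> ` U \<Longrightarrow> F y (r *\<^sub>R \<xi>) = r\<^sup>2 *\<^sub>R F y \<xi>"
    and ode: "\<And>\<gamma> I t. integral_curve ?TA ?C \<Gamma> \<gamma> I \<Longrightarrow> open I \<Longrightarrow> t \<in> I \<Longrightarrow> fst (\<gamma> t) \<in> U \<Longrightarrow>
      ((\<lambda>s. tangent_chart (\<gamma> s)) has_vector_derivative
        (snd (tangent_chart (\<gamma> t)), F (fst (tangent_chart (\<gamma> t))) (snd (tangent_chart (\<gamma> t))))) (at t)"
    and acc: "\<And>\<gamma> I t. integral_curve ?TA ?C \<Gamma> \<gamma> I \<Longrightarrow> open I \<Longrightarrow> t \<in> I \<Longrightarrow> fst (\<gamma> t) \<in> U \<Longrightarrow>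
      nonholonomic_acceleration (fst (tangent_chart (\<gamma> t))) (snd (tangent_chart (\<gamma> t)))
        (F (fst (tangent_chart (\<gamma> t))) (snd (tangent_chart (\<gamma> t))))"
  have "\<phi> q \<in> \<phi> ` U" using q by simp
  then obtain r where r: "r > 0" "cball (\<phi> q) r \<subseteq> \<phi> ` U" using open_image open_contains_cball by metis
  have "bounded ((\<lambda>p. F (fst p) (snd p)) ` (cball (\<phi> q) r \<times> cball 0 1))"
    using r(2) by (intro compact_imp_bounded compact_continuous_image compact_Times compact_cball
      continuous_on_subset[OF smooth_on_continuous[OF F]]) auto
  then obtain C where C0: "C > 0"
    "\<And>z. z \<in> (\<lambda>p. F (fst p) (snd p)) ` (cball (\<phi> q) r \<times> cball 0 1) \<Longrightarrow> norm z \<le> C"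
    unfolding bounded_pos by blast
  note Cpos = C0(1)
  have C: "norm (F x \<xi>) \<le> C" if "x \<in> cball (\<phi> q) r" "norm \<xi> \<le> 1" for x \<xi>
    using C0(2)[OF imageI, of "(x, \<xi>)"] that by auto
  \<comment> \<open>\<open>F\<close> is homogeneous of degree two in the velocity.\<close>
  have C2: "norm (F x \<xi>) \<le> C * (norm \<xi>)\<^sup>2" if x: "x \<in> cball (\<phi> q) r" for x \<xi>
  proof -
    have "F x \<xi> = F x (norm \<xi> *\<^sub>R sgn \<xi>)" by (cases "\<xi> = 0") (simp_all add: sgn_div_norm)
    also have "\<dots> = (norm \<xi>)\<^sup>2 *\<^sub>R F x (sgn \<xi>)" using hom x r by blast
    finally have "norm (F x \<xi>) = (norm \<xi>)\<^sup>2 * norm (F x (sgn \<xi>))" by simp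
    also have "\<dots> \<le> (norm \<xi>)\<^sup>2 * C" using C[OF x, of "sgn \<xi>"] by (intro mult_left_mono) (auto simp: norm_sgn)
    finally show ?thesis by (simp add: mult.commute)
  qed
  define \<rho> where "\<rho> = min (r / 2) (1 / (4 * C))"
  have \<rho>: "0 < \<rho>" "\<rho> \<le> r / 2" "C * \<rho> \<le> 1 / 4"
  proof -
    show "0 < \<rho>" "\<rho> \<le> r / 2" using r Cpos by (auto simp: \<rho>_def)
    have "C * \<rho> \<le> C * (1 / (4 * C))" using Cpos by (intro mult_left_mono) (auto simp: \<rho>_def)
    then show "C * \<rho> \<le> 1 / 4" using Cpos by simp
  qed
  obtain \<epsilon>0 where \<epsilon>0: "\<epsilon>0 > 0" "\<And>w. w \<in> chart_distribution (\<phi> q) \<Longrightarrow> norm w < \<epsilon>0 \<Longrightarrow> cvec q w \<in> W q"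
    using exp_domain_chart[OF q W] by blast
  define \<epsilon> where "\<epsilon> = min \<epsilon>0 (\<rho> / 4)"
  let ?S = "cball (\<phi> q) r \<times> cball (0 :: 'e) \<rho>"
  have S: "compact ?S" "convex ?S" "?S \<subseteq> \<phi> ` U \<times> UNIV"
    using r by (auto intro: compact_Times convex_Times)
  have star: "(x, s *\<^sub>R \<xi>) \<in> ?S" if "s \<in> {0..1}" "(x, \<xi>) \<in> ?S" for x \<xi> s
    using that mult_left_le_one_le[of "norm \<xi>" s] by auto
  let ?Gf = "\<lambda>p. (snd p, F (fst p) (snd p))"
  have op: "open (\<phi> ` U \<times> (UNIV :: 'e set))" using open_image by (simp add: open_Times)
  have Gf: "smooth_on (\<phi> ` U \<times> UNIV) ?Gf"
    by (intro smooth_on_Pair[OF op] smooth_on_snd[OF op] smooth_on_ident[OF op] F)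
  have conf: "\<gamma> t \<in> tangent_domain \<and> tangent_chart (\<gamma> t) \<in> ?S \<and>
      ((\<lambda>s. tangent_chart (\<gamma> s)) has_vector_derivative ?Gf (tangent_chart (\<gamma> t))) (at t within {0..1})"
    if \<gamma>: "open I" "is_interval I" "0 \<in> I" "1 \<in> I" "integral_curve ?TA ?C \<Gamma> \<gamma> I" "\<gamma> 0 = (q, cvec q w)"
      and w: "norm w < \<epsilon>" and t: "t \<in> {0..1}" for \<gamma> I w t
  proof -
    have I: "{0..1} \<subseteq> I" using unit_interval_subset[OF \<gamma>(2,3,4)] .
    have *: "\<gamma> t \<in> tangent_domain \<and> tangent_chart (\<gamma> t) \<in> ball (\<phi> q) r \<times> ball 0 \<rho>"
    proof (rule integral_curve_confined[OF A q _ r(2) C2 \<rho> _ \<gamma>(5) I \<gamma>(6) _ t])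
      show "norm (coord (cvec q w)) \<le> \<rho> / 4" using w q by (simp add: \<epsilon>_def)
      show "((\<lambda>s. tangent_chart (\<gamma> s)) has_vector_derivative ?Gf (tangent_chart (\<gamma> t))) (at t)"
        if "t \<in> I" "fst (\<gamma> t) \<in> U" for t by (rule ode[OF \<gamma>(5,1) that])
    qed (use Cpos in simp_all)
    then have fU: "fst (\<gamma> t) \<in> U" by (cases "\<gamma> t") (simp add: tangent_domain_def)
    have "((\<lambda>s. tangent_chart (\<gamma> s)) has_vector_derivative ?Gf (tangent_chart (\<gamma> t))) (at t within {0..1})"
      by (rule has_vector_derivative_at_within[OF ode[OF \<gamma>(5,1) subsetD[OF I t] fU]])
    then show ?thesis using * by auto
  qed
  have "\<exists>y. exp_motion W q F ?S w y"
    if w: "w \<in> chart_distribution (\<phi> q)" "norm w < \<epsilon>" for w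
  proof -
    let ?v = "cvec q w"
    have vW: "?v \<in> W q" using \<epsilon>0(2)[OF w(1)] w(2) by (simp add: \<epsilon>_def)
    then obtain p' where "flow_relation ?TA ?C \<Gamma> 1 (q, ?v) p'"
      using W in_carrier[OF q] unfolding exp_domain_def by blast
    then obtain \<gamma> I where \<gamma>: "open I" "is_interval I" "0 \<in> I" "1 \<in> I" "integral_curve ?TA ?C \<Gamma> \<gamma> I" "\<gamma> 0 = (q, ?v)"
      unfolding flow_relation_def by blast
    define y where "y t = tangent_chart (\<gamma> t)" for t
    have y: "(y has_vector_derivative ?Gf (y t)) (at t within {0..1})" "y t \<in> ?S" "\<gamma> t \<in> tangent_domain" if "t \<in> {0..1}" for t
      using conf[OF \<gamma> w(2) that] by (auto simp: y_def[abs_def])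
    have y0: "y 0 = (\<phi> q, w)" using q by (simp add: y_def \<gamma>(6) tangent_chart_def)
    have flow: "flow ?TA ?C \<Gamma> 1 (q, ?v) = \<gamma> 1"
      unfolding flow_def
    proof (rule the_equality)
      show "flow_relation ?TA ?C \<Gamma> 1 (q, ?v) (\<gamma> 1)" unfolding flow_relation_def using \<gamma> by blast
      fix p assume "flow_relation ?TA ?C \<Gamma> 1 (q, ?v) p"
      then obtain \<delta> J where \<delta>: "open J" "is_interval J" "0 \<in> J" "1 \<in> J" "integral_curve ?TA ?C \<Gamma> \<delta> J" "\<delta> 0 = (q, ?v)"
        and p: "\<delta> 1 = p" unfolding flow_relation_def by blast
      have "tangent_chart (\<delta> 1) = tangent_chart (\<gamma> 1)"
        by (rule ode_solution_unique[OF op Gf S, where T = 1 and y = "\<lambda>t. tangent_chart (\<delta> t)" and x = "\<lambda>t. tangent_chart (\<gamma> t)"])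
          (use conf[OF \<delta> w(2)] conf[OF \<gamma> w(2)] \<gamma>(6) \<delta>(6) in auto)
      then have "\<delta> 1 = \<gamma> 1"
        using conf[OF \<delta> w(2), of 1] conf[OF \<gamma> w(2), of 1] by (intro inj_onD[OF tangent_chart_inv(1)]) auto
      then show "p = \<gamma> 1" using p by simp
    qed
    have exp: "nh_exp A D \<Gamma> q ?v = fst (\<gamma> 1)" by (simp add: nh_exp_def flow)
    have expU: "nh_exp A D \<Gamma> q ?v \<in> U" "\<phi> (nh_exp A D \<Gamma> q ?v) = fst (y 1)"
      using exp y(3)[of 1] by (cases "\<gamma> 1"; simp add: y_def tangent_chart_def tangent_domain_def)+
    have f0: "fst (\<gamma> 0) \<in> U" and tc0: "tangent_chart (\<gamma> 0) = (\<phi> q, w)"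
      using q y0 \<gamma>(6) by (simp_all add: y_def)
    have acc0: "nonholonomic_acceleration (\<phi> q) w (F (\<phi> q) w)"
      using acc[OF \<gamma>(5,1,3) f0] unfolding tc0 fst_conv snd_conv .
    show ?thesis unfolding exp_motion_def
      by (intro exI[of _ y] conjI ballI vW expU y0 y(1,2) acc0)
  qed
  then obtain y where "\<And>w. w \<in> chart_distribution (\<phi> q) \<Longrightarrow> norm w < \<epsilon> \<Longrightarrow> exp_motion W q F ?S w (y w)" by metis
  then have "exp_motions W q F ?S \<epsilon> y"
    unfolding exp_motions_def using F hom S star \<epsilon>0(1) \<rho>(1)
    by (simp add: \<epsilon>_def del: mem_Sigma_iff mem_Times_iff)
  then show "\<exists>F S \<epsilon> y. exp_motions W q F S \<epsilon> y" by blast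
qed

end

section \<open>The Gauss condition and the comparison of the two metrics\<close>

text \<open>Let \<open>J\<close> be the variation field of a family of motions issuing from one point, \<open>K = J'\<close>, and
  suppose that the Gauss condition holds: \<open>h(\<xi>, J) = t c\<close>, and \<open>h(\<xi>, \<xi>)\<close> is constant along each
  motion, which gives the second equation on differentiating in the parameter. The derivative
  of the first equation in \<open>t\<close> minus half of the second one is the Euler-Lagrange expression of
  \<open>h\<close> along the motion, evaluated on \<open>J\<close>. As \<open>J / t\<close> tends to \<open>u\<close>, the expression vanishes on
  \<open>u\<close> at the initial point.\<close>

lemma euler_lagrange_of_gauss:
  fixes x \<xi> J K :: "real \<Rightarrow> 'a::euclidean_space"
  assumes h: "smooth_form S h" and commute: "\<And>y u w. y \<in> S \<Longrightarrow> h y u w = h y w u"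
    and F: "smooth_on (S \<times> UNIV) (\<lambda>p. F (fst p) (snd p))"
    and x: "\<And>t. t \<in> {0..1} \<Longrightarrow> (x has_vector_derivative \<xi> t) (at t within {0..1})"
    and \<xi>: "\<And>t. t \<in> {0..1} \<Longrightarrow> (\<xi> has_vector_derivative F (x t) (\<xi> t)) (at t within {0..1})"
    and J: "\<And>t. t \<in> {0..1} \<Longrightarrow> (J has_vector_derivative K t) (at t within {0..1})"
    and xS: "\<And>t. t \<in> {0..1} \<Longrightarrow> x t \<in> S"
    and J0: "J 0 = 0" and K0: "K 0 = u"
    and gauss: "\<And>t. 0 < t \<Longrightarrow> t < 1 \<Longrightarrow> h (x t) (\<xi> t) (J t) = t * c"
    and speed: "\<And>t. 0 < t \<Longrightarrow> t < 1 \<Longrightarrow>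
      form_derivative h (x t) (J t) (\<xi> t) (\<xi> t) + 2 * h (x t) (K t) (\<xi> t) = 2 * c"
  shows "form_derivative h (x 0) (\<xi> 0) (\<xi> 0) u + h (x 0) (F (x 0) (\<xi> 0)) u
    - 1/2 * form_derivative h (x 0) u (\<xi> 0) (\<xi> 0) = 0"
proof -
  define \<Psi> where "\<Psi> p = form_derivative h (fst p) (fst (snd p)) (fst (snd p)) (snd (snd p))
    + h (fst p) (F (fst p) (fst (snd p))) (snd (snd p))
    - 1/2 * form_derivative h (fst p) (snd (snd p)) (fst (snd p)) (fst (snd p))" for p
  let ?T = "S \<times> (UNIV :: ('a \<times> 'a) set)"
  note S = smooth_form_open[OF h]
  have op: "open ?T" using S by (simp add: open_Times)
  have opS: "open (S \<times> (UNIV :: 'a set))" using S by (simp add: open_Times)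
  note pr = smooth_on_fst[OF op smooth_on_ident[OF op]] smooth_on_fst[OF op smooth_on_snd[OF op smooth_on_ident[OF op]]]
    smooth_on_snd[OF op smooth_on_snd[OF op smooth_on_ident[OF op]]]
  have imS: "fst ` ?T \<subseteq> S" by auto
  have "smooth_on ?T (\<lambda>p. F (fst (fst p, fst (snd p))) (snd (fst p, fst (snd p))))"
    by (rule smooth_on_compose[OF op opS F smooth_on_Pair[OF op pr(1,2)]]) auto
  then have Fsm: "smooth_on ?T (\<lambda>p. F (fst p) (fst (snd p)))" by simp
  have "smooth_on ?T \<Psi>"
    unfolding \<Psi>_def
    by (intro smooth_on_minus[OF op] smooth_on_add[OF op] smooth_on_mult[OF op] smooth_on_const[OF op]
      smooth_on_form_derivative[OF h op pr(1) _ _ _ imS] smooth_on_form[OF h op pr(1) _ _ imS] Fsm pr)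
  then have cont: "isCont \<Psi> (x 0, \<xi> 0, u)"
    using smooth_on_continuous op xS[of 0] continuous_on_eq_continuous_at by fastforce
  have zero: "\<Psi> (x t, \<xi> t, J t /\<^sub>R t) = 0" if t: "0 < t" "t < 1" for t
  proof -
    have ti: "t \<in> {0..1}" "t \<in> interior {0..1::real}" using t by auto
    note at = at_within_interior[OF ti(2)]
    note bl = smooth_form_bilinear[OF h xS[OF ti(1)]] and fl = form_derivative_linear[OF h xS[OF ti(1)]]
    have "((\<lambda>t. h (x t) (\<xi> t) (J t)) has_real_derivative
        (form_derivative h (x t) (\<xi> t) (\<xi> t) (J t) + h (x t) (F (x t) (\<xi> t)) (J t) + h (x t) (\<xi> t) (K t))) (at t)"
      using form_has_real_derivative[OF h x[OF ti(1)] \<xi>[OF ti(1)] J[OF ti(1)] xS[OF ti(1)]] unfolding at .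
    moreover have "((\<lambda>t. h (x t) (\<xi> t) (J t)) has_real_derivative c) (at t)"
    proof (rule has_field_derivative_transform_within)
      show "((\<lambda>t. t * c) has_real_derivative c) (at t)" by (auto intro!: derivative_eq_intros)
      show "0 < min t (1 - t)" using t by simp
      show "s * c = h (x s) (\<xi> s) (J s)" if "dist s t < min t (1 - t)" for s
        using gauss[of s] that by (auto simp: dist_real_def)
    qed simp
    ultimately have "form_derivative h (x t) (\<xi> t) (\<xi> t) (J t) + h (x t) (F (x t) (\<xi> t)) (J t) + h (x t) (\<xi> t) (K t) = c"
      by (rule DERIV_unique)
    then have "form_derivative h (x t) (\<xi> t) (\<xi> t) (J t) + h (x t) (F (x t) (\<xi> t)) (J t)
        - 1/2 * form_derivative h (x t) (J t) (\<xi> t) (\<xi> t) = 0"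
      using speed[OF t] commute[OF xS[OF ti(1)], of "\<xi> t" "K t"] by simp
    then show ?thesis
      using t by (simp add: \<Psi>_def linear_cmul[OF fl(1)] linear_cmul[OF fl(3)] bilinear_rmul[OF bl] field_simps)
  qed
  have at0: "at 0 within {0..1} = at_right (0 :: real)" by (rule at_within_Icc_at_right) simp
  have "(x \<longlongrightarrow> x 0) (at_right 0)" "(\<xi> \<longlongrightarrow> \<xi> 0) (at_right 0)"
    using has_vector_derivative_continuous[OF x[of 0]] has_vector_derivative_continuous[OF \<xi>[of 0]]
    by (simp_all add: continuous_within at0)
  moreover have "((\<lambda>t. J t /\<^sub>R t) \<longlongrightarrow> u) (at_right 0)"
  proof -
    have "((\<lambda>t. (1 / norm (t - 0)) *\<^sub>R (J t - (J 0 + (t - 0) *\<^sub>R K 0))) \<longlongrightarrow> 0) (at_right 0)"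
      using J[of 0] unfolding has_vector_derivative_def has_derivative_within at0 by simp
    moreover have "\<forall>\<^sub>F t in at_right 0. (1 / norm (t - 0)) *\<^sub>R (J t - (J 0 + (t - 0) *\<^sub>R K 0)) = J t /\<^sub>R t - u"
      unfolding eventually_at_right_field
      by (intro exI[of _ 1]) (simp add: J0 K0 scaleR_diff_right divide_inverse)
    ultimately have "((\<lambda>t. J t /\<^sub>R t - u) \<longlongrightarrow> 0) (at_right 0)" by (rule Lim_transform_eventually)
    then show ?thesis by (simp add: Lim_null[of _ u])
  qed
  ultimately have "((\<lambda>t. (x t, \<xi> t, J t /\<^sub>R t)) \<longlongrightarrow> (x 0, \<xi> 0, u)) (at_right 0)"
    by (intro tendsto_Pair)
  then have "((\<lambda>t. \<Psi> (x t, \<xi> t, J t /\<^sub>R t)) \<longlongrightarrow> \<Psi> (x 0, \<xi> 0, u)) (at_right 0)"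
    by (rule isCont_tendsto_compose[OF cont])
  moreover have "\<forall>\<^sub>F t in at_right 0. \<Psi> (x t, \<xi> t, J t /\<^sub>R t) = 0"
    unfolding eventually_at_right_field using zero by (intro exI[of _ 1]) auto
  then have "((\<lambda>t. \<Psi> (x t, \<xi> t, J t /\<^sub>R t)) \<longlongrightarrow> 0) (at_right 0)" by (rule tendsto_eventually)
  ultimately have "\<Psi> (x 0, \<xi> 0, u) = 0"
    using tendsto_unique trivial_limit_at_right_real by blast
  then show ?thesis by (simp add: \<Psi>_def)
qed

context nonholonomic_chart
begin

lemma chart_distribution_closed:
  "v \<in> chart_distribution y \<Longrightarrow> w \<in> chart_distribution y \<Longrightarrow> v + r *\<^sub>R w \<in> chart_distribution y"
  "v \<in> chart_distribution y \<Longrightarrow> r *\<^sub>R v \<in> chart_distribution y"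
  unfolding chart_distribution_def by (auto intro: span_add span_scale)

context
  fixes W q F S \<epsilon> and y :: "'e \<Rightarrow> real \<Rightarrow> 'e \<times> 'e"
  assumes q: "q \<in> U" and motions: "exp_motions W q F S \<epsilon> y"
begin

abbreviation "\<Delta> \<equiv> chart_distribution (\<phi> q)"

lemma motions_spray:
  "smooth_on (\<phi> ` U \<times> UNIV) (\<lambda>p. F (fst p) (snd p))" "x \<in> \<phi> ` U \<Longrightarrow> F x (r *\<^sub>R \<xi>) = r\<^sup>2 *\<^sub>R F x \<xi>"
  "compact S" "convex S" "S \<subseteq> \<phi> ` U \<times> UNIV" "r \<in> {0..1} \<Longrightarrow> (x, \<xi>) \<in> S \<Longrightarrow> (x, r *\<^sub>R \<xi>) \<in> S" "0 < \<epsilon>"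
  using motions unfolding exp_motions_def by auto

lemma motions_exp:
  assumes "w \<in> \<Delta>" "norm w < \<epsilon>"
  shows "cvec q w \<in> W q" "nh_exp A D \<Gamma> q (cvec q w) \<in> U" "\<phi> (nh_exp A D \<Gamma> q (cvec q w)) = fst (y w 1)" "y w 0 = (\<phi> q, w)"
  using motions assms unfolding exp_motions_def exp_motion_def by blast+

lemma motions_solution:
  assumes "w \<in> \<Delta>" "norm w < \<epsilon>" "t \<in> {0..1}"
  shows "(y w has_vector_derivative (snd (y w t), F (fst (y w t)) (snd (y w t)))) (at t within {0..1})"
    "y w t \<in> S" "fst (y w t) \<in> \<phi> ` U"
  using motions assms motions_spray(5) unfolding exp_motions_def exp_motion_def by (blast, blast, fastforce)

lemma spray_smooth: "smooth_on (\<phi> ` U \<times> UNIV) (\<lambda>p. (snd p, F (fst p) (snd p)))"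
  and spray_open: "open (\<phi> ` U \<times> (UNIV :: 'e set))"
proof -
  show op: "open (\<phi> ` U \<times> (UNIV :: 'e set))" using open_image by (simp add: open_Times)
  show "smooth_on (\<phi> ` U \<times> UNIV) (\<lambda>p. (snd p, F (fst p) (snd p)))"
    by (intro smooth_on_Pair[OF op] smooth_on_snd[OF op] smooth_on_ident[OF op] motions_spray(1))
qed

text \<open>A quadratic equation is invariant under rescaling of time, so \<open>exp (t w)\<close> runs through the
  motion with initial velocity \<open>w\<close>.\<close>

lemma motions_scaling:
  assumes w: "w \<in> \<Delta>" "norm w < \<epsilon>" and t: "t \<in> {0..1}"
  shows "fst (y (t *\<^sub>R w) 1) = fst (y w t)"
proof -
  have tw: "t *\<^sub>R w \<in> \<Delta>" "norm (t *\<^sub>R w) < \<epsilon>"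
    using chart_distribution_closed(2)[OF w(1)] w(2) t mult_left_le_one_le[of "norm w" t] by auto
  let ?z = "\<lambda>s. (fst (y w (t * s)), t *\<^sub>R snd (y w (t * s)))"
  have ts: "t * s \<in> {0..1}" if "s \<in> {0..1}" for s
    using that t by (auto intro: mult_le_one)
  have "y (t *\<^sub>R w) 1 = ?z 1"
  proof (rule ode_solution_unique[OF spray_open spray_smooth motions_spray(3-5), where T = 1 and x = ?z])
    fix s :: real assume s: "s \<in> {0..1}"
    show "(y (t *\<^sub>R w) has_vector_derivative (snd (y (t *\<^sub>R w) s), F (fst (y (t *\<^sub>R w) s)) (snd (y (t *\<^sub>R w) s)))) (at s within {0..1}) \<and>
        y (t *\<^sub>R w) s \<in> S"
      using motions_solution[OF tw s] by blast
    note sol = motions_solution[OF w ts[OF s]]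
    have "((\<lambda>s. t * s) has_vector_derivative t) (at s within {0..1})"
      by (auto intro!: derivative_eq_intros simp: has_real_derivative_iff_has_vector_derivative[symmetric])
    moreover have "(y w has_vector_derivative (snd (y w (t * s)), F (fst (y w (t * s))) (snd (y w (t * s)))))
        (at (t * s) within (\<lambda>s. t * s) ` {0..1})"
      by (rule has_vector_derivative_within_subset[OF sol(1)]) (use ts in auto)
    ultimately have "((y w \<circ> (\<lambda>s. t * s)) has_vector_derivative
        t *\<^sub>R (snd (y w (t * s)), F (fst (y w (t * s))) (snd (y w (t * s))))) (at s within {0..1})"
      by (rule vector_diff_chain_within)
    then have d: "((\<lambda>s. y w (t * s)) has_derivative
        (\<lambda>h. h *\<^sub>R t *\<^sub>R (snd (y w (t * s)), F (fst (y w (t * s))) (snd (y w (t * s)))))) (at s within {0..1})"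
      by (simp add: comp_def has_vector_derivative_def)
    have "(?z has_derivative (\<lambda>h. (fst (h *\<^sub>R t *\<^sub>R (snd (y w (t * s)), F (fst (y w (t * s))) (snd (y w (t * s))))),
        t *\<^sub>R snd (h *\<^sub>R t *\<^sub>R (snd (y w (t * s)), F (fst (y w (t * s))) (snd (y w (t * s)))))))) (at s within {0..1})"
      by (intro has_derivative_Pair has_derivative_scaleR_right has_derivative_fst has_derivative_snd d)
    moreover have "F (fst (y w (t * s))) (t *\<^sub>R snd (y w (t * s))) = t\<^sup>2 *\<^sub>R F (fst (y w (t * s))) (snd (y w (t * s)))"
      by (rule motions_spray(2)[OF sol(3)])
    ultimately show "(?z has_vector_derivative (snd (?z s), F (fst (?z s)) (snd (?z s)))) (at s within {0..1}) \<and> ?z s \<in> S"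
      using motions_spray(6)[OF t, of "fst (y w (t * s))" "snd (y w (t * s))"] sol(2)
      by (simp add: has_vector_derivative_def power2_eq_square mult.assoc mult.left_commute)
  qed (use motions_exp(4)[OF w] motions_exp(4)[OF tw] in auto)
  then show ?thesis by simp
qed

text \<open>A tangent vector of the exponential map is represented by a line of initial velocities, so it is
  computed by differentiating end points of motions along that line.\<close>

lemma tangent_exp:
  assumes w: "w \<in> \<Delta>" "norm w < \<epsilon>" and u: "u \<in> \<Delta>"
    and der: "((\<lambda>s. fst (y (w + s *\<^sub>R u) 1)) has_vector_derivative h) (at 0)"
  shows "tangent_nh_exp A D \<Gamma> q (cvec q w) (cvec q u) = cvec (nh_exp A D \<Gamma> q (cvec q w)) h"
proof -
  have "((\<lambda>s. w + s *\<^sub>R u) \<longlongrightarrow> w + 0 *\<^sub>R u) (nhds 0)" by (intro tendsto_intros filterlim_ident)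
  then have "((\<lambda>s. norm (w + s *\<^sub>R u)) \<longlongrightarrow> norm w) (nhds 0)" using tendsto_norm by fastforce
  then have near: "\<forall>\<^sub>F s in nhds 0. norm (w + s *\<^sub>R u) < \<epsilon>" using w(2) by (rule order_tendstoD)
  let ?c = "\<lambda>s. nh_exp A D \<Gamma> q (add_scaled (cvec q w) s (cvec q u))"
  have c: "?c s = nh_exp A D \<Gamma> q (cvec q (w + s *\<^sub>R u))" for s by (simp add: add_scaled_cvec[OF q])
  have ev: "\<forall>\<^sub>F s in nhds 0. ?c s \<in> U \<and> \<phi> (?c s) = fst (y (w + s *\<^sub>R u) 1)"
    using near by eventually_elim (use motions_exp(2,3)[OF chart_distribution_closed(1)[OF w(1) u]] in \<open>simp add: c\<close>)
  have "((\<lambda>s. \<phi> (?c s)) has_vector_derivative h) (at 0)"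
    unfolding has_vector_derivative_def
    by (rule has_derivative_transform_eventually[OF der[unfolded has_vector_derivative_def]])
      (use ev eventually_nhds_x_imp_x[OF ev] in \<open>auto simp: eventually_nhds_conv_at elim: eventually_mono\<close>)
  from velocity_chart[OF this] ev show ?thesis
    unfolding tangent_nh_exp_def by (simp add: c eventually_conj_iff)
qed

lemma norm_scaled_less: "norm w < \<epsilon> \<Longrightarrow> t \<in> {0..1} \<Longrightarrow> norm (t *\<^sub>R w) < \<epsilon>"
  using mult_left_le_one_le[of "norm w" t] by auto

text \<open>On the ray through \<open>w\<close> the exponential map is the motion itself.\<close>

lemma tangent_exp_radial:
  assumes w: "w \<in> \<Delta>" "norm w < \<epsilon>" and t: "0 < t" "t < 1"
  shows "tangent_nh_exp A D \<Gamma> q (cvec q (t *\<^sub>R w)) (cvec q (t *\<^sub>R w)) =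
    cvec (nh_exp A D \<Gamma> q (cvec q (t *\<^sub>R w))) (t *\<^sub>R snd (y w t))"
proof (rule tangent_exp)
  show "t *\<^sub>R w \<in> \<Delta>" "t *\<^sub>R w \<in> \<Delta>" by (rule chart_distribution_closed(2)[OF w(1)])+
  show "norm (t *\<^sub>R w) < \<epsilon>" using norm_scaled_less[OF w(2)] t by simp
  have ti: "t \<in> {0..1}" "t \<in> interior {0..1::real}" using t by auto
  have "((\<lambda>t. fst (y w t)) has_derivative (\<lambda>h. h *\<^sub>R snd (y w t))) (at t)"
    using has_derivative_fst[OF motions_solution(1)[OF w ti(1), unfolded has_vector_derivative_def]]
    by (simp add: at_within_interior[OF ti(2)])
  moreover have "((\<lambda>s. t + s * t) has_derivative (\<lambda>h. h * t)) (at 0)" by (auto intro!: derivative_eq_intros)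
  ultimately have "((\<lambda>s. fst (y w (t + s * t))) has_derivative (\<lambda>h. (h * t) *\<^sub>R snd (y w t))) (at 0)"
    using has_derivative_compose[of "\<lambda>s. t + s * t" "\<lambda>h. h * t" 0 UNIV "\<lambda>t. fst (y w t)"] by simp
  then have "((\<lambda>s. fst (y (t *\<^sub>R w + s *\<^sub>R t *\<^sub>R w) 1)) has_derivative (\<lambda>h. (h * t) *\<^sub>R snd (y w t))) (at 0)"
  proof (rule has_derivative_transform_within_open[where s = "ball 0 (1 - t)"])
    show "fst (y w (t + s * t)) = fst (y (t *\<^sub>R w + s *\<^sub>R t *\<^sub>R w) 1)" if "s \<in> ball 0 (1 - t)" for s
    proof -
      have s: "\<bar>s\<bar> < 1 - t" using that by simp
      have "\<bar>s * t\<bar> \<le> \<bar>s\<bar>" using t by (simp add: abs_mult mult_left_le)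
      moreover have "0 \<le> (1 + s) * t" using s t by (intro mult_nonneg_nonneg) auto
      ultimately have "t + s * t \<in> {0..1}" using s by (auto simp: algebra_simps)
      from motions_scaling[OF w this] show ?thesis by (simp add: scaleR_add_left)
    qed
  qed (use t in auto)
  then show "((\<lambda>s. fst (y (t *\<^sub>R w + s *\<^sub>R t *\<^sub>R w) 1)) has_vector_derivative t *\<^sub>R snd (y w t)) (at 0)"
    by (simp add: has_vector_derivative_def)
qed

text \<open>Motions are given for positive times only. So the derivative of \<open>exp (s u)\<close> at \<open>s = 0\<close> is pieced together from two
  one-sided ones, obtained from the motions with initial velocities \<open>r u\<close> and \<open>- r u\<close>, where \<open>r\<close> makes them short
  enough.\<close>

lemma tangent_exp_zero:
  assumes u: "u \<in> \<Delta>"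
  shows "tangent_nh_exp A D \<Gamma> q zero_vector (cvec q u) = cvec (nh_exp A D \<Gamma> q zero_vector) u"
proof -
  obtain r where r: "r > 0" "norm (r *\<^sub>R u) < \<epsilon>"
  proof
    show "0 < \<epsilon> / (norm u + 1)" using motions_spray(7) by (simp add: add_nonneg_pos)
    have "norm u * \<epsilon> < \<epsilon> * (norm u + 1)" using motions_spray(7) by (simp add: algebra_simps)
    then show "norm ((\<epsilon> / (norm u + 1)) *\<^sub>R u) < \<epsilon>"
      using motions_spray(7) by (simp add: divide_less_eq add_nonneg_pos mult.commute)
  qed
  have one_sided: "((\<lambda>s. fst (y (s *\<^sub>R u) 1)) has_vector_derivative u) (at 0 within {0..r})"
    if r: "norm (r *\<^sub>R u) < \<epsilon>" "r > 0" and u: "u \<in> \<Delta>" for u r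
  proof -
    have ru: "r *\<^sub>R u \<in> \<Delta>" by (rule chart_distribution_closed(2)[OF u])
    have im: "(\<lambda>s. s / r) ` {0..r} = {0..1}"
      using r(2) by (auto simp: image_iff intro!: bexI[of _ "_ * r"])
    have d: "((\<lambda>t. fst (y (r *\<^sub>R u) t)) has_derivative (\<lambda>h. h *\<^sub>R r *\<^sub>R u)) (at (0 / r) within (\<lambda>s. s / r) ` {0..r})"
      using has_derivative_fst[OF motions_solution(1)[OF ru r(1), of 0, unfolded has_vector_derivative_def]]
      by (simp add: motions_exp(4)[OF ru r(1)] im)
    have "((\<lambda>s. s / r) has_derivative (\<lambda>h. h / r)) (at 0 within {0..r})"
      by (intro bounded_linear_imp_has_derivative bounded_linear_divide)
    from has_derivative_in_compose[OF this d]
    have "((\<lambda>s. fst (y (r *\<^sub>R u) (s / r))) has_derivative (\<lambda>h. h *\<^sub>R u)) (at 0 within {0..r})"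
      using r(2) by simp
    then have "((\<lambda>s. fst (y (s *\<^sub>R u) 1)) has_derivative (\<lambda>h. h *\<^sub>R u)) (at 0 within {0..r})"
    proof (rule has_derivative_transform[rotated 2])
      show "fst (y (s *\<^sub>R u) 1) = fst (y (r *\<^sub>R u) (s / r))" if "s \<in> {0..r}" for s
        using motions_scaling[OF ru r(1), of "s / r"] that r(2) by simp
    qed (use r(2) in auto)
    then show ?thesis by (simp add: has_vector_derivative_def)
  qed
  let ?f = "\<lambda>s. fst (y (s *\<^sub>R u) 1)"
  have mu: "- u \<in> \<Delta>" using chart_distribution_closed(2)[OF u, of "-1"] by simp
  have "((\<lambda>s. fst (y (s *\<^sub>R - u) 1)) has_vector_derivative - u) (at 0 within {0..r})"
    by (rule one_sided[OF _ r(1) mu]) (use r(2) in simp)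
  moreover have "(uminus has_vector_derivative - 1) (at (0::real) within {-r..0})"
    by (auto intro!: derivative_eq_intros)
  moreover have "uminus ` {-r..0} = {0..r}" by auto
  ultimately have "(((\<lambda>s. fst (y (s *\<^sub>R - u) 1)) \<circ> uminus) has_vector_derivative (- 1) *\<^sub>R (- u)) (at 0 within {-r..0})"
    by (intro vector_diff_chain_within) auto
  then have "(?f has_vector_derivative u) (at 0 within {-r..0})" by (simp add: comp_def)
  then have "(?f has_derivative (\<lambda>h. h *\<^sub>R u)) (at 0 within {-r..0} \<union> {0..r})"
    using one_sided[OF r(2,1) u] unfolding has_vector_derivative_def
    by (simp add: has_derivative_within Lim_within_Un)
  moreover have "{-r..0} \<union> {0..r} = {-r..r}" using r(1) by auto
  moreover have "at 0 within {-r..r} = at 0" using r(1) by (intro at_within_interior) auto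
  ultimately have "(?f has_vector_derivative u) (at 0)" by (simp add: has_vector_derivative_def)
  then have "((\<lambda>s. fst (y (0 + s *\<^sub>R u) 1)) has_vector_derivative u) (at 0)" by simp
  moreover have "0 \<in> \<Delta>" by (simp add: chart_distribution_def span_zero)
  ultimately show ?thesis
    unfolding zero_vector_cvec[OF q] using tangent_exp[of 0 u u] u motions_spray(7) by simp
qed


lemma exp_zero: "nh_exp A D \<Gamma> q zero_vector = q"
proof -
  have 0: "0 \<in> \<Delta>" "norm (0 :: 'e) < \<epsilon>" using motions_spray(7) by (simp_all add: chart_distribution_def span_zero)
  have "fst (y 0 1) = \<phi> q" using motions_scaling[OF 0, of 0] motions_exp(4)[OF 0] by simp
  then have "\<phi> (nh_exp A D \<Gamma> q (cvec q 0)) = \<phi> q" using motions_exp(3)[OF 0] by simp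
  then show ?thesis
    using inj_onD[OF inj _ motions_exp(2)[OF 0] q] by (simp add: zero_vector_cvec[OF q])
qed

lemma pullback_zero:
  assumes "w \<in> \<Delta>" "u \<in> \<Delta>"
  shows "nh_exp_pullback A D \<Gamma> h q zero_vector (cvec q w) (cvec q u) = chart_metric h (\<phi> q) w u"
  by (simp add: nh_exp_pullback_def tangent_exp_zero assms exp_zero chart_metric_def chart_inv[OF q])

lemma pullback_radial:
  assumes w: "w \<in> \<Delta>" "norm w < \<epsilon>" and t: "0 < t" "t < 1"
    and u: "tangent_nh_exp A D \<Gamma> q (cvec q (t *\<^sub>R w)) u = cvec (nh_exp A D \<Gamma> q (cvec q (t *\<^sub>R w))) k"
  shows "nh_exp_pullback A D \<Gamma> h q (cvec q (t *\<^sub>R w)) (cvec q (t *\<^sub>R w)) u =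
    chart_metric h (fst (y w t)) (t *\<^sub>R snd (y w t)) k"
proof -
  have tw: "t *\<^sub>R w \<in> \<Delta>" "norm (t *\<^sub>R w) < \<epsilon>"
    using chart_distribution_closed(2)[OF w(1)] norm_scaled_less[OF w(2)] t by simp_all
  have "fst (y w t) = \<phi> (nh_exp A D \<Gamma> q (cvec q (t *\<^sub>R w)))"
    using motions_scaling[OF w, of t] motions_exp(3)[OF tw] t by simp
  then show ?thesis
    by (simp add: nh_exp_pullback_def tangent_exp_radial[OF w t] u chart_metric_def chart_inv[OF motions_exp(2)[OF tw]])
qed

text \<open>For \<open>w + s u\<close> close to \<open>w\<close> the motions form a differentiable family in \<open>s\<close>. The tangent map
  of the exponential map at \<open>t w\<close> sends \<open>u\<close> to \<open>J t / t\<close>, where \<open>J\<close> is the variation field.\<close>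

lemma gauss_imp_euler_lagrange:
  assumes h: "riemannian_metric A h"
    and gauss: "\<And>v u. v \<in> W q \<Longrightarrow> u \<in> D q \<Longrightarrow>
      nh_exp_pullback A D \<Gamma> h q v v u = nh_exp_pullback A D \<Gamma> h q zero_vector v u"
    and w: "w \<in> \<Delta>" "norm w < \<epsilon>" and u: "u \<in> \<Delta>"
  defines "H \<equiv> chart_metric h"
  shows "form_derivative H (\<phi> q) w w u + H (\<phi> q) (F (\<phi> q) w) u - 1/2 * form_derivative H (\<phi> q) u w w = 0"
proof -
  note H = chart_metric_smooth_form[OF h, folded H_def] and Hc = chart_metric_commute[OF h, folded H_def]
  have \<phi>q: "\<phi> q \<in> \<phi> ` U" using q by simp
  have bq: "bilinear (H (\<phi> q))" by (rule smooth_form_bilinear[OF H \<phi>q])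
  let ?Gf = "\<lambda>p. (snd p, F (fst p) (snd p))"
  \<comment> \<open>All velocities \<open>w + s u\<close> with \<open>|s| < \<delta>\<close> are shorter than \<open>\<epsilon>\<close>.\<close>
  define \<delta> where "\<delta> = (\<epsilon> - norm w) / (norm u + 1)"
  have \<delta>: "0 < \<delta>" using w(2) by (simp add: \<delta>_def add_nonneg_pos)
  have ws: "w + s *\<^sub>R u \<in> \<Delta>" "norm (w + s *\<^sub>R u) < \<epsilon>" if "\<bar>s\<bar> < \<delta>" for s
  proof -
    show "w + s *\<^sub>R u \<in> \<Delta>" by (rule chart_distribution_closed(1)[OF w(1) u])
    have "\<bar>s\<bar> * (norm u + 1) < \<epsilon> - norm w" using that by (simp add: \<delta>_def less_divide_eq add_nonneg_pos)
    then have "norm w + norm (s *\<^sub>R u) < \<epsilon>" by (simp add: algebra_simps)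
    then show "norm (w + s *\<^sub>R u) < \<epsilon>" using norm_triangle_ineq[of w "s *\<^sub>R u"] by linarith
  qed
  have "\<exists>z. z 0 = (0, u) \<and> (\<forall>t\<in>{0..1}.
      (z has_vector_derivative \<D> ?Gf (y (w + 0 *\<^sub>R u) t) (z t)) (at t within {0..1}) \<and>
      ((\<lambda>s. y (w + s *\<^sub>R u) t) has_vector_derivative z t) (at 0))"
  proof (rule ode_solution_variation[OF spray_open spray_smooth motions_spray(3-5) \<delta>])
    show "(y (w + s *\<^sub>R u) has_vector_derivative ?Gf (y (w + s *\<^sub>R u) t)) (at t within {0..1}) \<and> y (w + s *\<^sub>R u) t \<in> S"
      if "\<bar>s\<bar> < \<delta>" "t \<in> {0..1}" for s t
      using motions_solution[OF ws[OF that(1)] that(2)] by blast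
    show "y (w + s *\<^sub>R u) 0 = y (w + 0 *\<^sub>R u) 0 + s *\<^sub>R (0, u)" if "\<bar>s\<bar> < \<delta>" for s
      using motions_exp(4)[OF ws[OF that]] motions_exp(4)[OF w] by simp
  qed
  then obtain z where z0: "z 0 = (0, u)"
    and z1: "\<And>t. t \<in> {0..1} \<Longrightarrow> (z has_vector_derivative \<D> ?Gf (y w t) (z t)) (at t within {0..1})"
    and z2: "\<And>t. t \<in> {0..1} \<Longrightarrow> ((\<lambda>s. y (w + s *\<^sub>R u) t) has_vector_derivative z t) (at 0)"
    by auto
  define x \<xi> J K where "x t = fst (y w t)" "\<xi> t = snd (y w t)" "J t = fst (z t)" "K t = snd (z t)" for t
  note defs = x_\<xi>_J_K_def
  have fst_snd: "((\<lambda>t. fst (c t)) has_vector_derivative fst c') Fl" "((\<lambda>t. snd (c t)) has_vector_derivative snd c') Fl"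
    if "(c has_vector_derivative c') Fl" for c :: "real \<Rightarrow> 'e \<times> 'e" and c' Fl
    using that has_derivative_fst[of c "\<lambda>h. h *\<^sub>R c'" Fl] has_derivative_snd[of c "\<lambda>h. h *\<^sub>R c'" Fl]
    by (simp_all add: has_vector_derivative_def)
  have dJ: "(J has_vector_derivative K t) (at t within {0..1})" if t: "t \<in> {0..1}" for t
  proof -
    have "y w t \<in> \<phi> ` U \<times> UNIV" using motions_solution(3)[OF w t] by (simp add: mem_Times_iff)
    from has_derivative_fst[OF smooth_on_has_derivative[OF spray_smooth this]]
    have "(snd has_derivative (\<lambda>h. fst (\<D> ?Gf (y w t) h))) (at (y w t))" by simp
    from fun_cong[OF has_derivative_unique[OF this has_derivative_snd[OF has_derivative_ident]], of "z t"]
    have "fst (\<D> ?Gf (y w t) (z t)) = K t" by (simp add: defs)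
    then show ?thesis using fst_snd(1)[OF z1[OF t]] by (simp add: defs[abs_def])
  qed
  have xU: "x t \<in> \<phi> ` U" if "t \<in> {0..1}" for t using motions_solution(3)[OF w that] by (simp add: defs)
  have E1: "H (x t) (\<xi> t) (J t) = t * H (\<phi> q) w u" if t: "0 < t" "t < 1" for t
  proof -
    have ti: "t \<in> {0..1}" using t by simp
    have tw: "t *\<^sub>R w \<in> \<Delta>" "norm (t *\<^sub>R w) < \<epsilon>"
      using chart_distribution_closed(2)[OF w(1)] norm_scaled_less[OF w(2) ti] by auto
    have "((\<lambda>s. fst (y (w + s *\<^sub>R u) t)) has_derivative (\<lambda>h. h *\<^sub>R J t)) (at 0)"
      using fst_snd(1)[OF z2[OF ti]] by (simp add: has_vector_derivative_def defs)
    moreover have "((\<lambda>s. s / t) has_derivative (\<lambda>h. h / t)) (at 0)"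
      by (intro bounded_linear_imp_has_derivative bounded_linear_divide)
    ultimately have "((\<lambda>s. fst (y (w + (s / t) *\<^sub>R u) t)) has_derivative (\<lambda>h. (h / t) *\<^sub>R J t)) (at 0)"
      using has_derivative_compose[of "\<lambda>s. s / t" "\<lambda>h. h / t" 0 UNIV "\<lambda>s. fst (y (w + s *\<^sub>R u) t)"] by simp
    then have "((\<lambda>s. fst (y (t *\<^sub>R w + s *\<^sub>R u) 1)) has_derivative (\<lambda>h. (h / t) *\<^sub>R J t)) (at 0)"
    proof (rule has_derivative_transform_within_open[where s = "ball 0 (t * \<delta>)"])
      show "fst (y (w + (s / t) *\<^sub>R u) t) = fst (y (t *\<^sub>R w + s *\<^sub>R u) 1)" if "s \<in> ball 0 (t * \<delta>)" for s
      proof -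
        have "\<bar>s / t\<bar> < \<delta>" using that t(1) by (simp add: divide_less_eq mult.commute)
        from motions_scaling[OF ws[OF this] ti] show ?thesis using t(1) by (simp add: scaleR_add_right)
      qed
    qed (use t \<delta> in auto)
    then have "((\<lambda>s. fst (y (t *\<^sub>R w + s *\<^sub>R u) 1)) has_vector_derivative (1 / t) *\<^sub>R J t) (at 0)"
      by (simp add: has_vector_derivative_def)
    from tangent_exp[OF tw u this]
    have "nh_exp_pullback A D \<Gamma> h q (cvec q (t *\<^sub>R w)) (cvec q (t *\<^sub>R w)) (cvec q u) = H (x t) (t *\<^sub>R \<xi> t) ((1 / t) *\<^sub>R J t)"
      by (simp add: pullback_radial[OF w t] H_def defs)
    also have "\<dots> = H (x t) (\<xi> t) (J t)"
      using smooth_form_bilinear[OF H xU[OF ti]] t(1) by (simp add: bilinear_lmul bilinear_rmul)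
    finally have "H (x t) (\<xi> t) (J t) = nh_exp_pullback A D \<Gamma> h q zero_vector (cvec q (t *\<^sub>R w)) (cvec q u)"
      using gauss[OF motions_exp(1)[OF tw] cvec_in_distribution[OF q u]] by simp
    also have "\<dots> = H (\<phi> q) (t *\<^sub>R w) u" unfolding H_def by (rule pullback_zero[OF tw(1) u])
    finally show ?thesis by (simp add: bilinear_lmul[OF bq])
  qed
  have speed: "H (fst (y w' t)) (snd (y w' t)) (snd (y w' t)) = H (\<phi> q) w' w'"
    if w': "w' \<in> \<Delta>" "norm w' < \<epsilon>" and t: "0 < t" "t < 1" for w' t
  proof -
    have ti: "t \<in> {0..1}" using t by simp
    have tw: "t *\<^sub>R w' \<in> \<Delta>" "norm (t *\<^sub>R w') < \<epsilon>"
      using chart_distribution_closed(2)[OF w'(1)] norm_scaled_less[OF w'(2) ti] by auto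
    have "H (fst (y w' t)) (t *\<^sub>R snd (y w' t)) (t *\<^sub>R snd (y w' t)) = H (\<phi> q) (t *\<^sub>R w') (t *\<^sub>R w')"
      using gauss[OF motions_exp(1)[OF tw] cvec_in_distribution[OF q tw(1)]]
      unfolding pullback_radial[OF w' t tangent_exp_radial[OF w' t]] pullback_zero[OF tw(1) tw(1)] H_def .
    then show ?thesis
      using smooth_form_bilinear[OF H motions_solution(3)[OF w' ti]] bq t(1)
      by (simp add: bilinear_lmul bilinear_rmul)
  qed
  have E2: "form_derivative H (x t) (J t) (\<xi> t) (\<xi> t) + 2 * H (x t) (K t) (\<xi> t) = 2 * H (\<phi> q) w u"
    if t: "0 < t" "t < 1" for t
  proof -
    have ti: "t \<in> {0..1}" using t by simp
    have ds: "((\<lambda>s. fst (y (w + s *\<^sub>R u) t)) has_vector_derivative J t) (at 0)"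
      "((\<lambda>s. snd (y (w + s *\<^sub>R u) t)) has_vector_derivative K t) (at 0)"
      using fst_snd[OF z2[OF ti]] by (simp_all add: defs)
    have "((\<lambda>s. H (fst (y (w + s *\<^sub>R u) t)) (snd (y (w + s *\<^sub>R u) t)) (snd (y (w + s *\<^sub>R u) t))) has_real_derivative
        (form_derivative H (x t) (J t) (\<xi> t) (\<xi> t) + H (x t) (K t) (\<xi> t) + H (x t) (\<xi> t) (K t))) (at 0)"
      using form_has_real_derivative[OF H ds(1) ds(2) ds(2)] xU[OF ti] by (simp add: defs)
    moreover have "((\<lambda>s. H (fst (y (w + s *\<^sub>R u) t)) (snd (y (w + s *\<^sub>R u) t)) (snd (y (w + s *\<^sub>R u) t))) has_real_derivative
        (2 * H (\<phi> q) w u)) (at 0)"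
    proof (rule has_field_derivative_transform_within[OF _ \<delta>])
      have dl: "((\<lambda>s. w + s *\<^sub>R u) has_vector_derivative u) (at 0)" by (auto intro!: derivative_eq_intros)
      show "((\<lambda>s. H (\<phi> q) (w + s *\<^sub>R u) (w + s *\<^sub>R u)) has_real_derivative 2 * H (\<phi> q) w u) (at 0)"
        using form_has_real_derivative[OF H has_vector_derivative_const dl dl, of "\<phi> q"] \<phi>q Hc[OF \<phi>q, of u w]
          linear_0[OF form_derivative_linear(1)[OF H \<phi>q]] by simp
      show "H (\<phi> q) (w + s *\<^sub>R u) (w + s *\<^sub>R u) =
          H (fst (y (w + s *\<^sub>R u) t)) (snd (y (w + s *\<^sub>R u) t)) (snd (y (w + s *\<^sub>R u) t))" if "dist s 0 < \<delta>" for s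
        using speed[OF ws[of s] t] that by simp
    qed simp
    ultimately have "form_derivative H (x t) (J t) (\<xi> t) (\<xi> t) + H (x t) (K t) (\<xi> t) + H (x t) (\<xi> t) (K t) = 2 * H (\<phi> q) w u"
      by (rule DERIV_unique)
    then show ?thesis using Hc[OF xU[OF ti], of "\<xi> t" "K t"] by simp
  qed
  have "form_derivative H (x 0) (\<xi> 0) (\<xi> 0) u + H (x 0) (F (x 0) (\<xi> 0)) u - 1/2 * form_derivative H (x 0) u (\<xi> 0) (\<xi> 0) = 0"
  proof (rule euler_lagrange_of_gauss[OF H Hc motions_spray(1) _ _ dJ xU _ _ E1 E2])
    fix t :: real assume t: "t \<in> {0..1}"
    show "(x has_vector_derivative \<xi> t) (at t within {0..1})" "(\<xi> has_vector_derivative F (x t) (\<xi> t)) (at t within {0..1})"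
      using fst_snd[OF motions_solution(1)[OF w t]] by (simp_all add: defs[abs_def])
  qed (use z0 in \<open>auto simp: defs\<close>)
  then show ?thesis by (simp add: defs motions_exp(4)[OF w])
qed

end


lemma bracket_chart:
  assumes R: "structure_functions A X R" and q: "q \<in> U" and ab: "a < DIM('e)" "b < DIM('e)"
  shows "\<D> (E b) (\<phi> q) (E a (\<phi> q)) - \<D> (E a) (\<phi> q) (E b (\<phi> q)) =
    (\<Sum>\<gamma><DIM('e). R \<gamma> a b q *\<^sub>R E \<gamma> (\<phi> q))"
proof (rule euclidean_eqI)
  fix i :: 'e assume i: "i \<in> Basis"
  let ?f = "\<lambda>x. \<phi> x \<bullet> i"
  have der: "X a q (\<lambda>x. X b x ?f) = \<D> (E b) (\<phi> q) (E a (\<phi> q)) \<bullet> i"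
    if a: "a < DIM('e)" and b: "b < DIM('e)" for a b
  proof -
    have d: "(E b has_derivative \<D> (E b) (\<phi> q)) (at (\<phi> q))"
      using smooth_on_has_derivative[OF frame_smooth[OF b]] q by blast
    have sm: "smooth_on (\<phi> ` U) (\<lambda>y. E b y \<bullet> i)"
      using open_image by (intro smooth_on_inner frame_smooth[OF b] smooth_on_const)
    have "X a q = cvec q (E a (\<phi> q))"
      using cvec_coord[OF q frame_tangent[OF q a]] coord_frame[OF q, of a] by simp
    moreover have "cvec q (E a (\<phi> q)) (\<lambda>x. X b x ?f) = \<D> (\<lambda>y. E b y \<bullet> i) (\<phi> q) (E a (\<phi> q))"
      by (rule smooth_near_chartI(2)[OF q open_image _ sm])
        (use q in \<open>auto simp: chart_field_def coordinate_vector_inner[OF i]\<close>)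
    moreover have "\<D> (\<lambda>y. E b y \<bullet> i) (\<phi> q) (E a (\<phi> q)) = \<D> (E b) (\<phi> q) (E a (\<phi> q)) \<bullet> i"
      using fun_cong[OF frechet_derivative_at[OF has_derivative_inner_left[OF d, of i]]] by metis
    ultimately show ?thesis by simp
  qed
  have "(\<D> (E b) (\<phi> q) (E a (\<phi> q)) - \<D> (E a) (\<phi> q) (E b (\<phi> q))) \<bullet> i =
      lie_bracket A (X a) (X b) q ?f"
    unfolding lie_bracket_def using smooth_near_coordinate[OF q] der ab by (simp add: inner_diff_left)
  also have "\<dots> = lincomb {..<DIM('e)} (\<lambda>\<gamma>. R \<gamma> a b q) X q ?f"
    using R ab in_carrier[OF q] unfolding structure_functions_def by metis
  also have "\<dots> = (\<Sum>\<gamma><DIM('e). R \<gamma> a b q *\<^sub>R E \<gamma> (\<phi> q)) \<bullet> i"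
    by (simp add: lincomb_def inner_sum_left coord_frame[OF q, symmetric] coordinate_vector_inner[OF i])
  finally show "(\<D> (E b) (\<phi> q) (E a (\<phi> q)) - \<D> (E a) (\<phi> q) (E b (\<phi> q))) \<bullet> i =
      (\<Sum>\<gamma><DIM('e). R \<gamma> a b q *\<^sub>R E \<gamma> (\<phi> q)) \<bullet> i" .
qed

lemma frame_orthogonal:
  assumes q: "q \<in> U" and k: "m \<le> k" "k < DIM('e)" and w: "w \<in> chart_distribution (\<phi> q)"
  shows "G (\<phi> q) w (E k (\<phi> q)) = 0"
proof -
  have "X k q = lincomb {m..<DIM('e)} (\<lambda>a. if a = k then 1 else 0) X q"
    using k by (simp add: lincomb_def fun_eq_iff if_distrib[of "\<lambda>x. x * _"] cong: if_cong)
  then have "X k q \<in> orthogonal_distribution A g D q"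
    using frame in_carrier[OF q] unfolding adapted_frame_def by blast
  then have "g q (X k q) (cvec q w) = 0"
    using cvec_in_distribution[OF q w] unfolding orthogonal_distribution_def by blast
  then show ?thesis
    using metric_chart[OF q frame_tangent[OF q k(2)] cvec_in_tangent_space[OF q, of w], of g]
      chart_metric_commute[OF metric, of "\<phi> q"] q
    by (simp add: coord_frame[OF q] coord_cvec[OF q])
qed

lemma frame_in_distribution: "a < m \<Longrightarrow> E a y \<in> chart_distribution y"
  unfolding chart_distribution_def by (intro span_base) auto

lemma modification_chart:
  assumes "preserving_modification A D g h" "y \<in> \<phi> ` U" "u \<in> chart_distribution y" "w \<in> chart_distribution y"
  shows "chart_metric h y u w = G y u w"
proof -
  obtain q where q: "q \<in> U" "y = \<phi> q" using assms(2) by blast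
  then show ?thesis
    using assms in_carrier[OF q(1)] cvec_in_distribution[OF q(1)]
    unfolding preserving_modification_def chart_metric_def by (simp add: chart_inv)
qed

text \<open>Extend \<open>w\<close> to the field \<open>V\<close> with constant coefficients in the frame. The metrics agree on \<open>V\<close>
  and on the frame of the distribution, so the derivatives of \<open>h(V, V)\<close> and \<open>h(V, E b)\<close> agree
  with those for \<open>g\<close>. After inserting them into the two Euler-Lagrange expressions, the only
  remaining difference is in the products of \<open>w\<close> with the bracket \<open>[V, E b]\<close>.\<close>

lemma bracket_product_eq:
  fixes c f :: "nat \<Rightarrow> real" and \<alpha> :: 'e
  assumes h: "riemannian_metric A h" and mod: "preserving_modification A D g h" and q: "q \<in> U" and b: "b < m"
  defines "H \<equiv> chart_metric h" and "V \<equiv> \<lambda>y. \<Sum>a<m. c a *\<^sub>R E a y"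
  assumes acc: "\<alpha> = (\<Sum>a<m. c a *\<^sub>R \<D> (E a) (\<phi> q) (V (\<phi> q)) + f a *\<^sub>R E a (\<phi> q))"
    and nh: "G (\<phi> q) \<alpha> (E b (\<phi> q)) = 1/2 * form_derivative G (\<phi> q) (E b (\<phi> q)) (V (\<phi> q)) (V (\<phi> q))
      - form_derivative G (\<phi> q) (V (\<phi> q)) (V (\<phi> q)) (E b (\<phi> q))"
    and el: "form_derivative H (\<phi> q) (V (\<phi> q)) (V (\<phi> q)) (E b (\<phi> q)) + H (\<phi> q) \<alpha> (E b (\<phi> q))
      - 1/2 * form_derivative H (\<phi> q) (E b (\<phi> q)) (V (\<phi> q)) (V (\<phi> q)) = 0"
  defines "B \<equiv> \<Sum>a<m. c a *\<^sub>R (\<D> (E b) (\<phi> q) (E a (\<phi> q)) - \<D> (E a) (\<phi> q) (E b (\<phi> q)))"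
  shows "H (\<phi> q) (V (\<phi> q)) B = G (\<phi> q) (V (\<phi> q)) B"
proof -
  let ?y = "\<phi> q" and ?w = "V (\<phi> q)" and ?e = "E b (\<phi> q)"
  let ?D = "\<lambda>a. \<D> (E a) (\<phi> q)"
  define DV where "DV u = (\<Sum>a<m. c a *\<^sub>R ?D a u)" for u
  have y: "?y \<in> \<phi> ` U" using q by simp
  note Gf = chart_metric_smooth_form[OF metric] and Hf = chart_metric_smooth_form[OF h, folded H_def]
  note Gc = chart_metric_commute[OF metric y] and Hc = chart_metric_commute[OF h y, folded H_def]
  have dE: "(E a has_derivative ?D a) (at ?y)" if "a < m" for a
    using smooth_on_has_derivative[OF frame_smooth[of a]] y that m_le by simp
  have dV: "(V has_derivative DV) (at ?y)"
    unfolding V_def DV_def[abs_def] by (intro has_derivative_sum has_derivative_scaleR_right dE) simp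
  have V\<Delta>: "V y \<in> chart_distribution y" for y
    unfolding V_def chart_distribution_def by (intro span_sum span_scale span_base) auto
  have sameVV: "form_derivative H ?y u ?w ?w + 2 * H ?y (DV u) ?w = form_derivative G ?y u ?w ?w + 2 * G ?y (DV u) ?w" for u
  proof -
    have "((\<lambda>y. H y (V y) (V y)) has_derivative
        (\<lambda>u. form_derivative H ?y u ?w ?w + H ?y (DV u) ?w + H ?y ?w (DV u))) (at ?y)"
      by (rule form_has_derivative[OF Hf has_derivative_ident dV dV y])
    moreover have "((\<lambda>y. H y (V y) (V y)) has_derivative
        (\<lambda>u. form_derivative G ?y u ?w ?w + G ?y (DV u) ?w + G ?y ?w (DV u))) (at ?y)"
      by (rule has_derivative_transform_within_open[OF form_has_derivative[OF Gf has_derivative_ident dV dV y] open_image y])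
        (simp add: H_def modification_chart[OF mod] V\<Delta>)
    ultimately have "(\<lambda>u. form_derivative H ?y u ?w ?w + H ?y (DV u) ?w + H ?y ?w (DV u)) =
        (\<lambda>u. form_derivative G ?y u ?w ?w + G ?y (DV u) ?w + G ?y ?w (DV u))"
      by (rule has_derivative_unique)
    from fun_cong[OF this, of u] show ?thesis using Gc[of ?w "DV u"] Hc[of ?w "DV u"] by simp
  qed
  have sameVE: "form_derivative H ?y u ?w ?e + H ?y (DV u) ?e + H ?y ?w (?D b u) =
      form_derivative G ?y u ?w ?e + G ?y (DV u) ?e + G ?y ?w (?D b u)" for u
  proof -
    have "((\<lambda>y. H y (V y) (E b y)) has_derivative
        (\<lambda>u. form_derivative H ?y u ?w ?e + H ?y (DV u) ?e + H ?y ?w (?D b u))) (at ?y)"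
      by (rule form_has_derivative[OF Hf has_derivative_ident dV dE[OF b] y])
    moreover have "((\<lambda>y. H y (V y) (E b y)) has_derivative
        (\<lambda>u. form_derivative G ?y u ?w ?e + G ?y (DV u) ?e + G ?y ?w (?D b u))) (at ?y)"
      by (rule has_derivative_transform_within_open[OF form_has_derivative[OF Gf has_derivative_ident dV dE[OF b] y] open_image y])
        (simp add: H_def modification_chart[OF mod] V\<Delta> frame_in_distribution[OF b])
    ultimately have "(\<lambda>u. form_derivative H ?y u ?w ?e + H ?y (DV u) ?e + H ?y ?w (?D b u)) =
        (\<lambda>u. form_derivative G ?y u ?w ?e + G ?y (DV u) ?e + G ?y ?w (?D b u))"
      by (rule has_derivative_unique)
    from fun_cong[OF this, of u] show ?thesis .
  qed
  define f' where "f' = (\<Sum>a<m. f a *\<^sub>R E a ?y)"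
  have \<alpha>: "\<alpha> = DV ?w + f'" by (simp add: acc DV_def f'_def sum.distrib)
  have "f' \<in> chart_distribution ?y"
    unfolding f'_def chart_distribution_def by (intro span_sum span_scale span_base) auto
  then have same_f: "H ?y f' ?e = G ?y f' ?e"
    unfolding H_def by (rule modification_chart[OF mod y _ frame_in_distribution[OF b]])
  note Hb = smooth_form_bilinear[OF Hf y] and Gb = smooth_form_bilinear[OF Gf y]
  have "B = ?D b ?w - DV ?e"
  proof -
    have "linear (?D b)" by (rule has_derivative_linear[OF dE[OF b]])
    then have "?D b ?w = (\<Sum>a<m. c a *\<^sub>R ?D b (E a ?y))" by (simp add: V_def linear_sum linear_cmul)
    then show ?thesis by (simp add: B_def DV_def scaleR_diff_right sum_subtractf)
  qed
  then have "H ?y ?w B = H ?y ?w (?D b ?w) - H ?y (DV ?e) ?w" "G ?y ?w B = G ?y ?w (?D b ?w) - G ?y (DV ?e) ?w"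
    using Hc[of ?w "DV ?e"] Gc[of ?w "DV ?e"] by (simp_all add: bilinear_rsub[OF Hb] bilinear_rsub[OF Gb])
  moreover have "H ?y \<alpha> ?e = H ?y (DV ?w) ?e + H ?y f' ?e" "G ?y \<alpha> ?e = G ?y (DV ?w) ?e + G ?y f' ?e"
    by (simp_all add: \<alpha> bilinear_ladd[OF Hb] bilinear_ladd[OF Gb])
  ultimately show ?thesis using nh el sameVV[of ?e] sameVE[of ?w] same_f by linarith
qed

text \<open>The exponential map provides information on short vectors only, but the condition is
  homogeneous of degree two in \<open>v\<close>, so it may be tested on \<open>r v\<close> with small \<open>r\<close>. Expanding the bracket in the
  frame leaves the components transversal to the distribution: the others have the same product with \<open>v\<close> for both
  metrics.\<close>

lemma gauss_imp_bracket_condition: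
  assumes A: "smooth_manifold A" and q: "q \<in> U" and W: "exp_domain A g D \<Gamma> W" and R: "structure_functions A X R"
    and h: "riemannian_metric A h" and mod: "preserving_modification A D g h"
    and gauss: "\<And>v u. v \<in> W q \<Longrightarrow> u \<in> D q \<Longrightarrow>
      nh_exp_pullback A D \<Gamma> h q v v u = nh_exp_pullback A D \<Gamma> h q zero_vector v u"
    and c: "c < m"
  shows "(\<Sum>a<m. \<Sum>b<m. \<Sum>k\<in>{m..<DIM('e)}. h q (X b q) (X k q) * R k a c q * v a * v b) = 0"
proof -
  let ?n = "DIM('e)" and ?y = "\<phi> q"
  let ?H = "chart_metric h"
  obtain F S \<epsilon> y where motions: "exp_motions W q F S \<epsilon> y" using exp_motions_exist[OF A q W] by blast
  have yU: "?y \<in> \<phi> ` U" using q by simp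
  note Hb = smooth_form_bilinear[OF chart_metric_smooth_form[OF h] yU]
    and Gb = smooth_form_bilinear[OF chart_metric_smooth_form[OF metric] yU]
  define w where "w = (\<Sum>a<m. v a *\<^sub>R E a ?y)"
  have w\<Delta>: "w \<in> chart_distribution ?y"
    unfolding w_def chart_distribution_def by (intro span_sum span_scale span_base) auto
  define r where "r = \<epsilon> / (norm w + 1)"
  have \<epsilon>: "\<epsilon> > 0" by (rule motions_spray(7)[OF q motions])
  have r: "r > 0" using \<epsilon> by (simp add: r_def add_nonneg_pos)
  have "norm w * \<epsilon> < \<epsilon> * (norm w + 1)" using \<epsilon> by (simp add: algebra_simps)
  then have rw: "norm (r *\<^sub>R w) < \<epsilon>" using \<epsilon> by (simp add: r_def divide_less_eq add_nonneg_pos mult.commute)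
  have rw\<Delta>: "r *\<^sub>R w \<in> chart_distribution ?y" by (rule chart_distribution_closed(2)[OF w\<Delta>])
  obtain p f where p: "r *\<^sub>R w = (\<Sum>a<m. p a *\<^sub>R E a ?y)"
    "F ?y (r *\<^sub>R w) = (\<Sum>a<m. p a *\<^sub>R \<D> (E a) ?y (r *\<^sub>R w) + f a *\<^sub>R E a ?y)"
    "\<And>a. a < m \<Longrightarrow> G ?y (F ?y (r *\<^sub>R w)) (E a ?y) =
      1/2 * form_derivative G ?y (E a ?y) (r *\<^sub>R w) (r *\<^sub>R w) - form_derivative G ?y (r *\<^sub>R w) (r *\<^sub>R w) (E a ?y)"
    using motions rw rw\<Delta> unfolding exp_motions_def exp_motion_def nonholonomic_acceleration_def by blast
  have pv: "p a = r * v a" if a: "a < m" for a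
  proof -
    have ext: "(\<Sum>a<?n. (if a < m then d a else 0) *\<^sub>R E a ?y) = (\<Sum>a<m. d a *\<^sub>R E a ?y)" for d
      by (rule sum.mono_neutral_cong_right) (use m_le in auto)
    have "(\<Sum>a<?n. (if a < m then p a else 0) *\<^sub>R E a ?y) = (\<Sum>a<?n. (if a < m then r * v a else 0) *\<^sub>R E a ?y)"
      unfolding ext using p(1) by (simp add: w_def scaleR_sum_right)
    from frame_coefficients_unique[OF q this, of a] show ?thesis using a m_le by simp
  qed
  define B where "B = (\<Sum>a<m. p a *\<^sub>R (\<D> (E c) ?y (E a ?y) - \<D> (E a) ?y (E c ?y)))"
  have HB: "?H ?y (r *\<^sub>R w) B = G ?y (r *\<^sub>R w) B"
    using bracket_product_eq[OF h mod q c, of "F ?y (r *\<^sub>R w)" p f] p(2) p(3)[OF c]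
      gauss_imp_euler_lagrange[OF q motions h gauss rw\<Delta> rw frame_in_distribution[OF c]]
    unfolding p(1)[symmetric] B_def[symmetric] by simp
  define s where "s k = (\<Sum>a<m. p a * R k a c q)" for k
  have "B = (\<Sum>a<m. p a *\<^sub>R (\<Sum>k<?n. R k a c q *\<^sub>R E k ?y))"
    unfolding B_def by (rule sum.cong) (use bracket_chart[OF R q] c m_le in auto)
  also have "\<dots> = (\<Sum>a<m. \<Sum>k<?n. (p a * R k a c q) *\<^sub>R E k ?y)" by (simp add: scaleR_sum_right)
  also have "\<dots> = (\<Sum>k<?n. s k *\<^sub>R E k ?y)"
    by (subst sum.swap) (simp add: s_def scaleR_sum_left)
  finally have B: "B = (\<Sum>k<?n. s k *\<^sub>R E k ?y)" .
  have expand: "L (r *\<^sub>R w) B = (\<Sum>k<?n. s k * (r * L w (E k ?y)))" if "bilinear L" for L :: "'e \<Rightarrow> 'e \<Rightarrow> real"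
  proof -
    have "linear (L w)" using that by (simp add: bilinear_def)
    then have "L w B = (\<Sum>k<?n. s k * L w (E k ?y))"
      unfolding B by (simp add: linear_sum[of "L w"] linear_cmul[of "L w"])
    then show ?thesis by (simp add: bilinear_lmul[OF that] sum_distrib_left mult_ac)
  qed
  have "(\<Sum>k<?n. s k * (r * (?H ?y w (E k ?y) - G ?y w (E k ?y)))) = 0"
    using HB expand[OF Hb] expand[OF Gb] by (simp add: right_diff_distrib sum_subtractf)
  also have "(\<Sum>k<?n. s k * (r * (?H ?y w (E k ?y) - G ?y w (E k ?y)))) = (\<Sum>k\<in>{m..<?n}. s k * (r * ?H ?y w (E k ?y)))"
    by (rule sum.mono_neutral_cong_right)
      (auto simp: frame_orthogonal[OF q _ _ w\<Delta>] modification_chart[OF mod yU w\<Delta> frame_in_distribution])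
  finally have sum0: "(\<Sum>k\<in>{m..<?n}. s k * (r * ?H ?y w (E k ?y))) = 0" .
  have "(\<Sum>k\<in>{m..<?n}. (\<Sum>a<m. v a * R k a c q) * ?H ?y w (E k ?y)) = 0"
  proof -
    have s: "s k = r * (\<Sum>a<m. v a * R k a c q)" for k
      unfolding s_def sum_distrib_left by (rule sum.cong) (simp_all add: pv)
    have "(\<Sum>k\<in>{m..<?n}. s k * (r * ?H ?y w (E k ?y))) = r\<^sup>2 * (\<Sum>k\<in>{m..<?n}. (\<Sum>a<m. v a * R k a c q) * ?H ?y w (E k ?y))"
      unfolding sum_distrib_left[of "r\<^sup>2"] by (rule sum.cong) (simp_all add: s power2_eq_square)
    then show ?thesis using r sum0 by simp
  qed
  also have "(\<Sum>k\<in>{m..<?n}. (\<Sum>a<m. v a * R k a c q) * ?H ?y w (E k ?y)) =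
      (\<Sum>k\<in>{m..<?n}. \<Sum>a<m. \<Sum>b<m. h q (X b q) (X k q) * R k a c q * v a * v b)"
  proof (rule sum.cong)
    fix k assume k: "k \<in> {m..<?n}"
    have "?H ?y w (E k ?y) = (\<Sum>b<m. v b * ?H ?y (E b ?y) (E k ?y))"
    proof -
      have "linear (\<lambda>u. ?H ?y u (E k ?y))" using Hb by (simp add: bilinear_def)
      then show ?thesis unfolding w_def by (simp add: linear_sum[of "\<lambda>u. ?H ?y u (E k ?y)"] bilinear_lmul[OF Hb])
    qed
    also have "\<dots> = (\<Sum>b<m. v b * h q (X b q) (X k q))"
    proof (rule sum.cong)
      fix b assume "b \<in> {..<m}"
      then show "v b * ?H ?y (E b ?y) (E k ?y) = v b * h q (X b q) (X k q)"
        using metric_chart[OF q frame_tangent[OF q] frame_tangent[OF q], of b k h] m_le k by (simp add: coord_frame[OF q])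
    qed simp
    finally show "(\<Sum>a<m. v a * R k a c q) * ?H ?y w (E k ?y) = (\<Sum>a<m. \<Sum>b<m. h q (X b q) (X k q) * R k a c q * v a * v b)"
      by (simp add: sum_product mult_ac)
  qed simp
  also have "\<dots> = (\<Sum>a<m. \<Sum>b<m. \<Sum>k\<in>{m..<?n}. h q (X b q) (X k q) * R k a c q * v a * v b)"
    by (subst sum.swap, rule sum.cong[OF refl], rule sum.swap)
  finally show ?thesis .
qed

end

theorem proposition8:
  fixes A :: "('q, 'e::euclidean_space) atlas"
    and g g_hat :: "'q \<Rightarrow> 'q tangent \<Rightarrow> 'q tangent \<Rightarrow> real"
    and m :: nat
    and D W :: "'q \<Rightarrow> 'q tangent set"
    and X :: "nat \<Rightarrow> 'q \<Rightarrow> 'q tangent"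
    and R :: "nat \<Rightarrow> nat \<Rightarrow> nat \<Rightarrow> 'q \<Rightarrow> real"
    and \<Gamma> :: "'q \<times> 'q tangent \<Rightarrow> ('q \<times> 'q tangent) tangent"
  assumes "smooth_manifold A"
    and "riemannian_metric A g"
    and "adapted_frame A g m D X"
    and "structure_functions A X R"
    and "nonholonomic_vector_field A (kinetic_lagrangian g) m D X \<Gamma>"
    and "exp_domain A g D \<Gamma> W"
    and "riemannian_metric A g_hat"
    and "preserving_modification A D g g_hat"
    and "\<forall>q\<in>carrier A. \<forall>v\<in>W q. \<forall>u\<in>D q.
      nh_exp_pullback A D \<Gamma> g_hat q v v u = nh_exp_pullback A D \<Gamma> g_hat q zero_vector v u"
  shows "\<forall>q\<in>carrier A. \<forall>c<m. \<forall>v :: nat \<Rightarrow> real.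
    (\<Sum>a<m. \<Sum>b<m. \<Sum>k\<in>{m..<DIM('e)}. g_hat q (X b q) (X k q) * R k a c q * v a * v b) = 0"
proof (intro ballI allI impI)
  fix q c and v :: "nat \<Rightarrow> real"
  assume q: "q \<in> carrier A" and c: "c < m"
  obtain U \<phi> where U: "(U, \<phi>) \<in> A" "q \<in> U" using q unfolding carrier_def by auto
  interpret nonholonomic_chart A U \<phi> g m D X \<Gamma>
    by unfold_locales (use assms U in \<open>auto simp: smooth_manifold_def\<close>)
  show "(\<Sum>a<m. \<Sum>b<m. \<Sum>k\<in>{m..<DIM('e)}. g_hat q (X b q) (X k q) * R k a c q * v a * v b) = 0"
    by (rule gauss_imp_bracket_condition[OF assms(1) U(2) assms(6,4,7,8) _ c]) (use assms(9) q in blast)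
qed

end
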